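(* Let $d\ge1$, let $X_1,\dots,X_n\in\mathbb{R}^d$ be fixed, let $\pi^*$ be an unknown permutation of $\{1,\dots,n\}$ and let $Y_i=f^*(X_{\pi^*(i)})+\epsilon_i$, $1\le i\le n$, where $\epsilon_1,\dots,\epsilon_n$ are i.i.d. $N(0,\sigma^2I_d)$ with $\sigma>0$ known. Assume $f^*=\nabla\psi_{f^*}$ for a differentiable $\psi_{f^*}:\mathbb{R}^d\to\mathbb{R}$ satisfying: (A1) $\psi_{f^*}(z)\ge\psi_{f^*}(x)+\langle\nabla\psi_{f^*}(x),z-x\rangle+\frac{\lambda}{2}\|x-z\|_2^2$ for all $x,z$ (some $\lambda>0$); (A2) $\psi_{f^*}(z)\le\psi_{f^*}(x)+\langle\nabla\psi_{f^*}(x),z-x\rangle+\frac{L}{2}\|x-z\|_2^2$ for all $x,z$ (some $L>0$); (A3) $\max_{1\le i\le n}\|f^*(X_i)\|_2\le B$ for some $0<B<\infty$. Let $\widehat f(X_1),\dots,\widehat f(X_n)$ be the output of the denoising procedure described in the context. Then there are constants $C_0,C>0$ depending only on $d,B,\sigma$ such that if $n\ge C_0(\log n)^{d+1}$, then with probability at least $1-5/n$, $$\frac1n\sum_{i=1}^n\|\widehat f(X_i)-f^*(X_i)\|_2^2\le C\,\frac{L}{\lambda}\,\frac{1}{\log n}.$$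
   Context: Let $\varphi_\sigma$ denote the density of $N(0,\sigma^2I_d)$. Denoising procedure: (1) Compute the Kiefer–Wolfowitz nonparametric maximum likelihood estimator (NPMLE), i.e. a minimizer $\widehat{\mathsf f}_n$ of $-\sum_{i=1}^n\log\mathsf f(Y_i)$ over all densities of the form $\mathsf f(y)=\int\varphi_\sigma(y-\theta)\,d\nu(\theta)$ with $\nu$ a probability distribution on $\mathbb{R}^d$; the associated mixing measure is atomic, $\widehat\nu=\sum_{j=1}^p\widehat\alpha_j\delta_{\widehat\theta_j}$ with $\widehat\alpha_j>0$, $\sum_j\widehat\alpha_j=1$. (2) Compute an optimal coupling matrix $\widehat\Gamma\in\mathbb{R}_+^{n\times p}$ minimizing $\sum_{i,j}\Gamma_{ij}\frac12\|X_i-\widehat\theta_j\|_2^2$ subject to $\sum_i\Gamma_{ij}=\widehat\alpha_j$ for all $j$ and $\sum_j\Gamma_{ij}=1/n$ for all $i$. (3) Output the barycentric projection $\widehat f(X_i)=n\sum_{j=1}^p\widehat\Gamma_{ij}\widehat\theta_j$, $1\le i\le n$. *)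

theory Defs
  imports "HOL-Probability.Probability"
begin

definition gdens :: "real \<Rightarrow> 'a::euclidean_space \<Rightarrow> real" where
  "gdens \<sigma> y = (2 * pi * \<sigma>\<^sup>2) powr (- real DIM('a) / 2) * exp (- (norm y)\<^sup>2 / (2 * \<sigma>\<^sup>2))"

definition gauss_vec :: "real \<Rightarrow> 'a::euclidean_space measure" where
  "gauss_vec \<sigma> = density lborel (\<lambda>y. ennreal (gdens \<sigma> y))"

definition mixture_dens :: "real \<Rightarrow> 'a::euclidean_space measure \<Rightarrow> 'a \<Rightarrow> real" where
  "mixture_dens \<sigma> \<nu> y = (\<integral>\<theta>. gdens \<sigma> (y - \<theta>) \<partial>\<nu>)"

text \<open>(p, alpha, theta) is an atomic Kiefer--Wolfowitz NPMLE for the data Y_0..Y_{n-1}: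
  the atomic mixing distribution sum_j alpha_j delta_{theta_j} maximises the log-likelihood
  over all Borel probability measures on R^d.\<close>
definition is_npmle :: "real \<Rightarrow> nat \<Rightarrow> (nat \<Rightarrow> 'a::euclidean_space) \<Rightarrow> nat \<Rightarrow> (nat \<Rightarrow> real) \<Rightarrow> (nat \<Rightarrow> 'a) \<Rightarrow> bool" where
  "is_npmle \<sigma> n Y p \<alpha> \<theta> \<longleftrightarrow>
     (\<forall>j<p. \<alpha> j > 0) \<and> (\<Sum>j<p. \<alpha> j) = 1 \<and>
     (\<forall>\<nu>. prob_space \<nu> \<and> sets \<nu> = sets borel \<longrightarrow>
        - (\<Sum>i<n. ln (\<Sum>j<p. \<alpha> j * gdens \<sigma> (Y i - \<theta> j)))
        \<le> - (\<Sum>i<n. ln (mixture_dens \<sigma> \<nu> (Y i))))"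

definition is_coupling :: "nat \<Rightarrow> nat \<Rightarrow> (nat \<Rightarrow> real) \<Rightarrow> (nat \<Rightarrow> nat \<Rightarrow> real) \<Rightarrow> bool" where
  "is_coupling n p \<alpha> \<Gamma> \<longleftrightarrow>
     (\<forall>i<n. \<forall>j<p. \<Gamma> i j \<ge> 0) \<and>
     (\<forall>j<p. (\<Sum>i<n. \<Gamma> i j) = \<alpha> j) \<and>
     (\<forall>i<n. (\<Sum>j<p. \<Gamma> i j) = 1 / real n)"

definition coupling_cost :: "nat \<Rightarrow> nat \<Rightarrow> (nat \<Rightarrow> 'a::euclidean_space) \<Rightarrow> (nat \<Rightarrow> 'a) \<Rightarrow> (nat \<Rightarrow> nat \<Rightarrow> real) \<Rightarrow> real" where
  "coupling_cost n p X \<theta> \<Gamma> = (\<Sum>i<n. \<Sum>j<p. \<Gamma> i j * ((1/2) * (norm (X i - \<theta> j))\<^sup>2))"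

definition is_opt_coupling :: "nat \<Rightarrow> nat \<Rightarrow> (nat \<Rightarrow> 'a::euclidean_space) \<Rightarrow> (nat \<Rightarrow> 'a) \<Rightarrow> (nat \<Rightarrow> real) \<Rightarrow> (nat \<Rightarrow> nat \<Rightarrow> real) \<Rightarrow> bool" where
  "is_opt_coupling n p X \<theta> \<alpha> \<Gamma> \<longleftrightarrow> is_coupling n p \<alpha> \<Gamma> \<and>
     (\<forall>\<Gamma>'. is_coupling n p \<alpha> \<Gamma>' \<longrightarrow> coupling_cost n p X \<theta> \<Gamma> \<le> coupling_cost n p X \<theta> \<Gamma>')"

definition bary_proj :: "nat \<Rightarrow> nat \<Rightarrow> (nat \<Rightarrow> nat \<Rightarrow> real) \<Rightarrow> (nat \<Rightarrow> 'a::euclidean_space) \<Rightarrow> nat \<Rightarrow> 'a" where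
  "bary_proj n p \<Gamma> \<theta> i = real n *\<^sub>R (\<Sum>j<p. \<Gamma> i j *\<^sub>R \<theta> j)"

end

theory Submission
  imports Defs "HOL-Real_Asymp.Real_Asymp"
begin

text \<open>
  By the Bregman estimates for \<open>\<psi>\<close>, the error of the barycentric projection is at most \<open>L / \<lambda>\<close> times the
  transport cost of any coupling between the law of the \<open>f (X i)\<close> and the estimated mixing measure, so
  it suffices to find one of cost \<open>O(1 / log n)\<close>.

  Writing \<open>fs\<close> and \<open>fh\<close> for the true and the estimated mixture density, the likelihood inequality and
  \<open>ln x \<le> x - 1 - (sqrt x - 1)\<^sup>2\<close> bound the empirical Hellinger distance of \<open>fh\<close> from \<open>fs\<close> on a ball of
  radius \<open>\<sigma> sqrt (ln n / 8)\<close>. All empirical averages involved are linear in the mixing measure, so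
  Hoeffding's inequality on a grid of atoms is enough for uniformity, and the characteristic functions
  of \<open>fh\<close> and \<open>fs\<close> differ by a negative power of \<open>n\<close>. Dividing by the Gaussian factor keeps a negative power
  for the mixing measures at frequencies of order \<open>sqrt (ln n)\<close>.

  The atoms lie in the ball spanned by the data, of radius \<open>O(sqrt (ln n))\<close>. Both mixing measures are smoothed
  by Fejer--Korovkin kernels of degree of order \<open>ln n\<close> on a torus of that size: the smoothing costs
  \<open>O(1 / log n)\<close>, and the smoothed measures differ by a negative power of \<open>n\<close> in total variation.
\<close>

subsection \<open>Gaussian densities\<close>

text \<open>The rate is dictated by deconvolution: at frequency t the mixing measure is recovered
  only after multiplication by \<open>exp (\<sigma>\<^sup>2 * (norm t)\<^sup>2 / 2)\<close>. A
  polynomially small error for the densities therefore affords only frequencies up to a small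
  multiple of sqrt(ln n), that is, a spatial resolution of order 1 / sqrt(ln n), and squaring gives
  1 / ln n. The obstacle to uniformity over the estimator is that the ratio of
  \<open>gdens \<sigma> (y - \<theta>)\<close> to the true density may be unbounded in y. Truncation
  to a ball caps it by a constant times n^(1/8), small enough for Hoeffding's inequality with
  deviation n^(-1/4), while a mass of order at most n^(-1/64) is left outside. The good event is
  fixed before the estimator and works for every NPMLE at once, so measurability of the estimator
  never arises. The exponents are not optimised: it is enough that some negative power of n survives
  to beat the powers of ln n.\<close>

lemma gdens_eq_prod_normal_density:
  fixes y :: "'a::euclidean_space"
  assumes "\<sigma> > 0"
  shows "gdens \<sigma> y = (\<Prod>b\<in>Basis. normal_density 0 \<sigma> (y \<bullet> b))"
proof -
  have "(\<Prod>b\<in>(Basis::'a set). 1 / sqrt (2 * pi * \<sigma>\<^sup>2)) = (2 * pi * \<sigma>\<^sup>2) powr (- real DIM('a) / 2)"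
  proof -
    have "1 / sqrt (2 * pi * \<sigma>\<^sup>2) = (2 * pi * \<sigma>\<^sup>2) powr (-1/2)"
      using assms by (simp add: powr_minus_divide powr_half_sqrt)
    hence "(\<Prod>b\<in>(Basis::'a set). 1 / sqrt (2 * pi * \<sigma>\<^sup>2)) = ((2 * pi * \<sigma>\<^sup>2) powr (-1/2)) powr real DIM('a)"
      using assms by (simp only: prod_constant) (subst powr_realpow, auto)
    thus ?thesis by (simp only: powr_powr) simp
  qed
  moreover have "(\<Prod>b\<in>Basis. exp (-(y \<bullet> b)\<^sup>2 / (2 * \<sigma>\<^sup>2))) = exp (- (norm y)\<^sup>2 / (2 * \<sigma>\<^sup>2))"
  proof -
    have "(norm y)\<^sup>2 = (\<Sum>b\<in>Basis. (y \<bullet> b)\<^sup>2)"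
      unfolding power2_norm_eq_inner euclidean_inner[of y y] by (simp add: power2_eq_square)
    thus ?thesis
      by (simp add: exp_sum[symmetric] sum_negf sum_divide_distrib[symmetric])
  qed
  ultimately show ?thesis
    unfolding gdens_def normal_density_def diff_zero prod.distrib by simp
qed

lemma gdens_pos: "\<sigma> > 0 \<Longrightarrow> gdens \<sigma> y > 0"
  by (simp add: gdens_def)

lemma gdens_nonneg [simp]: "gdens \<sigma> y \<ge> 0"
  by (simp add: gdens_def)

lemma borel_measurable_gdens [measurable]: "gdens \<sigma> \<in> borel_measurable borel"
  unfolding gdens_def by measurable

lemma normal_density_char:
  assumes "\<sigma> > 0"
  shows "integrable lborel (\<lambda>x. normal_density 0 \<sigma> x *\<^sub>R cis (t * x))"
    and "(\<integral>x. normal_density 0 \<sigma> x *\<^sub>R cis (t * x) \<partial>lborel) = complex_of_real (exp (- \<sigma>\<^sup>2 * t\<^sup>2 / 2))"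
proof -
  show "integrable lborel (\<lambda>x. normal_density 0 \<sigma> x *\<^sub>R cis (t * x))"
    by (rule Bochner_Integration.integrable_bound[OF integrable_normal_density[OF assms, of 0]])
       (auto simp: cis_conv_exp)
  have scale: "normal_density 0 \<sigma> (\<sigma> * x) = std_normal_density x / \<sigma>" for x
    using assms by (simp add: normal_density_def real_sqrt_mult field_simps power_mult_distrib)
  have "(\<integral>x. normal_density 0 \<sigma> x *\<^sub>R cis (t * x) \<partial>lborel)
      = (\<integral>x. std_normal_density x *\<^sub>R cis ((\<sigma> * t) * x) \<partial>lborel)"
    using assms
    by (subst lborel_integral_real_affine[where c=\<sigma> and t=0])
       (auto simp: scale simp flip: integral_scaleR_right intro!: Bochner_Integration.integral_cong, simp add: mult_ac)
  also have "\<dots> = char std_normal_distribution (\<sigma> * t)"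
    unfolding char_def by (subst integral_density) (auto simp: cis_conv_exp mult_ac)
  finally show "(\<integral>x. normal_density 0 \<sigma> x *\<^sub>R cis (t * x) \<partial>lborel) = complex_of_real (exp (- \<sigma>\<^sup>2 * t\<^sup>2 / 2))"
    by (simp add: char_std_normal_distribution power_mult_distrib)
qed

text \<open>Lebesgue measure is the image of the product measure over \<open>Basis\<close>, and both
  \<open>gdens\<close> and \<open>cis\<close> factor over the coordinates, so the integral is a
  product of one-dimensional characteristic functions.\<close>

lemma has_integral_gdens_cis:
  fixes t :: "'a::euclidean_space"
  assumes "\<sigma> > 0"
  shows "has_bochner_integral lborel (\<lambda>y. gdens \<sigma> y *\<^sub>R cis (t \<bullet> y)) (complex_of_real (exp (- \<sigma>\<^sup>2 * (norm t)\<^sup>2 / 2)))"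
proof -
  interpret product_sigma_finite "\<lambda>_::'a. lborel :: real measure" ..
  let ?F = "\<lambda>b x. normal_density 0 \<sigma> x *\<^sub>R cis ((t \<bullet> b) * x)"
  let ?T = "\<lambda>f. \<Sum>b\<in>Basis. f b *\<^sub>R (b::'a)"
  have meas: "?T \<in> measurable (\<Pi>\<^sub>M b\<in>Basis. lborel) borel"
    by measurable
  have eq: "gdens \<sigma> y *\<^sub>R cis (t \<bullet> y) = (\<Prod>b\<in>Basis. ?F b (y \<bullet> b))" for y :: 'a
    unfolding gdens_eq_prod_normal_density[OF assms] euclidean_inner[of t y] scaleR_conv_of_real
    by (simp add: prod.distrib cis_conv_exp sum_distrib_left exp_sum mult_ac)
  have eq': "(\<Prod>b\<in>Basis. ?F b (?T f \<bullet> b)) = (\<Prod>b\<in>Basis. ?F b (f b))" for f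
    by (intro prod.cong) auto
  have cm: "(\<lambda>y::'a. \<Prod>b\<in>Basis. ?F b (y \<bullet> b)) \<in> borel_measurable borel"
    unfolding eq[symmetric] by (auto simp: cis_conv_exp intro!: borel_measurable_scaleR borel_measurable_continuous_onI continuous_intros)
  have int: "integrable (\<Pi>\<^sub>M b\<in>Basis. lborel) (\<lambda>f. \<Prod>b\<in>Basis. ?F b (f b))"
    by (rule product_integrable_prod) (auto intro: normal_density_char[OF assms])
  have "(\<integral>f. (\<Prod>b\<in>Basis. ?F b (f b)) \<partial>(\<Pi>\<^sub>M b\<in>Basis. lborel)) = (\<Prod>b\<in>Basis. complex_of_real (exp (- \<sigma>\<^sup>2 * (t \<bullet> b)\<^sup>2 / 2)))"
    by (subst product_integral_prod) (auto intro: normal_density_char[OF assms] simp: normal_density_char(2)[OF assms])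
  also have "\<dots> = complex_of_real (exp (- \<sigma>\<^sup>2 * (norm t)\<^sup>2 / 2))"
    unfolding power2_norm_eq_inner euclidean_inner[of t t]
    by (simp add: power2_eq_square exp_sum[symmetric] sum_distrib_left sum_negf sum_divide_distrib
         flip: of_real_prod)
  finally have val: "(\<integral>f. (\<Prod>b\<in>Basis. ?F b (f b)) \<partial>(\<Pi>\<^sub>M b\<in>Basis. lborel)) = \<dots>" .
  show ?thesis
    unfolding has_bochner_integral_iff eq
    by (subst (1 2) lborel_eq) (simp add: integrable_distr_eq[OF meas cm] integral_distr[OF meas cm] eq' int val)
qed

lemma has_integral_gdens_shift_cis:
  fixes t :: "'a::euclidean_space"
  assumes "\<sigma> > 0"
  shows "has_bochner_integral lborel (\<lambda>y. gdens \<sigma> (y - \<theta>) *\<^sub>R cis (t \<bullet> y))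
           (exp (- \<sigma>\<^sup>2 * (norm t)\<^sup>2 / 2) *\<^sub>R cis (t \<bullet> \<theta>))"
proof -
  have "has_bochner_integral lborel (\<lambda>y. cis (t \<bullet> \<theta>) * (gdens \<sigma> y *\<^sub>R cis (t \<bullet> y)))
      (cis (t \<bullet> \<theta>) * complex_of_real (exp (- \<sigma>\<^sup>2 * (norm t)\<^sup>2 / 2)))"
    by (intro has_bochner_integral_mult_right has_integral_gdens_cis assms)
  moreover have "cis (t \<bullet> \<theta>) * (gdens \<sigma> y *\<^sub>R cis (t \<bullet> y)) = gdens \<sigma> ((\<theta> + y) - \<theta>) *\<^sub>R cis (t \<bullet> (\<theta> + y))" for y
    by (simp add: inner_add_right cis_mult)
  ultimately have *: "has_bochner_integral lborel (\<lambda>y. gdens \<sigma> ((\<theta> + y) - \<theta>) *\<^sub>R cis (t \<bullet> (\<theta> + y)))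
           (exp (- \<sigma>\<^sup>2 * (norm t)\<^sup>2 / 2) *\<^sub>R cis (t \<bullet> \<theta>))"
    by (simp only: scaleR_conv_of_real mult_ac)
  have cm: "(\<lambda>y. gdens \<sigma> (y - \<theta>) *\<^sub>R cis (t \<bullet> y)) \<in> borel_measurable borel"
    by (auto simp: cis_conv_exp intro!: borel_measurable_scaleR borel_measurable_continuous_onI continuous_intros)
  show ?thesis
    using * unfolding has_bochner_integral_iff
    by (subst (1 2) lborel_distr_plus[of \<theta>, symmetric])
       (simp add: integrable_distr_eq[OF _ cm] integral_distr[OF _ cm])
qed

lemma has_integral_gdens_shift:
  fixes \<theta> :: "'a::euclidean_space"
  assumes "\<sigma> > 0"
  shows "has_bochner_integral lborel (\<lambda>y. gdens \<sigma> (y - \<theta>)) 1"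
proof -
  have "has_bochner_integral lborel (\<lambda>y. complex_of_real (gdens \<sigma> (y - \<theta>))) 1"
    using has_integral_gdens_shift_cis[OF assms, of \<theta> 0] by (simp add: scaleR_conv_of_real)
  thus ?thesis
    using has_bochner_integral_bounded_linear[OF bounded_linear_Re] by fastforce
qed

lemma integrable_gdens_shift_bounded:
  fixes h :: "'a::euclidean_space \<Rightarrow> real"
  assumes "\<sigma> > 0" and [measurable]: "h \<in> borel_measurable borel" and "\<And>y. \<bar>h y\<bar> \<le> b"
  shows "integrable lborel (\<lambda>y. h y * gdens \<sigma> (y - \<theta>))"
proof (rule Bochner_Integration.integrable_bound)
  show "integrable lborel (\<lambda>y. b * gdens \<sigma> (y - \<theta>))"
    using has_integral_gdens_shift[OF assms(1), of \<theta>] by (auto simp: has_bochner_integral_iff)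
  show "AE x in lborel. norm (h x * gdens \<sigma> (x - \<theta>)) \<le> norm (b * gdens \<sigma> (x - \<theta>))"
    using assms(3) by (auto simp: abs_mult intro!: mult_right_mono order_trans[OF assms(3)])
qed auto

lemma sets_gauss_vec [simp, measurable_cong]: "sets (gauss_vec \<sigma>) = sets borel"
  by (simp add: gauss_vec_def)

lemma space_gauss_vec [simp]: "space (gauss_vec \<sigma>) = UNIV"
  by (simp add: gauss_vec_def)

lemma prob_space_gauss_vec:
  assumes "\<sigma> > 0"
  shows "prob_space (gauss_vec \<sigma> :: 'a::euclidean_space measure)"
proof
  have "has_bochner_integral lborel (gdens \<sigma> :: 'a \<Rightarrow> real) 1"
    using has_integral_gdens_shift[OF assms, of 0] by simp
  hence "(\<integral>\<^sup>+y. ennreal (gdens \<sigma> (y::'a)) \<partial>lborel) = 1"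
    by (auto simp: has_bochner_integral_iff nn_integral_eq_integral)
  thus "emeasure (gauss_vec \<sigma> :: 'a measure) (space (gauss_vec \<sigma>)) = 1"
    by (simp add: gauss_vec_def emeasure_density)
qed

text \<open>Turns an expectation over the noise around a centre into an integral against a shifted
  density; averaging over the centres then produces the mixture density.\<close>

lemma integral_gauss_vec_shift:
  fixes g :: "'a::euclidean_space \<Rightarrow> real"
  assumes [measurable]: "g \<in> borel_measurable borel"
  shows "(\<integral>e. g (a + e) \<partial>gauss_vec \<sigma>) = (\<integral>y. g y * gdens \<sigma> (y - a) \<partial>lborel)"
proof -
  have "(\<integral>e. g (a + e) \<partial>gauss_vec \<sigma>) = (\<integral>e. gdens \<sigma> e * g (a + e) \<partial>lborel)"
    unfolding gauss_vec_def by (subst integral_density) auto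
  also have "\<dots> = (\<integral>y. g y * gdens \<sigma> (y - a) \<partial>distr lborel borel ((+) a))"
    by (subst integral_distr) (auto simp: mult_ac)
  finally show ?thesis by (simp only: lborel_distr_plus)
qed

text \<open>Tilting a Gaussian by \<open>exp (|y|\<^sup>2 / 4\<sigma>\<^sup>2)\<close> gives a multiple of the Gaussian of variance \<open>2\<sigma>\<^sup>2\<close>.\<close>
lemma gauss_vec_norm_tail:
  fixes r \<sigma> :: real
  assumes "\<sigma> > 0" "r \<ge> 0"
  shows "measure (gauss_vec \<sigma> :: 'a::euclidean_space measure) {e. norm e > r}
           \<le> 2 powr (real DIM('a) / 2) * exp (- r\<^sup>2 / (4 * \<sigma>\<^sup>2))"
proof -
  interpret prob_space "gauss_vec \<sigma> :: 'a measure" by (rule prob_space_gauss_vec[OF assms(1)])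
  let ?c = "2 powr (real DIM('a) / 2) * exp (- r\<^sup>2 / (4 * \<sigma>\<^sup>2))"
  let ?s = "sqrt 2 * \<sigma>"
  have s: "?s > 0" using assms by simp
  have "measure (gauss_vec \<sigma>) {e::'a. norm e > r} = (\<integral>e. indicator {e::'a. norm e > r} e \<partial>gauss_vec \<sigma>)"
    by simp
  also have "\<dots> = (\<integral>(y::'a). indicator {e. norm e > r} y * gdens \<sigma> y \<partial>lborel)"
    using integral_gauss_vec_shift[of "indicator {e::'a. norm e > r}" \<sigma> 0] by simp
  also have "\<dots> \<le> (\<integral>(y::'a). ?c * gdens ?s (y - 0) \<partial>lborel)"
  proof (rule integral_mono)
    show "integrable lborel (\<lambda>y::'a. indicator {e. norm e > r} y * gdens \<sigma> y)"
      using integrable_gdens_shift_bounded[OF assms(1), of "indicator {e::'a. norm e > r}" 1 0]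
      by (auto simp: indicator_def)
    show "integrable lborel (\<lambda>y::'a. ?c * gdens ?s (y - 0))"
      using has_integral_gdens_shift[OF s, of "0::'a"] by (auto simp: has_bochner_integral_iff)
    fix y :: 'a
    have "gdens \<sigma> y \<le> ?c * gdens ?s y" if "norm y > r"
    proof -
      have "r\<^sup>2 \<le> (norm y)\<^sup>2" using that assms by (intro power_mono) auto
      hence e: "exp (- (norm y)\<^sup>2 / (2 * \<sigma>\<^sup>2)) \<le> exp (- r\<^sup>2 / (4 * \<sigma>\<^sup>2)) * exp (- (norm y)\<^sup>2 / (2 * ?s\<^sup>2))"
        using assms by (simp add: power_mult_distrib field_simps flip: exp_add)
      \<comment> \<open>The factor \<open>2 powr (real DIM('a) / 2)\<close> is the ratio of the
        normalising constant for variance \<open>\<sigma>\<^sup>2\<close> to the one for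
        \<open>2 * \<sigma>\<^sup>2\<close>.\<close>
      have "(2 * pi * \<sigma>\<^sup>2) powr (- real DIM('a) / 2)
          = (2 * pi * \<sigma>\<^sup>2) powr (- real DIM('a) / 2) * (2 powr (real DIM('a) / 2) * 2 powr (- real DIM('a) / 2))"
        by (simp flip: powr_add)
      also have "\<dots> = 2 powr (real DIM('a) / 2) * (2 * pi * ?s\<^sup>2) powr (- real DIM('a) / 2)"
      proof -
        have "2 * pi * ?s\<^sup>2 = (2 * pi * \<sigma>\<^sup>2) * 2" by (simp add: power_mult_distrib)
        thus ?thesis by (simp only: powr_mult mult_ac)
      qed
      finally have "gdens \<sigma> y = 2 powr (real DIM('a) / 2) * (2 * pi * ?s\<^sup>2) powr (- real DIM('a) / 2)
          * exp (- (norm y)\<^sup>2 / (2 * \<sigma>\<^sup>2))"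
        unfolding gdens_def by simp
      also have "\<dots> \<le> 2 powr (real DIM('a) / 2) * (2 * pi * ?s\<^sup>2) powr (- real DIM('a) / 2)
          * (exp (- r\<^sup>2 / (4 * \<sigma>\<^sup>2)) * exp (- (norm y)\<^sup>2 / (2 * ?s\<^sup>2)))"
        by (rule mult_left_mono[OF e]) simp
      finally show ?thesis
        unfolding gdens_def by (simp only: mult_ac)
    qed
    thus "indicator {e. norm e > r} y * gdens \<sigma> y \<le> ?c * gdens ?s (y - 0)"
      by (auto simp: indicator_def)
  qed
  also have "\<dots> = ?c"
    using has_integral_gdens_shift[OF s, of "0::'a"] by (auto simp: has_bochner_integral_iff)
  finally show ?thesis .
qed

lemma gdens_le: "gdens \<sigma> (y::'a::euclidean_space) \<le> (2 * pi * \<sigma>\<^sup>2) powr (- real DIM('a) / 2)"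
  by (simp add: gdens_def mult_left_le)

lemma gdens_strict_antimono:
  fixes y z :: "'a::euclidean_space"
  assumes "\<sigma> > 0" "norm y < norm z"
  shows "gdens \<sigma> z < gdens \<sigma> y"
proof -
  have "(norm y)\<^sup>2 / (2 * \<sigma>\<^sup>2) < (norm z)\<^sup>2 / (2 * \<sigma>\<^sup>2)"
    using assms by (intro divide_strict_right_mono power_strict_mono) auto
  thus ?thesis using assms by (simp add: gdens_def)
qed

lemma gdens_ge:
  assumes "norm (y::'a::euclidean_space) \<le> r"
  shows "(2 * pi * \<sigma>\<^sup>2) powr (- real DIM('a) / 2) * exp (- r\<^sup>2 / (2 * \<sigma>\<^sup>2)) \<le> gdens \<sigma> y"
  using assms by (auto simp: gdens_def intro!: mult_left_mono divide_right_mono power_mono)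

text \<open>With u = |x| / \<sigma> the derivative has modulus u exp(-u^2/2) / \<sigma>, and u <= 1
  + u^2/2 <= exp(u^2/2). A Lipschitz constant that is uniform in the argument is what later allows
  the atoms to be rounded to a finite grid.\<close>

lemma exp_neg_square_lipschitz:
  fixes r s \<sigma> :: real
  assumes "\<sigma> > 0"
  shows "\<bar>exp (- r\<^sup>2 / (2 * \<sigma>\<^sup>2)) - exp (- s\<^sup>2 / (2 * \<sigma>\<^sup>2))\<bar> \<le> \<bar>r - s\<bar> / \<sigma>"
proof -
  have "norm (exp (- r\<^sup>2 / (2 * \<sigma>\<^sup>2)) - exp (- s\<^sup>2 / (2 * \<sigma>\<^sup>2))) \<le> (1 / \<sigma>) * norm (r - s)"
  proof (rule field_differentiable_bound[of UNIV])
    fix x :: real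
    show "((\<lambda>x. exp (- x\<^sup>2 / (2 * \<sigma>\<^sup>2))) has_field_derivative
        - (x / \<sigma>\<^sup>2) * exp (- x\<^sup>2 / (2 * \<sigma>\<^sup>2))) (at x within UNIV)"
      using assms by (auto intro!: derivative_eq_intros simp: field_simps)
    define u where "u = \<bar>x\<bar> / \<sigma>"
    have u: "u \<ge> 0" using assms by (simp add: u_def)
    have "u \<le> 1 + u\<^sup>2 / 2" using zero_le_power2[of "u - 1"] by (simp add: power2_diff)
    also have "\<dots> \<le> exp (u\<^sup>2 / 2)" by (rule exp_ge_add_one_self)
    finally have "u * exp (- (u\<^sup>2 / 2)) \<le> 1" by (simp add: exp_minus field_simps)
    moreover have "\<bar>x\<bar> / \<sigma>\<^sup>2 * exp (- x\<^sup>2 / (2 * \<sigma>\<^sup>2)) = (u * exp (- (u\<^sup>2 / 2))) / \<sigma>"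
      using assms by (simp add: u_def power_divide power2_eq_square)
    ultimately show "norm (- (x / \<sigma>\<^sup>2) * exp (- x\<^sup>2 / (2 * \<sigma>\<^sup>2))) \<le> 1 / \<sigma>"
      using assms by (simp add: abs_mult divide_right_mono)
  qed auto
  thus ?thesis by simp
qed

lemma gdens_lipschitz:
  fixes y z :: "'a::euclidean_space"
  assumes "\<sigma> > 0"
  shows "\<bar>gdens \<sigma> y - gdens \<sigma> z\<bar> \<le> (2 * pi * \<sigma>\<^sup>2) powr (- real DIM('a) / 2) * (norm (y - z) / \<sigma>)"
proof -
  have "\<bar>exp (- (norm y)\<^sup>2 / (2 * \<sigma>\<^sup>2)) - exp (- (norm z)\<^sup>2 / (2 * \<sigma>\<^sup>2))\<bar> \<le> norm (y - z) / \<sigma>"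
    using exp_neg_square_lipschitz[OF assms, of "norm y" "norm z"] norm_triangle_ineq3[of y z] assms
    by (meson divide_right_mono less_imp_le order_trans)
  thus ?thesis
    unfolding gdens_def right_diff_distrib[symmetric] abs_mult
    by (metis abs_of_nonneg mult_left_mono powr_ge_zero)
qed

subsection \<open>Stability and construction of couplings\<close>

text \<open>One gradient step: z minimises the convex function \<psi> - <f z, .>, and moving from x
  to \<open>x - (1 / L) *\<^sub>R (f x - f z)\<close> lowers this function by at least |f x - f z|^2
  / (2L). The decrease cannot exceed the gap to the minimum, which is the Bregman
  divergence.\<close>

lemma bregman_lower:
  fixes \<psi> :: "'a::euclidean_space \<Rightarrow> real"
  assumes "L > 0"
    and conv: "\<And>x z. \<psi> z \<ge> \<psi> x + f x \<bullet> (z - x)"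
    and smooth: "\<And>x z. \<psi> z \<le> \<psi> x + f x \<bullet> (z - x) + L / 2 * (norm (x - z))\<^sup>2"
  shows "(norm (f x - f z))\<^sup>2 / (2 * L) \<le> \<psi> x - \<psi> z - f z \<bullet> (x - z)"
proof -
  define v where "v = f x - f z"
  define w where "w = x - (1 / L) *\<^sub>R v"
  have wx: "w - x = - (1 / L) *\<^sub>R v" and xw: "x - w = (1 / L) *\<^sub>R v"
    by (simp_all add: w_def)
  have "\<psi> w \<le> \<psi> x + f x \<bullet> (w - x) + L / 2 * (norm (x - w))\<^sup>2" by (rule smooth)
  moreover have "\<psi> w \<ge> \<psi> z + f z \<bullet> (w - z)" by (rule conv)
  ultimately have "\<psi> z + f z \<bullet> (w - z) \<le> \<psi> x + f x \<bullet> (w - x) + L / 2 * (norm (x - w))\<^sup>2" by linarith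
  moreover have "f z \<bullet> (w - z) = f z \<bullet> (w - x) + f z \<bullet> (x - z)"
    by (simp add: inner_diff_right)
  moreover have "f x \<bullet> (w - x) - f z \<bullet> (w - x) = - (v \<bullet> v) / L"
    unfolding wx by (simp add: v_def inner_diff_left diff_divide_distrib)
  moreover have "L / 2 * (norm (x - w))\<^sup>2 = (v \<bullet> v) / (2 * L)"
    unfolding xw using \<open>L > 0\<close> power2_norm_eq_inner[of v] by (simp add: power_mult_distrib power2_eq_square field_simps)
  ultimately have "v \<bullet> v / L - v \<bullet> v / (2 * L) \<le> \<psi> x - \<psi> z - f z \<bullet> (x - z)"
    by simp
  thus ?thesis
    using \<open>L > 0\<close> by (simp add: v_def power2_norm_eq_inner field_simps)
qed

text \<open>Strong convexity is applied with base point x although the divergence is based at z.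
  This leaves \<open>v \<bullet> (x - z)\<close> minus a quadratic in x - z, and completing the
  square eliminates x - z.\<close>

lemma bregman_upper:
  fixes \<psi> :: "'a::euclidean_space \<Rightarrow> real"
  assumes "l > 0"
    and conv: "\<And>x z. \<psi> z \<ge> \<psi> x + f x \<bullet> (z - x) + l / 2 * (norm (x - z))\<^sup>2"
  shows "\<psi> x - \<psi> z - f z \<bullet> (x - z) \<le> (norm (f x - f z))\<^sup>2 / (2 * l)"
proof -
  define v where "v = f x - f z"
  have "\<psi> x - \<psi> z - f z \<bullet> (x - z) \<le> v \<bullet> (x - z) - l / 2 * (norm (x - z))\<^sup>2"
    using conv[where x=x and z=z] by (simp add: v_def inner_diff_left inner_diff_right)
  also have "\<dots> \<le> v \<bullet> v / (2 * l)"
  proof -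
    have "0 \<le> (v - l *\<^sub>R (x - z)) \<bullet> (v - l *\<^sub>R (x - z))" by simp
    also have "\<dots> = v \<bullet> v - 2 * l * (v \<bullet> (x - z)) + l\<^sup>2 * (norm (x - z))\<^sup>2"
      unfolding power2_norm_eq_inner
      by (simp add: inner_diff_left[of v] inner_diff_right[of _ v] inner_commute[of x v] inner_commute[of z v]
          power2_eq_square algebra_simps)
    finally show ?thesis using \<open>l > 0\<close> by (simp add: field_simps power2_eq_square)
  qed
  finally show ?thesis by (simp add: v_def power2_norm_eq_inner)
qed

text \<open>The coercive function \<psi> - <\<theta>, .> attains its minimum, where its gradient
  vanishes. Every atom thus becomes a value of f, so divergences to atoms can be written with \<psi>
  alone and the conjugate never has to be defined.\<close>

lemma strongly_convex_gradient_surj: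
  fixes \<psi> :: "'a::euclidean_space \<Rightarrow> real"
  assumes "l > 0"
    and grad: "\<And>x. GDERIV \<psi> x :> f x"
    and conv: "\<And>x z. \<psi> z \<ge> \<psi> x + f x \<bullet> (z - x) + l / 2 * (norm (x - z))\<^sup>2"
  shows "\<exists>x. f x = \<theta>"
proof -
  define g where "g = (\<lambda>x. \<psi> x - \<theta> \<bullet> x)"
  have gder: "(g has_derivative (\<lambda>h. (f x - \<theta>) \<bullet> h)) (at x)" for x
    using grad[of x] unfolding gderiv_def g_def
    by (auto intro!: derivative_eq_intros simp: inner_diff_left inner_diff_right inner_commute)
  have contg: "continuous_on S g" for S
    by (intro continuous_at_imp_continuous_on ballI has_derivative_continuous[OF gder])
  define r where "r = 2 * norm (f 0 - \<theta>) / l"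
  have r: "r \<ge> 0" using assms by (simp add: r_def)
  \<comment> \<open>The radius is chosen so that outside the ball the strong convexity term
    outweighs the linear term; the minimum over the ball is then global.\<close>
  have out: "g z > g 0" if "norm z > r" for z
  proof -
    have z: "norm z > 0" using that r by linarith
    have "(f 0 - \<theta>) \<bullet> z \<ge> - (norm (f 0 - \<theta>) * norm z)"
      using Cauchy_Schwarz_ineq2[of "f 0 - \<theta>" z] by linarith
    moreover have "norm (f 0 - \<theta>) * norm z < l / 2 * norm z * norm z"
      using that z \<open>l > 0\<close> by (simp add: r_def field_simps)
    moreover have "g z \<ge> g 0 + (f 0 - \<theta>) \<bullet> z + l / 2 * (norm z)\<^sup>2"
      using conv[where x=0 and z=z] by (simp add: g_def inner_diff_left)
    ultimately show ?thesis by (simp add: power2_eq_square)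
  qed
  obtain x where x: "x \<in> cball 0 r" "\<And>y. y \<in> cball 0 r \<Longrightarrow> g x \<le> g y"
    using continuous_attains_inf[OF compact_cball _ contg, of 0 r] r by auto
  have min: "g x \<le> g y" for y
    using x(2)[of y] x(2)[of 0] out[of y] r by (cases "norm y \<le> r") auto
  have "(\<lambda>h. (f x - \<theta>) \<bullet> h) = (\<lambda>h. 0)"
    by (rule differential_zero_maxmin[OF _ open_UNIV gder]) (use min in auto)
  hence "(f x - \<theta>) \<bullet> (f x - \<theta>) = 0" by metis
  thus ?thesis by auto
qed

text \<open>Jensen's inequality for the conditional law of the atom given i. Each |\<theta> j - a|^2
  dominates its tangent 2 <m, \<theta> j - a> - |m|^2 at the conditional mean m, and the tangents
  average to |m|^2.\<close>

lemma norm_bary_proj_diff_le: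
  fixes \<theta> :: "nat \<Rightarrow> 'a::euclidean_space"
  assumes "is_coupling n p \<alpha> \<Gamma>" "i < n"
  shows "(1 / real n) * (norm (bary_proj n p \<Gamma> \<theta> i - a))\<^sup>2 \<le> (\<Sum>j<p. \<Gamma> i j * (norm (a - \<theta> j))\<^sup>2)"
proof -
  have n: "real n > 0" using assms(2) by simp
  have nn: "\<And>j. j < p \<Longrightarrow> \<Gamma> i j \<ge> 0" and s: "(\<Sum>j<p. \<Gamma> i j) = 1 / real n"
    using assms by (auto simp: is_coupling_def)
  define m where "m = bary_proj n p \<Gamma> \<theta> i - a"
  have S: "(\<Sum>j<p. \<Gamma> i j *\<^sub>R \<theta> j) = (1 / real n) *\<^sub>R bary_proj n p \<Gamma> \<theta> i"
    using n by (simp add: bary_proj_def)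
  have "(\<Sum>j<p. \<Gamma> i j * (norm (a - \<theta> j))\<^sup>2) = (\<Sum>j<p. \<Gamma> i j * ((norm (m - (\<theta> j - a)))\<^sup>2 + 2 * (m \<bullet> (\<theta> j - a)) - m \<bullet> m))"
    by (intro sum.cong refl arg_cong2[of _ _ _ _ "(*)"])
       (simp add: power2_norm_eq_inner inner_diff_left inner_diff_right inner_commute)
  also have "\<dots> \<ge> (\<Sum>j<p. \<Gamma> i j * (2 * (m \<bullet> (\<theta> j - a)) - m \<bullet> m))"
    by (intro sum_mono mult_left_mono) (use nn in auto)
  also have "(\<Sum>j<p. \<Gamma> i j * (2 * (m \<bullet> (\<theta> j - a)) - m \<bullet> m))
      = 2 * (m \<bullet> (\<Sum>j<p. \<Gamma> i j *\<^sub>R \<theta> j)) - (2 * (m \<bullet> a) + m \<bullet> m) * (\<Sum>j<p. \<Gamma> i j)"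
    by (simp add: inner_sum_right inner_diff_right sum_distrib_left sum_distrib_right algebra_simps sum.distrib sum_subtractf)
  also have "\<dots> = (1 / real n) * (norm m)\<^sup>2"
    unfolding S s power2_norm_eq_inner m_def
    by (simp add: inner_diff_left inner_diff_right algebra_simps diff_divide_distrib add_divide_distrib inner_commute)
  finally show ?thesis by (simp add: m_def)
qed

text \<open>With \<open>\<psi>\<^sup>*\<close> the conjugate of \<open>\<psi>\<close>, the optimal coupling also minimises the mean of
  \<open>\<psi> x + \<psi>\<^sup>* \<theta> - x \<bullet> \<theta>\<close>, and this gap is a Bregman divergence comparable to \<open>|f x - \<theta>|\<^sup>2\<close>.\<close>
lemma opt_coupling_stability:
  fixes X :: "nat \<Rightarrow> 'a::euclidean_space"
  assumes "l > 0" "L > 0"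
    and grad: "\<And>x. GDERIV \<psi> x :> f x"
    and conv: "\<And>x z. \<psi> z \<ge> \<psi> x + f x \<bullet> (z - x) + l / 2 * (norm (x - z))\<^sup>2"
    and smooth: "\<And>x z. \<psi> z \<le> \<psi> x + f x \<bullet> (z - x) + L / 2 * (norm (x - z))\<^sup>2"
    and opt: "is_opt_coupling n p X \<theta> \<alpha> \<Gamma>" and coup: "is_coupling n p \<alpha> \<gamma>"
  shows "(1 / real n) * (\<Sum>i<n. (norm (bary_proj n p \<Gamma> \<theta> i - f (X i)))\<^sup>2)
           \<le> (L / l) * (\<Sum>i<n. \<Sum>j<p. \<gamma> i j * (norm (f (X i) - \<theta> j))\<^sup>2)"
proof -
  have "\<forall>j. \<exists>z. f z = \<theta> j"
    using strongly_convex_gradient_surj[OF assms(1) grad conv] by blast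
  then obtain Z where Z: "\<And>j. f (Z j) = \<theta> j" by metis
  have conv0: "\<psi> z \<ge> \<psi> x + f x \<bullet> (z - x)" for x z
    by (rule order_trans[OF _ conv[where x=x]]) (use \<open>l > 0\<close> in simp)
  have cG: "is_coupling n p \<alpha> \<Gamma>" and le: "coupling_cost n p X \<theta> \<Gamma> \<le> coupling_cost n p X \<theta> \<gamma>"
    using opt coup by (auto simp: is_opt_coupling_def)
  define D where "D = (\<lambda>i j. \<psi> (X i) - \<psi> (Z j) - \<theta> j \<bullet> (X i - Z j))"
  \<comment> \<open>Expanding |X i - \<theta> j|^2 shows that \<open>D\<close> is the transport cost
    plus a term in i alone and a term in j alone. Couplings with the same marginals give these two
    terms the same total, so minimising the cost minimises the mean of \<open>D\<close>.\<close>
  define u where "u = (\<lambda>i. \<psi> (X i) - (norm (X i))\<^sup>2 / 2)"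
  define v where "v = (\<lambda>j. \<theta> j \<bullet> Z j - \<psi> (Z j) - (norm (\<theta> j))\<^sup>2 / 2)"
  have D: "D i j = u i + v j + (1/2) * (norm (X i - \<theta> j))\<^sup>2" for i j
    by (simp add: D_def u_def v_def power2_norm_eq_inner inner_diff_left inner_diff_right
        inner_commute field_simps)
  have tot: "(\<Sum>i<n. \<Sum>j<p. g i j * D i j) = (\<Sum>i<n. u i / real n) + (\<Sum>j<p. v j * \<alpha> j) + coupling_cost n p X \<theta> g"
    if "is_coupling n p \<alpha> g" for g
  proof -
    have "(\<Sum>i<n. \<Sum>j<p. g i j * D i j)
        = (\<Sum>i<n. \<Sum>j<p. u i * g i j) + (\<Sum>i<n. \<Sum>j<p. v j * g i j) + coupling_cost n p X \<theta> g"
      unfolding D coupling_cost_def by (simp add: algebra_simps sum.distrib)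
    also have "(\<Sum>i<n. \<Sum>j<p. u i * g i j) = (\<Sum>i<n. u i / real n)"
      using that by (simp add: is_coupling_def flip: sum_distrib_left)
    also have "(\<Sum>i<n. \<Sum>j<p. v j * g i j) = (\<Sum>j<p. v j * \<alpha> j)"
      using that by (subst sum.swap) (simp add: is_coupling_def flip: sum_distrib_left)
    finally show ?thesis .
  qed
  have lower: "(norm (f (X i) - \<theta> j))\<^sup>2 \<le> 2 * L * D i j" for i j
    using bregman_lower[of L \<psi> f "X i" "Z j", OF \<open>L > 0\<close> conv0 smooth] \<open>L > 0\<close>
    by (simp add: D_def Z field_simps)
  have upper: "D i j \<le> (norm (f (X i) - \<theta> j))\<^sup>2 / (2 * l)" for i j
    using bregman_upper[of l \<psi> f "X i" "Z j", OF \<open>l > 0\<close> conv] by (simp add: D_def Z)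
  have "(1 / real n) * (\<Sum>i<n. (norm (bary_proj n p \<Gamma> \<theta> i - f (X i)))\<^sup>2)
      \<le> (\<Sum>i<n. \<Sum>j<p. \<Gamma> i j * (norm (f (X i) - \<theta> j))\<^sup>2)"
    unfolding sum_distrib_left by (intro sum_mono norm_bary_proj_diff_le[OF cG]) auto
  also have "\<dots> \<le> (\<Sum>i<n. \<Sum>j<p. \<Gamma> i j * (2 * L * D i j))"
    using cG by (intro sum_mono mult_left_mono lower) (auto simp: is_coupling_def)
  also have "\<dots> = 2 * L * (\<Sum>i<n. \<Sum>j<p. \<Gamma> i j * D i j)"
    by (simp add: sum_distrib_left mult_ac)
  also have "\<dots> \<le> 2 * L * (\<Sum>i<n. \<Sum>j<p. \<gamma> i j * D i j)"
    unfolding tot[OF cG] tot[OF coup] using le \<open>L > 0\<close> by simp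
  also have "\<dots> \<le> 2 * L * (\<Sum>i<n. \<Sum>j<p. \<gamma> i j * ((norm (f (X i) - \<theta> j))\<^sup>2 / (2 * l)))"
    using coup \<open>L > 0\<close> by (intro mult_left_mono sum_mono upper) (auto simp: is_coupling_def)
  also have "\<dots> = (L / l) * (\<Sum>i<n. \<Sum>j<p. \<gamma> i j * (norm (f (X i) - \<theta> j))\<^sup>2)"
    by (simp add: sum_distrib_left mult_ac)
  finally show ?thesis .
qed

text \<open>Both marginals are smoothed to \<open>P\<close> and \<open>Q\<close> on the common set \<open>G\<close>; the common part
  \<open>min P Q\<close> is transported through \<open>G\<close>, and the leftovers are coupled independently.\<close>
lemma coupling_via_smoothing:
  fixes u :: "nat \<Rightarrow> real" and v :: "nat \<Rightarrow> real" and k :: "nat \<Rightarrow> 'g \<Rightarrow> real" and h :: "nat \<Rightarrow> 'g \<Rightarrow> real"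
  assumes G: "finite G"
    and u: "\<And>i. i < n \<Longrightarrow> u i \<ge> 0" "(\<Sum>i<n. u i) = 1" and v: "\<And>j. j < p \<Longrightarrow> v j \<ge> 0" "(\<Sum>j<p. v j) = 1"
    and k: "\<And>i g. i < n \<Longrightarrow> g \<in> G \<Longrightarrow> k i g \<ge> 0" "\<And>i. i < n \<Longrightarrow> (\<Sum>g\<in>G. k i g) = 1"
    and h: "\<And>j g. j < p \<Longrightarrow> g \<in> G \<Longrightarrow> h j g \<ge> 0" "\<And>j. j < p \<Longrightarrow> (\<Sum>g\<in>G. h j g) = 1"
    and c: "\<And>i j g. i < n \<Longrightarrow> j < p \<Longrightarrow> g \<in> G \<Longrightarrow> c i j \<le> c1 i g + c2 j g"
    and c1: "\<And>i g. i < n \<Longrightarrow> g \<in> G \<Longrightarrow> c1 i g \<ge> 0" and c2: "\<And>j g. j < p \<Longrightarrow> g \<in> G \<Longrightarrow> c2 j g \<ge> 0"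
    and D: "\<And>i j. i < n \<Longrightarrow> j < p \<Longrightarrow> c i j \<le> D" "D \<ge> 0"
  shows "\<exists>\<gamma>. (\<forall>i<n. \<forall>j<p. \<gamma> i j \<ge> 0) \<and> (\<forall>j<p. (\<Sum>i<n. \<gamma> i j) = v j) \<and> (\<forall>i<n. (\<Sum>j<p. \<gamma> i j) = u i) \<and>
     (\<Sum>i<n. \<Sum>j<p. \<gamma> i j * c i j) \<le> (\<Sum>i<n. u i * (\<Sum>g\<in>G. k i g * c1 i g)) + (\<Sum>j<p. v j * (\<Sum>g\<in>G. h j g * c2 j g))
        + D * (\<Sum>g\<in>G. \<bar>(\<Sum>i<n. u i * k i g) - (\<Sum>j<p. v j * h j g)\<bar>)"
proof -
  define P where "P = (\<lambda>g. \<Sum>i<n. u i * k i g)"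
  define Q where "Q = (\<lambda>g. \<Sum>j<p. v j * h j g)"
  define m where "m = (\<lambda>g. min (P g) (Q g))"
  have P: "P g \<ge> 0" if "g \<in> G" for g unfolding P_def using that u k by (auto intro!: sum_nonneg)
  have Q: "Q g \<ge> 0" if "g \<in> G" for g unfolding Q_def using that v h by (auto intro!: sum_nonneg)
  have m: "m g \<ge> 0" "m g \<le> P g" "m g \<le> Q g" if "g \<in> G" for g using P[OF that] Q[OF that] by (auto simp: m_def)
  have sP: "(\<Sum>g\<in>G. P g) = 1"
    unfolding P_def by (subst sum.swap) (simp add: k(2) u(2) flip: sum_distrib_left)
  have sQ: "(\<Sum>g\<in>G. Q g) = 1"
    unfolding Q_def by (subst sum.swap) (simp add: h(2) v(2) flip: sum_distrib_left)
  have kP: "u i * k i g \<le> P g" if "i < n" "g \<in> G" for i g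
    unfolding P_def using that u k by (intro member_le_sum) auto
  have hQ: "v j * h j g \<le> Q g" if "j < p" "g \<in> G" for j g
    unfolding Q_def using that v h by (intro member_le_sum) auto
  \<comment> \<open>\<open>x / 0 = 0\<close> is harmless below: \<open>P g = 0\<close> forces every \<open>u i * k i g\<close> and \<open>m g\<close> to vanish\<close>
  define r where "r = (\<lambda>i. \<Sum>g\<in>G. u i * k i g * (1 - m g / P g))"
  define s where "s = (\<lambda>j. \<Sum>g\<in>G. v j * h j g * (1 - m g / Q g))"
  define R where "R = (\<Sum>g\<in>G. P g - m g)"
  have mP: "m g / P g \<le> 1" "m g / P g \<ge> 0" if "g \<in> G" for g using m[OF that] P[OF that] by (auto simp: divide_le_eq)
  have mQ: "m g / Q g \<le> 1" "m g / Q g \<ge> 0" if "g \<in> G" for g using m[OF that] Q[OF that] by (auto simp: divide_le_eq)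
  have r: "r i \<ge> 0" if "i < n" for i
    unfolding r_def using that u k mP by (intro sum_nonneg mult_nonneg_nonneg) auto
  have s: "s j \<ge> 0" if "j < p" for j
    unfolding s_def using that v h mQ by (intro sum_nonneg mult_nonneg_nonneg) auto
  have PmP: "P g * (1 - m g / P g) = P g - m g" if "g \<in> G" for g
    using m[OF that] by (cases "P g = 0") (auto simp: field_simps)
  have QmQ: "Q g * (1 - m g / Q g) = Q g - m g" if "g \<in> G" for g
    using m[OF that] by (cases "Q g = 0") (auto simp: field_simps)
  have sr: "(\<Sum>i<n. r i) = R"
  proof -
    have "(\<Sum>i<n. r i) = (\<Sum>g\<in>G. P g * (1 - m g / P g))"
      unfolding r_def P_def by (subst sum.swap) (simp add: sum_distrib_right)
    thus ?thesis by (simp add: PmP R_def)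
  qed
  have R2: "R = (\<Sum>g\<in>G. Q g - m g)"
    using sP sQ by (simp add: R_def sum_subtractf)
  have ss: "(\<Sum>j<p. s j) = R"
  proof -
    have "(\<Sum>j<p. s j) = (\<Sum>g\<in>G. Q g * (1 - m g / Q g))"
      unfolding s_def Q_def by (subst sum.swap) (simp add: sum_distrib_right)
    thus ?thesis by (simp add: QmQ R2)
  qed
  have R0: "R \<ge> 0" unfolding R_def using m by (intro sum_nonneg) auto
  \<comment> \<open>Gluing at g: the mass \<open>m g\<close> is split with i and j independent,
    following their conditional laws \<open>u i * k i g / P g\<close> and
    \<open>v j * h j g / Q g\<close>.\<close>
  define w where "w = (\<lambda>i j g. (u i * k i g) * (v j * h j g) * (m g / (P g * Q g)))"
  \<comment> \<open>\<open>r\<close> and \<open>s\<close> are the parts of the marginals not carried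
    through \<open>G\<close>. Both have total mass \<open>R\<close>, so their product divided by
    \<open>R\<close> couples them; for \<open>R = 0\<close> both vanish, and so does the
    quotient.\<close>
  define \<gamma> where "\<gamma> = (\<lambda>i j. (\<Sum>g\<in>G. w i j g) + r i * s j / R)"
  have w: "w i j g \<ge> 0" if "i < n" "j < p" "g \<in> G" for i j g
    unfolding w_def using that u v k h m P Q by (intro mult_nonneg_nonneg divide_nonneg_nonneg) auto
  have wi: "(\<Sum>j<p. w i j g) = u i * k i g * (m g / P g)" if "i < n" "g \<in> G" for i g
  proof -
    have "(\<Sum>j<p. w i j g) = u i * k i g * (m g / (P g * Q g)) * Q g"
      unfolding w_def Q_def[THEN fun_cong, of g] sum_distrib_left by (simp add: mult_ac)
    also have "\<dots> = u i * k i g * (m g / P g)"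
      using m[OF that(2)] by (cases "Q g = 0") auto
    finally show ?thesis .
  qed
  have wj: "(\<Sum>i<n. w i j g) = v j * h j g * (m g / Q g)" if "j < p" "g \<in> G" for j g
  proof -
    have "(\<Sum>i<n. w i j g) = v j * h j g * (m g / (P g * Q g)) * P g"
      unfolding w_def P_def[THEN fun_cong, of g] sum_distrib_left by (simp add: mult_ac)
    also have "\<dots> = v j * h j g * (m g / Q g)"
      using m[OF that(2)] by (cases "P g = 0") auto
    finally show ?thesis .
  qed
  have g0: "\<gamma> i j \<ge> 0" if "i < n" "j < p" for i j
    unfolding \<gamma>_def using that r s R0 w by (intro add_nonneg_nonneg sum_nonneg divide_nonneg_nonneg mult_nonneg_nonneg) auto
  have r0: "r i = 0" if "R = 0" "i < n" for i
    using sr r that sum_nonneg_eq_0_iff[of "{..<n}" r] by auto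
  have s0: "s j = 0" if "R = 0" "j < p" for j
    using ss s that sum_nonneg_eq_0_iff[of "{..<p}" s] by auto
  have gi: "(\<Sum>j<p. \<gamma> i j) = u i" if "i < n" for i
  proof -
    have "(\<Sum>j<p. \<gamma> i j) = (\<Sum>g\<in>G. \<Sum>j<p. w i j g) + r i * (\<Sum>j<p. s j) / R"
      unfolding \<gamma>_def sum.distrib by (subst sum.swap) (simp add: sum_distrib_left sum_divide_distrib)
    also have "r i * (\<Sum>j<p. s j) / R = r i" using r0 that ss by (cases "R = 0") auto
    also have "(\<Sum>g\<in>G. \<Sum>j<p. w i j g) + r i = (\<Sum>g\<in>G. u i * k i g)"
      unfolding r_def sum.distrib[symmetric] by (intro sum.cong) (simp_all add: wi that algebra_simps)
    finally show ?thesis using k(2)[OF that] by (simp flip: sum_distrib_left)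
  qed
  have gj: "(\<Sum>i<n. \<gamma> i j) = v j" if "j < p" for j
  proof -
    have "(\<Sum>i<n. \<gamma> i j) = (\<Sum>g\<in>G. \<Sum>i<n. w i j g) + (\<Sum>i<n. r i) * s j / R"
      unfolding \<gamma>_def sum.distrib by (subst sum.swap) (simp add: sum_distrib_right sum_divide_distrib)
    also have "(\<Sum>i<n. r i) * s j / R = s j" using s0 that sr by (cases "R = 0") auto
    also have "(\<Sum>g\<in>G. \<Sum>i<n. w i j g) + s j = (\<Sum>g\<in>G. v j * h j g)"
      unfolding s_def sum.distrib[symmetric] by (intro sum.cong) (simp_all add: wj that algebra_simps)
    finally show ?thesis using h(2)[OF that] by (simp flip: sum_distrib_left)
  qed
  have "(\<Sum>i<n. \<Sum>j<p. \<gamma> i j * c i j)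
      \<le> (\<Sum>i<n. \<Sum>j<p. (\<Sum>g\<in>G. w i j g * c1 i g) + (\<Sum>g\<in>G. w i j g * c2 j g) + r i * s j / R * D)"
  proof (intro sum_mono)
    fix i j assume ij: "i \<in> {..<n}" "j \<in> {..<p}"
    have "(\<Sum>g\<in>G. w i j g) * c i j \<le> (\<Sum>g\<in>G. w i j g * c1 i g) + (\<Sum>g\<in>G. w i j g * c2 j g)"
      unfolding sum.distrib[symmetric] sum_distrib_right distrib_left[symmetric]
      using ij by (intro sum_mono mult_left_mono c w) auto
    moreover have "r i * s j / R * c i j \<le> r i * s j / R * D"
      using ij r s R0 D by (intro mult_left_mono) auto
    ultimately show "\<gamma> i j * c i j \<le> (\<Sum>g\<in>G. w i j g * c1 i g) + (\<Sum>g\<in>G. w i j g * c2 j g) + r i * s j / R * D"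
      by (simp add: \<gamma>_def distrib_right)
  qed
  also have "\<dots> = (\<Sum>i<n. \<Sum>j<p. \<Sum>g\<in>G. w i j g * c1 i g) + (\<Sum>i<n. \<Sum>j<p. \<Sum>g\<in>G. w i j g * c2 j g)
      + (\<Sum>i<n. \<Sum>j<p. r i * s j / R * D)"
    by (simp add: sum.distrib)
  also have "(\<Sum>i<n. \<Sum>j<p. \<Sum>g\<in>G. w i j g * c1 i g) \<le> (\<Sum>i<n. u i * (\<Sum>g\<in>G. k i g * c1 i g))"
  proof (intro sum_mono)
    fix i assume i: "i \<in> {..<n}"
    have "(\<Sum>j<p. \<Sum>g\<in>G. w i j g * c1 i g) = (\<Sum>g\<in>G. (\<Sum>j<p. w i j g) * c1 i g)"
      by (subst sum.swap) (simp add: sum_distrib_right)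
    also have "\<dots> \<le> (\<Sum>g\<in>G. u i * k i g * 1 * c1 i g)"
      using i u k c1 mP by (intro sum_mono, subst wi) (auto intro!: mult_right_mono mult_left_mono simp del: times_divide_eq_right mult_1_right)
    finally show "(\<Sum>j<p. \<Sum>g\<in>G. w i j g * c1 i g) \<le> u i * (\<Sum>g\<in>G. k i g * c1 i g)"
      by (simp add: sum_distrib_left mult_ac)
  qed
  also have "(\<Sum>i<n. \<Sum>j<p. \<Sum>g\<in>G. w i j g * c2 j g) \<le> (\<Sum>j<p. v j * (\<Sum>g\<in>G. h j g * c2 j g))"
  proof (subst sum.swap, intro sum_mono)
    fix j assume j: "j \<in> {..<p}"
    have "(\<Sum>i<n. \<Sum>g\<in>G. w i j g * c2 j g) = (\<Sum>g\<in>G. (\<Sum>i<n. w i j g) * c2 j g)"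
      by (subst sum.swap) (simp add: sum_distrib_right)
    also have "\<dots> \<le> (\<Sum>g\<in>G. v j * h j g * 1 * c2 j g)"
      using j v h c2 mQ by (intro sum_mono, subst wj) (auto intro!: mult_right_mono mult_left_mono simp del: times_divide_eq_right mult_1_right)
    finally show "(\<Sum>i<n. \<Sum>g\<in>G. w i j g * c2 j g) \<le> v j * (\<Sum>g\<in>G. h j g * c2 j g)"
      by (simp add: sum_distrib_left mult_ac)
  qed
  also have "(\<Sum>i<n. \<Sum>j<p. r i * s j / R * D) = D * R"
  proof -
    have "(\<Sum>i<n. \<Sum>j<p. r i * s j / R * D) = (\<Sum>i<n. r i) * (\<Sum>j<p. s j) / R * D"
      unfolding sum_product by (simp add: sum_divide_distrib sum_distrib_right)
    thus ?thesis unfolding sr ss by (cases "R = 0") auto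
  qed
  \<comment> \<open>\<open>R\<close> is the sum of the positive parts of
    \<open>P g - Q g\<close>.\<close>
  also have "D * R \<le> D * (\<Sum>g\<in>G. \<bar>P g - Q g\<bar>)"
    unfolding R_def using D by (intro mult_left_mono sum_mono) (auto simp: m_def)
  finally show ?thesis
    using g0 gi gj unfolding P_def Q_def by (intro exI[of _ \<gamma>]) auto
qed

subsection \<open>Couplings from characteristic functions\<close>

text \<open>The sequence is a sampled half period of the sine, the positive ground state of a path
  with N + 1 vertices and zero boundary values. Its three-term recurrence yields the eigenvalue
  cos(\<pi> / (N + 2)), the largest first Fourier coefficient that a nonnegative trigonometric
  polynomial of degree N and mean one can have.\<close>

lemma fejer_korovkin_coefficients:
  obtains a :: "nat \<Rightarrow> real" where "\<And>m. m \<le> N \<Longrightarrow> a m \<ge> 0" "(\<Sum>m\<le>N. (a m)\<^sup>2) = 1"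
    "(\<Sum>m<N. a m * a (Suc m)) = cos (pi / real (N + 2))"
proof -
  define q where "q = pi / real (N + 2)"
  define s where "s = (\<lambda>k::nat. sin (q * real k))"
  define S where "S = (\<Sum>m\<le>N. (s (Suc m))\<^sup>2)"
  have q: "q > 0" "q * real (N + 2) = pi" by (auto simp: q_def)
  have pos: "s (Suc m) > 0" if "m \<le> N" for m
  proof -
    have "q * real (Suc m) < q * real (N + 2)" using that q(1) by (intro mult_strict_left_mono) auto
    hence "q * real (Suc m) < pi" using q(2) by linarith
    thus ?thesis unfolding s_def using q(1) by (intro sin_gt_zero) auto
  qed
  have S: "S > 0" unfolding S_def using pos by (intro sum_pos zero_less_power) auto
  \<comment> \<open>The zeros at both ends let the two shifted sums below close up: the surplus term
    vanishes in each, and both equal \<open>T\<close>.\<close>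
  have s0: "s 0 = 0" "s (N + 2) = 0" using q(2) by (simp_all add: s_def)
  have rec: "s (Suc (Suc m)) + s m = 2 * cos q * s (Suc m)" for m
  proof -
    have "s (Suc (Suc m)) = sin (q * real (Suc m) + q)" "s m = sin (q * real (Suc m) - q)"
      by (simp_all add: s_def algebra_simps)
    thus ?thesis by (simp add: s_def sin_add sin_diff)
  qed
  define T where "T = (\<Sum>m<N. s (Suc m) * s (Suc (Suc m)))"
  have "(\<Sum>m\<le>N. s (Suc m) * s (Suc (Suc m))) = T"
    using s0(2) by (simp add: T_def lessThan_Suc_atMost[symmetric])
  moreover have "(\<Sum>m\<le>N. s (Suc m) * s m) = T"
    unfolding T_def lessThan_Suc_atMost[symmetric] by (subst sum.lessThan_Suc_shift) (simp add: s0 mult.commute)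
  ultimately have "2 * T = (\<Sum>m\<le>N. s (Suc m) * (s (Suc (Suc m)) + s m))"
    by (simp add: distrib_left sum.distrib)
  also have "\<dots> = 2 * cos q * S"
    unfolding rec S_def sum_distrib_left by (intro sum.cong) (auto simp: power2_eq_square)
  finally have T: "T = cos q * S" by simp
  show ?thesis
  proof (rule that[of "\<lambda>m. s (Suc m) / sqrt S"])
    show "s (Suc m) / sqrt S \<ge> 0" if "m \<le> N" for m using pos[OF that] S by auto
    show "(\<Sum>m\<le>N. (s (Suc m) / sqrt S)\<^sup>2) = 1"
      using S by (simp add: power_divide S_def[symmetric] flip: sum_divide_distrib)
    show "(\<Sum>m<N. s (Suc m) / sqrt S * (s (Suc (Suc m)) / sqrt S)) = cos (pi / real (N + 2))"
      using S T by (simp add: T_def[symmetric] q_def flip: sum_divide_distrib)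
  qed
qed

text \<open>For |z| < Q, divisibility of z by Q forces z = 0; otherwise the sum is a complete
  geometric sum over a nontrivial Q-th root of unity.\<close>

lemma sum_cis_roots_of_unity:
  fixes z :: int and x :: real
  assumes "\<bar>z\<bar> < int Q"
  shows "(\<Sum>g<Q. cis (of_int z * (x - 2 * pi * real g / real Q))) = (if z = 0 then of_nat Q else 0)"
proof (cases "z = 0")
  case False
  have Q: "real Q > 0" using assms by auto
  define w where "w = cis (- 2 * pi * of_int z / real Q)"
  have "w ^ Q = cis (2 * pi * of_int (- z))"
  proof -
    have "real Q * (- 2 * pi * of_int z / real Q) = 2 * pi * of_int (- z)" using Q by simp
    thus ?thesis unfolding w_def by (metis Complex.DeMoivre)
  qed
  also have "\<dots> = 1" by (rule cis_multiple_2pi) auto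
  finally have wQ: "w ^ Q = 1" .
  have w1: "w \<noteq> 1"
  proof
    assume "w = 1"
    hence "cos (- 2 * pi * of_int z / real Q) = 1"
      by (simp add: w_def complex_eq_iff)
    then obtain k :: int where "- 2 * pi * of_int z / real Q = of_int k * 2 * pi"
      using cos_one_2pi_int by blast
    hence "pi * real_of_int (- z) = pi * real_of_int (k * int Q)" using Q by (simp add: field_simps)
    hence "real_of_int (- z) = real_of_int (k * int Q)" by (simp only: mult_left_cancel[OF pi_neq_zero])
    hence "- z = k * int Q" by (simp only: of_int_eq_iff)
    hence "\<bar>z\<bar> = \<bar>k\<bar> * int Q" by (metis abs_minus_cancel abs_mult abs_of_nat)
    moreover have "k \<noteq> 0" using \<open>- z = k * int Q\<close> False by auto
    hence "\<bar>k\<bar> \<ge> 1" by linarith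
    ultimately show False using assms mult_right_mono[of 1 "\<bar>k\<bar>" "int Q"] by auto
  qed
  have "cis (of_int z * (x - 2 * pi * real g / real Q)) = cis (of_int z * x) * w ^ g" for g
    unfolding w_def Complex.DeMoivre cis_mult by (simp add: algebra_simps)
  hence "(\<Sum>g<Q. cis (of_int z * (x - 2 * pi * real g / real Q))) = cis (of_int z * x) * (\<Sum>g<Q. w ^ g)"
    by (simp add: sum_distrib_left)
  also have "(\<Sum>g<Q. w ^ g) = 0"
    using w1 wQ by (simp add: geometric_sum)
  finally show ?thesis using False by simp
qed simp

text \<open>Writing the kernel as a squared modulus secures nonnegativity; its Fourier coefficients
  are the autocorrelations of \<open>a\<close>.\<close>

definition trig_kernel :: "(nat \<Rightarrow> real) \<Rightarrow> nat \<Rightarrow> real \<Rightarrow> real" where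
  "trig_kernel a N x = (cmod (\<Sum>m\<le>N. a m * cis (real m * x)))\<^sup>2"

lemma trig_kernel_nonneg [simp]: "trig_kernel a N x \<ge> 0"
  by (simp add: trig_kernel_def)

lemma trig_kernel_expand:
  "complex_of_real (trig_kernel a N x)
     = (\<Sum>(m,m')\<in>{..N}\<times>{..N}. complex_of_real (a m * a m') * cis (of_int (int m - int m') * x))"
proof -
  have "complex_of_real (trig_kernel a N x)
      = (\<Sum>m\<le>N. a m * cis (real m * x)) * cnj (\<Sum>m\<le>N. a m * cis (real m * x))"
    unfolding trig_kernel_def by (simp only: complex_norm_square)
  also have "\<dots> = (\<Sum>m\<le>N. \<Sum>m'\<le>N. complex_of_real (a m * a m') * (cis (real m * x) * cis (- (real m' * x))))"
    by (simp add: sum_product cis_cnj mult_ac)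
  also have "\<dots> = (\<Sum>m\<le>N. \<Sum>m'\<le>N. complex_of_real (a m * a m') * cis (of_int (int m - int m') * x))"
    by (simp add: cis_mult algebra_simps)
  finally show ?thesis by (simp add: sum.cartesian_product)
qed

text \<open>The frequencies m - m' + r have modulus at most N + 1 < Q, so the grid average has no
  aliasing and extracts a Fourier coefficient exactly. The case r = 0 gives the mass of the kernel
  and r = 1 its spread. Working on a grid keeps the space of smoothed measures finite.\<close>

lemma trig_kernel_grid_average:
  fixes r :: int and x :: real
  assumes "\<bar>r\<bar> \<le> 1" "Q \<ge> N + 2"
  defines "y \<equiv> \<lambda>g. x - 2 * pi * real g / real Q"
  shows "(\<Sum>g<Q. complex_of_real (trig_kernel a N (y g) / real Q) * cis (of_int r * y g))
       = (\<Sum>(m,m')\<in>{..N}\<times>{..N}. complex_of_real (if int m + r = int m' then a m * a m' else 0))"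
proof -
  have Q: "Q > 0" using assms by simp
  have "(\<Sum>g<Q. complex_of_real (trig_kernel a N (y g) / real Q) * cis (of_int r * y g))
      = (\<Sum>g<Q. \<Sum>(m,m')\<in>{..N}\<times>{..N}. complex_of_real (a m * a m' / real Q) * cis (of_int (int m - int m' + r) * y g))"
    unfolding of_real_divide trig_kernel_expand
    by (simp add: sum_distrib_left sum_distrib_right sum_divide_distrib case_prod_unfold distrib_right mult.assoc flip: cis_mult)
  also have "\<dots> = (\<Sum>(m,m')\<in>{..N}\<times>{..N}. complex_of_real (a m * a m' / real Q) * (\<Sum>g<Q. cis (of_int (int m - int m' + r) * y g)))"
    by (subst sum.swap) (simp add: sum_distrib_left case_prod_unfold)
  also have "\<dots> = (\<Sum>(m,m')\<in>{..N}\<times>{..N}. complex_of_real (if int m + r = int m' then a m * a m' else 0))"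
  proof (intro sum.cong refl, clarify)
    fix m m' assume m: "m \<le> N" "m' \<le> N"
    have lt: "\<bar>int m - int m' + r\<bar> < int Q" using m assms(1,2) by linarith
    have eq: "(int m - int m' + r = 0) = (int m + r = int m')" by linarith
    show "complex_of_real (a m * a m' / real Q) * (\<Sum>g<Q. cis (of_int (int m - int m' + r) * y g))
       = complex_of_real (if int m + r = int m' then a m * a m' else 0)"
      unfolding y_def sum_cis_roots_of_unity[OF lt] eq using Q by auto
  qed
  finally show ?thesis .
qed

lemma trig_kernel_average:
  assumes "Q \<ge> N + 2" "(\<Sum>m\<le>N. (a m)\<^sup>2) = 1"
  shows "(\<Sum>g<Q. trig_kernel a N (x - 2 * pi * real g / real Q) / real Q) = 1"
proof -
  have "complex_of_real (\<Sum>g<Q. trig_kernel a N (x - 2 * pi * real g / real Q) / real Q)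
      = (\<Sum>(m,m')\<in>{..N}\<times>{..N}. complex_of_real (if m = m' then a m * a m' else 0))"
    using trig_kernel_grid_average[of 0 N Q a x] assms(1) by simp
  also have "\<dots> = complex_of_real (\<Sum>m\<le>N. \<Sum>m'\<le>N. (if m = m' then a m * a m' else 0))"
    unfolding of_real_sum sum.cartesian_product by (intro sum.cong) auto
  also have "(\<Sum>m\<le>N. \<Sum>m'\<le>N. (if m = m' then a m * a m' else 0)) = (\<Sum>m\<le>N. (a m)\<^sup>2)"
    by (intro sum.cong) (auto simp: power2_eq_square)
  finally show ?thesis using assms(2) by (simp only: of_real_eq_iff)
qed

text \<open>Since 1 - cos is a squared chord, this mean measures the width of the kernel; for the
  coefficients constructed above, the mean of 1 - cos is of order 1 / N^2.\<close>

lemma trig_kernel_average_cos: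
  assumes "Q \<ge> N + 2"
  defines "y \<equiv> \<lambda>x g. x - 2 * pi * real g / real Q"
  shows "(\<Sum>g<Q. trig_kernel a N (y x g) / real Q * cos (y x g)) = (\<Sum>m<N. a m * a (Suc m))"
proof -
  have "complex_of_real (\<Sum>m\<le>N. \<Sum>m'\<le>N. (if m' = Suc m then a m * a m' else 0))
      = (\<Sum>(m,m')\<in>{..N}\<times>{..N}. complex_of_real (if int m + 1 = int m' then a m * a m' else 0))"
    unfolding of_real_sum sum.cartesian_product by (intro sum.cong) auto
  also have "\<dots> = (\<Sum>g<Q. complex_of_real (trig_kernel a N (y x g) / real Q) * cis (y x g))"
    using trig_kernel_grid_average[of 1 N Q a x] assms(1) by (simp add: y_def)
  finally have "(\<Sum>g<Q. trig_kernel a N (y x g) / real Q * cos (y x g))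
      = (\<Sum>m\<le>N. \<Sum>m'\<le>N. (if m' = Suc m then a m * a m' else 0))"
    by (simp add: complex_eq_iff)
  also have "\<dots> = (\<Sum>m\<le>N. if Suc m \<le> N then a m * a (Suc m) else 0)"
    by (intro sum.cong) auto
  also have "\<dots> = (\<Sum>m<N. a m * a (Suc m))"
    by (intro sum.mono_neutral_cong_right) auto
  finally show ?thesis .
qed

section \<open>Chords and arcs of the unit circle\<close>

lemma two_minus_two_cos_le: "2 * (1 - cos x) \<le> x\<^sup>2" for x :: real
proof -
  have "2 * (1 - cos x) = 4 * (sin (x / 2))\<^sup>2"
    using cos_double_sin[of "x / 2"] by simp
  also have "\<dots> \<le> 4 * (x / 2)\<^sup>2"
    using abs_sin_x_le_abs_x[of "x / 2"] unfolding abs_le_square_iff by simp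
  finally show ?thesis by (simp add: power_divide)
qed

text \<open>Half-angle formula together with sin w >= w / 2 on [0, 1]; the restriction |x| <= 2
  keeps |x| / 2 in that interval, and the factor 4 is the square of the factor lost there.\<close>

lemma two_minus_two_cos_ge:
  fixes x :: real
  assumes "\<bar>x\<bar> \<le> 2"
  shows "x\<^sup>2 \<le> 4 * (2 * (1 - cos x))"
proof -
  have half: "w / 2 \<le> sin w" if "0 \<le> w" "w \<le> 1" for w :: real
  proof -
    have "sin 0 - 0 / 2 \<le> sin w - w / 2"
    proof (rule DERIV_nonneg_imp_nondecreasing[OF that(1), of "\<lambda>w. sin w - w / 2"])
      fix v :: real assume v: "0 \<le> v" "v \<le> w"
      have "cos (pi / 3) \<le> cos v"
        using v that pi_gt3 by (intro cos_monotone_0_pi_le) auto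
      hence "cos v - 1 / 2 \<ge> 0" by (simp add: cos_60)
      moreover have "((\<lambda>w. sin w - w / 2) has_real_derivative cos v - 1 / 2) (at v)"
        by (auto intro!: derivative_eq_intros)
      ultimately show "\<exists>y. ((\<lambda>w. sin w - w / 2) has_real_derivative y) (at v) \<and> 0 \<le> y" by blast
    qed
    thus ?thesis by simp
  qed
  have "\<bar>x\<bar> / 4 \<le> \<bar>sin (x / 2)\<bar>"
    using half[of "\<bar>x\<bar> / 2"] assms by (cases "x \<ge> 0") auto
  hence "(x / 4)\<^sup>2 \<le> (sin (x / 2))\<^sup>2" by (intro abs_le_square_iff[THEN iffD1]) simp
  moreover have "2 * (1 - cos x) = 4 * (sin (x / 2))\<^sup>2"
    using cos_double_sin[of "x / 2"] by simp
  ultimately show ?thesis by (simp add: power_divide)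
qed

text \<open>2 (1 - cos (x - z)) is the squared chord between \<open>cis x\<close> and
  \<open>cis z\<close>, so the triangle inequality applies to its root, followed by (a + b)^2 <= 2
  a^2 + 2 b^2.\<close>

lemma chord_triangle: "2 * (1 - cos (x - z)) \<le> 2 * (2 * (1 - cos (x - y))) + 2 * (2 * (1 - cos (z - y)))" for x y z :: real
proof -
  have *: "2 * (1 - cos (u - v)) = (cmod (cis u - cis v))\<^sup>2" for u v
  proof -
    have "(cmod (cis u - cis v))\<^sup>2 = ((cos u)\<^sup>2 + (sin u)\<^sup>2) + ((cos v)\<^sup>2 + (sin v)\<^sup>2) - 2 * (cos u * cos v + sin u * sin v)"
      unfolding cmod_power2 by (simp add: power2_eq_square algebra_simps)
    thus ?thesis by (simp add: cos_diff)
  qed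
  have "cmod (cis x - cis z) \<le> cmod (cis x - cis y) + cmod (cis z - cis y)"
    by (metis norm_minus_commute norm_diff_triangle_ineq diff_add_cancel norm_triangle_ineq add_diff_eq)
  hence "(cmod (cis x - cis z))\<^sup>2 \<le> (cmod (cis x - cis y) + cmod (cis z - cis y))\<^sup>2"
    by (intro power_mono) auto
  also have "\<dots> \<le> 2 * (cmod (cis x - cis y))\<^sup>2 + 2 * (cmod (cis z - cis y))\<^sup>2"
    using zero_le_power2[of "cmod (cis x - cis y) - cmod (cis z - cis y)"]
    by (simp add: power2_sum power2_diff)
  finally show ?thesis by (simp only: *)
qed

text \<open>A bounded piece of a scaled integer lattice, used in two roles: as the set of
  frequencies that the kernels see on the torus, and as the finite grid of atoms for the union
  bound.\<close>

definition lattice :: "real \<Rightarrow> nat \<Rightarrow> 'a::euclidean_space set" where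
  "lattice \<delta> N = {t. \<forall>b\<in>Basis. \<exists>z::int. \<bar>z\<bar> \<le> int N \<and> t \<bullet> b = \<delta> * of_int z}"

text \<open>The Fejer--Korovkin kernels have mean square width \<open>O(R\<^sup>2/N\<^sup>2)\<close> on the torus of period \<open>2 \<pi> R\<close>,
  and only see the characteristic functions at finitely many frequencies.\<close>
lemma coupling_of_close_characteristic_functions:
  fixes a \<theta> :: "nat \<Rightarrow> 'a::euclidean_space"
  assumes R: "R > 0" and n: "n > 0"
    and a: "\<And>i. i < n \<Longrightarrow> norm (a i) \<le> R" and \<theta>: "\<And>j. j < p \<Longrightarrow> norm (\<theta> j) \<le> R"
    and v: "\<And>j. j < p \<Longrightarrow> v j \<ge> 0" "(\<Sum>j<p. v j) = 1"
    and close: "\<And>t. t \<in> lattice (1 / R) N \<Longrightarrow>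
        cmod ((\<Sum>i<n. (1 / real n) *\<^sub>R cis (t \<bullet> a i)) - (\<Sum>j<p. v j *\<^sub>R cis (t \<bullet> \<theta> j))) \<le> \<eta>"
  shows "\<exists>\<gamma>. is_coupling n p v \<gamma> \<and> (\<Sum>i<n. \<Sum>j<p. \<gamma> i j * (norm (a i - \<theta> j))\<^sup>2)
     \<le> 16 * real DIM('a) * (R * (pi / real (N + 2)))\<^sup>2 + 4 * R\<^sup>2 * real (N + 1) ^ DIM('a) * \<eta>"
proof -
  obtain c where c: "\<And>m. m \<le> N \<Longrightarrow> c m \<ge> 0" "(\<Sum>m\<le>N. (c m)\<^sup>2) = 1"
    "(\<Sum>m<N. c m * c (Suc m)) = cos (pi / real (N + 2))"
    using fejer_korovkin_coefficients by blast
  define Q where "Q = N + 2"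
  define G where "G = PiE (Basis::'a set) (\<lambda>_. {..<Q})"
  define y where "y = (\<lambda>(x::'a) (g::'a \<Rightarrow> nat) b. (1 / R) * (x \<bullet> b) - 2 * pi * real (g b) / real Q)"
  define K where "K = (\<lambda>x g. \<Prod>b\<in>Basis. trig_kernel c N (y x g b) / real Q)"
  define ch where "ch = (\<lambda>x g. \<Sum>b\<in>Basis. 2 * (1 - cos (y x g b)))"
  have Q: "Q \<ge> N + 2" "real Q > 0" by (auto simp: Q_def)
  have G: "finite G" unfolding G_def by (intro finite_PiE) auto
  have K0: "K x g \<ge> 0" for x g
    unfolding K_def by (intro prod_nonneg) auto
  have K1: "(\<Sum>g\<in>G. K x g) = 1" for x
  proof -
    have "(\<Sum>g\<in>G. K x g) = (\<Prod>b\<in>Basis. \<Sum>g<Q. trig_kernel c N ((1 / R) * (x \<bullet> b) - 2 * pi * real g / real Q) / real Q)"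
      unfolding G_def K_def y_def by (subst prod_sum_PiE) auto
    thus ?thesis using trig_kernel_average[OF Q(1) c(2)] by simp
  qed
  have ch0: "ch x g \<ge> 0" for x g
    unfolding ch_def by (intro sum_nonneg) auto
  have Kch: "(\<Sum>g\<in>G. K x g * ch x g) \<le> real DIM('a) * (pi / real (N + 2))\<^sup>2" for x
  proof -
    \<comment> \<open>The spread in direction b involves only one factor of the product kernel, and
      the other factors sum to one. \<open>F\<close> builds the cosine weight into that factor, so
      that the sum over \<open>G\<close> still factorises.\<close>
    have "(\<Sum>g\<in>G. K x g * (2 * (1 - cos (y x g b)))) \<le> (pi / real (N + 2))\<^sup>2" if b: "b \<in> Basis" for b
    proof -
      define F where "F = (\<lambda>b' g. trig_kernel c N ((1 / R) * (x \<bullet> b') - 2 * pi * real g / real Q) / real Q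
         * (if b' = b then 2 * (1 - cos ((1 / R) * (x \<bullet> b) - 2 * pi * real g / real Q)) else 1))"
      have "K x g * (2 * (1 - cos (y x g b))) = (\<Prod>b'\<in>Basis. F b' (g b'))" for g
      proof -
        have "(\<Prod>b'\<in>Basis. F b' (g b')) = K x g * (\<Prod>b'\<in>Basis. if b' = b then 2 * (1 - cos (y x g b)) else 1)"
          unfolding F_def K_def y_def prod.distrib by (intro arg_cong2[of _ _ _ _ "(*)"] prod.cong) auto
        thus ?thesis using b by (simp add: prod.delta)
      qed
      hence "(\<Sum>g\<in>G. K x g * (2 * (1 - cos (y x g b)))) = (\<Prod>b'\<in>Basis. \<Sum>g<Q. F b' g)"
        unfolding G_def by (subst prod_sum_PiE) auto
      also have "\<dots> = (\<Prod>b'\<in>Basis. if b' = b then 2 * (1 - cos (pi / real (N + 2))) else 1)"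
      proof (intro prod.cong refl)
        fix b' :: 'a
        let ?y = "\<lambda>g. (1 / R) * (x \<bullet> b') - 2 * pi * real g / real Q"
        let ?k = "\<lambda>g. trig_kernel c N (?y g) / real Q"
        have A: "(\<Sum>g<Q. ?k g) = 1" by (rule trig_kernel_average[OF Q(1) c(2)])
        have B: "(\<Sum>g<Q. ?k g * cos (?y g)) = cos (pi / real (N + 2))"
          using trig_kernel_average_cos[OF Q(1), of c "(1 / R) * (x \<bullet> b')"] c(3) by simp
        show "(\<Sum>g<Q. F b' g) = (if b' = b then 2 * (1 - cos (pi / real (N + 2))) else 1)"
        proof (cases "b' = b")
          case True
          have "(\<Sum>g<Q. F b' g) = 2 * ((\<Sum>g<Q. ?k g) - (\<Sum>g<Q. ?k g * cos (?y g)))"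
            unfolding sum_subtractf[symmetric] sum_distrib_left F_def using True
            by (intro sum.cong) (simp_all add: algebra_simps)
          thus ?thesis using True A B by simp
        next
          case False
          thus ?thesis using A by (simp add: F_def)
        qed
      qed
      also have "\<dots> = 2 * (1 - cos (pi / real (N + 2)))" using b by (simp add: prod.delta)
      also have "\<dots> \<le> (pi / real (N + 2))\<^sup>2" by (rule two_minus_two_cos_le)
      finally show ?thesis .
    qed
    hence "(\<Sum>b\<in>Basis. \<Sum>g\<in>G. K x g * (2 * (1 - cos (y x g b)))) \<le> (\<Sum>b\<in>(Basis::'a set). (pi / real (N + 2))\<^sup>2)"
      by (rule sum_mono)
    thus ?thesis
      unfolding ch_def sum_distrib_left by (subst sum.swap) simp
  qed
  have cost: "(norm (x - z))\<^sup>2 \<le> 8 * R\<^sup>2 * ch x g + 8 * R\<^sup>2 * ch z g" if "norm x \<le> R" "norm z \<le> R" for x z :: 'a and g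
  proof -
    have "((x - z) \<bullet> b)\<^sup>2 \<le> 8 * R\<^sup>2 * (2 * (1 - cos (y x g b))) + 8 * R\<^sup>2 * (2 * (1 - cos (y z g b)))"
      if b: "b \<in> Basis" for b
    proof -
      define u where "u = (1 / R) * (x \<bullet> b)"
      define w where "w = (1 / R) * (z \<bullet> b)"
      have "\<bar>x \<bullet> b\<bar> \<le> R" "\<bar>z \<bullet> b\<bar> \<le> R"
        using Basis_le_norm[OF b] \<open>norm x \<le> R\<close> \<open>norm z \<le> R\<close> order_trans by blast+
      hence "\<bar>u\<bar> \<le> 1" "\<bar>w\<bar> \<le> 1" using R by (auto simp: u_def w_def abs_mult)
      \<comment> \<open>The torus has period 2 \<pi> R and the points lie within R of the origin. In
        units of R their coordinates differ by at most 2, which is less than the half period \<pi>,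
        so nothing wraps around and the chord controls the distance.\<close>
      hence "\<bar>u - w\<bar> \<le> 2" by linarith
      hence "(u - w)\<^sup>2 \<le> 4 * (2 * (1 - cos (u - w)))" by (rule two_minus_two_cos_ge)
      also have "\<dots> \<le> 4 * (2 * (2 * (1 - cos (y x g b))) + 2 * (2 * (1 - cos (y z g b))))"
        using chord_triangle[of u w "2 * pi * real (g b) / real Q"] by (simp add: y_def u_def w_def)
      finally have "R\<^sup>2 * (u - w)\<^sup>2 \<le> R\<^sup>2 * (4 * (2 * (2 * (1 - cos (y x g b))) + 2 * (2 * (1 - cos (y z g b)))))"
        by (rule mult_left_mono) simp
      moreover have "R\<^sup>2 * (u - w)\<^sup>2 = ((x - z) \<bullet> b)\<^sup>2"
      proof -
        have "(x - z) \<bullet> b = R * (u - w)" using R by (simp add: u_def w_def inner_diff_left right_diff_distrib)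
        thus ?thesis by (simp add: power_mult_distrib)
      qed
      ultimately show ?thesis by (simp add: algebra_simps)
    qed
    hence "(\<Sum>b\<in>Basis. ((x - z) \<bullet> b)\<^sup>2) \<le> (\<Sum>b\<in>Basis. 8 * R\<^sup>2 * (2 * (1 - cos (y x g b))) + 8 * R\<^sup>2 * (2 * (1 - cos (y z g b))))"
      by (rule sum_mono)
    moreover have "(norm (x - z))\<^sup>2 = (\<Sum>b\<in>Basis. ((x - z) \<bullet> b)\<^sup>2)"
      unfolding power2_norm_eq_inner euclidean_inner[of "x - z" "x - z"] by (simp add: power2_eq_square)
    ultimately show ?thesis by (simp add: ch_def sum.distrib sum_distrib_left)
  qed
  \<comment> \<open>The smoothed mass at g is a combination of values of the characteristic function
    at the lattice frequencies \<open>t \<mu>\<close>, with phases \<open>ph \<mu>\<close> of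
    modulus one. The two masses therefore differ by at most \<open>\<eta>\<close> times the sum of
    the coefficients.\<close>
  have tv: "\<bar>(\<Sum>i<n. (1 / real n) * K (a i) g) - (\<Sum>j<p. v j * K (\<theta> j) g)\<bar> \<le> real (N + 1) ^ DIM('a) * \<eta> / real Q ^ DIM('a)" for g
  proof -
    define M where "M = PiE (Basis::'a set) (\<lambda>_. {..N} \<times> {..N})"
    define A where "A = (\<lambda>\<mu>::'a \<Rightarrow> nat \<times> nat. \<Prod>b\<in>Basis. c (fst (\<mu> b)) * c (snd (\<mu> b)))"
    define t where "t = (\<lambda>\<mu>::'a \<Rightarrow> nat \<times> nat. \<Sum>b\<in>Basis. ((1 / R) * of_int (int (fst (\<mu> b)) - int (snd (\<mu> b)))) *\<^sub>R b)"
    define ph where "ph = (\<lambda>\<mu>::'a \<Rightarrow> nat \<times> nat. cis (- (\<Sum>b\<in>Basis. of_int (int (fst (\<mu> b)) - int (snd (\<mu> b))) * (2 * pi * real (g b) / real Q))))"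
    have finM: "finite M" unfolding M_def by (intro finite_PiE) auto
    have tl: "t \<mu> \<in> lattice (1 / R) N" if "\<mu> \<in> M" for \<mu>
      unfolding lattice_def
    proof (clarify)
      fix b :: 'a assume b: "b \<in> Basis"
      have "\<mu> b \<in> {..N} \<times> {..N}" using that b by (auto simp: M_def PiE_iff)
      hence "\<bar>int (fst (\<mu> b)) - int (snd (\<mu> b))\<bar> \<le> int N" by auto
      moreover have "t \<mu> \<bullet> b = (1 / R) * of_int (int (fst (\<mu> b)) - int (snd (\<mu> b)))"
        unfolding t_def using b by (simp only: inner_sum_left_Basis)
      ultimately show "\<exists>z. \<bar>z\<bar> \<le> int N \<and> t \<mu> \<bullet> b = 1 / R * real_of_int z" by blast
    qed
    have A0: "A \<mu> \<ge> 0" if "\<mu> \<in> M" for \<mu>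
      unfolding A_def using that c(1) by (intro prod_nonneg) (auto simp: M_def PiE_iff mem_Times_iff intro!: mult_nonneg_nonneg)
    have sA: "(\<Sum>\<mu>\<in>M. A \<mu>) \<le> real (N + 1) ^ DIM('a)"
    proof -
      have "(\<Sum>\<mu>\<in>M. A \<mu>) = (\<Prod>b\<in>(Basis::'a set). \<Sum>q\<in>{..N} \<times> {..N}. c (fst q) * c (snd q))"
        unfolding M_def A_def by (subst prod_sum_PiE) auto
      also have "\<dots> = ((\<Sum>m\<le>N. c m)\<^sup>2) ^ DIM('a)"
        by (simp add: power2_eq_square sum_product sum.cartesian_product case_prod_unfold)
      also have "\<dots> \<le> (real (N + 1)) ^ DIM('a)"
      proof (rule power_mono)
        \<comment> \<open>As \<open>c\<close> has unit square sum, Cauchy-Schwarz bounds the squared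
          sum of its entries by their number N + 1.\<close>
        have "(\<Sum>m\<le>N. 1 * c m)\<^sup>2 \<le> (\<Sum>m\<le>N. 1\<^sup>2) * (\<Sum>m\<le>N. (c m)\<^sup>2)"
          by (rule Cauchy_Schwarz_ineq_sum)
        thus "(\<Sum>m\<le>N. c m)\<^sup>2 \<le> real (N + 1)" using c(2) by simp
      qed simp
      finally show ?thesis .
    qed
    have expand: "complex_of_real (K x g) = (\<Sum>\<mu>\<in>M. (A \<mu> / real Q ^ DIM('a)) *\<^sub>R (ph \<mu> * cis (t \<mu> \<bullet> x)))" for x
    proof -
      have "complex_of_real (K x g) = (\<Prod>b\<in>Basis. \<Sum>q\<in>{..N} \<times> {..N}. complex_of_real (c (fst q) * c (snd q) / real Q)
          * cis (of_int (int (fst q) - int (snd q)) * y x g b))"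
        unfolding K_def of_real_prod of_real_divide trig_kernel_expand
        by (simp add: case_prod_unfold sum_divide_distrib)
      also have "\<dots> = (\<Sum>\<mu>\<in>M. \<Prod>b\<in>Basis. complex_of_real (c (fst (\<mu> b)) * c (snd (\<mu> b)) / real Q)
          * cis (of_int (int (fst (\<mu> b)) - int (snd (\<mu> b))) * y x g b))"
        unfolding M_def by (subst prod_sum_PiE) auto
      also have "\<dots> = (\<Sum>\<mu>\<in>M. (A \<mu> / real Q ^ DIM('a)) *\<^sub>R (ph \<mu> * cis (t \<mu> \<bullet> x)))"
      proof (intro sum.cong refl)
        fix \<mu> assume "\<mu> \<in> M"
        let ?z = "\<lambda>b. of_int (int (fst (\<mu> b)) - int (snd (\<mu> b))) :: real"
        have "(\<Prod>b\<in>Basis. cis (?z b * y x g b)) = cis (\<Sum>b\<in>Basis. ?z b * y x g b)"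
          by (simp add: cis_conv_exp sum_distrib_left exp_sum)
        also have "(\<Sum>b\<in>Basis. ?z b * y x g b) = - (\<Sum>b\<in>Basis. ?z b * (2 * pi * real (g b) / real Q)) + t \<mu> \<bullet> x"
          unfolding t_def inner_sum_left y_def sum_negf[symmetric] sum.distrib[symmetric]
          by (intro sum.cong refl) (simp add: inner_commute algebra_simps)
        finally have 1: "(\<Prod>b\<in>Basis. cis (?z b * y x g b)) = ph \<mu> * cis (t \<mu> \<bullet> x)"
          by (simp add: ph_def cis_mult)
        have 2: "(\<Prod>b\<in>Basis. complex_of_real (c (fst (\<mu> b)) * c (snd (\<mu> b)) / real Q)) = complex_of_real (A \<mu> / real Q ^ DIM('a))"
          unfolding A_def of_real_prod[symmetric] prod_dividef by simp
        show "(\<Prod>b\<in>Basis. complex_of_real (c (fst (\<mu> b)) * c (snd (\<mu> b)) / real Q) * cis (?z b * y x g b))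
          = (A \<mu> / real Q ^ DIM('a)) *\<^sub>R (ph \<mu> * cis (t \<mu> \<bullet> x))"
          unfolding prod.distrib 1 2 scaleR_conv_of_real ..
      qed
      finally show ?thesis .
    qed
    let ?\<chi> = "\<lambda>t. (\<Sum>i<n. (1 / real n) *\<^sub>R cis (t \<bullet> a i)) - (\<Sum>j<p. v j *\<^sub>R cis (t \<bullet> \<theta> j))"
    have comb: "(\<Sum>i\<in>I. complex_of_real (u i) * complex_of_real (K (x i) g)) = (\<Sum>\<mu>\<in>M. (A \<mu> / real Q ^ DIM('a)) *\<^sub>R (ph \<mu> * (\<Sum>i\<in>I. u i *\<^sub>R cis (t \<mu> \<bullet> x i))))"
      for u :: "nat \<Rightarrow> real" and x and I
      unfolding expand sum_distrib_left scaleR_sum_right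
      by (subst sum.swap) (simp add: mult_ac scaleR_conv_of_real)
    have "complex_of_real ((\<Sum>i<n. (1 / real n) * K (a i) g) - (\<Sum>j<p. v j * K (\<theta> j) g))
        = (\<Sum>i<n. complex_of_real (1 / real n) * complex_of_real (K (a i) g)) - (\<Sum>j<p. complex_of_real (v j) * complex_of_real (K (\<theta> j) g))"
      by simp
    also have "\<dots> = (\<Sum>\<mu>\<in>M. (A \<mu> / real Q ^ DIM('a)) *\<^sub>R (ph \<mu> * ?\<chi> (t \<mu>)))"
      unfolding comb sum_subtractf[symmetric] by (simp only: right_diff_distrib scaleR_diff_right)
    finally have E: "complex_of_real ((\<Sum>i<n. (1 / real n) * K (a i) g) - (\<Sum>j<p. v j * K (\<theta> j) g))
        = (\<Sum>\<mu>\<in>M. (A \<mu> / real Q ^ DIM('a)) *\<^sub>R (ph \<mu> * ?\<chi> (t \<mu>)))" .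
    have "\<bar>(\<Sum>i<n. (1 / real n) * K (a i) g) - (\<Sum>j<p. v j * K (\<theta> j) g)\<bar>
        = cmod (\<Sum>\<mu>\<in>M. (A \<mu> / real Q ^ DIM('a)) *\<^sub>R (ph \<mu> * ?\<chi> (t \<mu>)))"
      unfolding E[symmetric] norm_of_real ..
    also have "\<dots> \<le> (\<Sum>\<mu>\<in>M. (A \<mu> / real Q ^ DIM('a)) * \<eta>)"
    proof (rule sum_norm_le)
      fix \<mu> assume \<mu>: "\<mu> \<in> M"
      have "norm ((A \<mu> / real Q ^ DIM('a)) *\<^sub>R (ph \<mu> * ?\<chi> (t \<mu>))) = (A \<mu> / real Q ^ DIM('a)) * cmod (?\<chi> (t \<mu>))"
        using A0[OF \<mu>] by (simp add: norm_mult ph_def)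
      also have "\<dots> \<le> (A \<mu> / real Q ^ DIM('a)) * \<eta>"
        using A0[OF \<mu>] close[OF tl[OF \<mu>]] by (intro mult_left_mono) auto
      finally show "norm ((A \<mu> / real Q ^ DIM('a)) *\<^sub>R (ph \<mu> * ?\<chi> (t \<mu>))) \<le> (A \<mu> / real Q ^ DIM('a)) * \<eta>" .
    qed
    also have "\<dots> = (\<Sum>\<mu>\<in>M. A \<mu>) * \<eta> / real Q ^ DIM('a)"
      by (simp add: sum_distrib_right sum_divide_distrib)
    also have "\<dots> \<le> real (N + 1) ^ DIM('a) * \<eta> / real Q ^ DIM('a)"
    proof -
      \<comment> \<open>Frequency 0 in the closeness assumption forces \<open>\<eta>\<close> to be
        nonnegative, as required for enlarging the coefficient sum.\<close>
      have "0 \<in> (lattice (1 / R) N :: 'a set)" by (auto simp: lattice_def intro!: exI[of _ 0])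
      hence "\<eta> \<ge> 0" using close norm_ge_zero order_trans by blast
      thus ?thesis using sA Q by (intro divide_right_mono mult_right_mono) auto
    qed
    finally show ?thesis .
  qed
  have cardG: "card G = Q ^ DIM('a)" by (simp add: G_def card_PiE)
  have TV: "(\<Sum>g\<in>G. \<bar>(\<Sum>i<n. (1 / real n) * K (a i) g) - (\<Sum>j<p. v j * K (\<theta> j) g)\<bar>) \<le> real (N + 1) ^ DIM('a) * \<eta>"
  proof -
    have "(\<Sum>g\<in>G. \<bar>(\<Sum>i<n. (1 / real n) * K (a i) g) - (\<Sum>j<p. v j * K (\<theta> j) g)\<bar>)
        \<le> (\<Sum>g\<in>G. real (N + 1) ^ DIM('a) * \<eta> / real Q ^ DIM('a))"
      by (intro sum_mono tv)
    also have "\<dots> = real (N + 1) ^ DIM('a) * \<eta>" using Q by (simp add: cardG)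
    finally show ?thesis .
  qed
  have D: "(norm (a i - \<theta> j))\<^sup>2 \<le> 4 * R\<^sup>2" if "i < n" "j < p" for i j
  proof -
    have "norm (a i - \<theta> j) \<le> 2 * R"
      using norm_triangle_ineq4[of "a i" "\<theta> j"] a[OF that(1)] \<theta>[OF that(2)] by linarith
    hence "(norm (a i - \<theta> j))\<^sup>2 \<le> (2 * R)\<^sup>2" by (intro power_mono) auto
    thus ?thesis by (simp add: power_mult_distrib)
  qed
  have "\<exists>\<gamma>. (\<forall>i<n. \<forall>j<p. \<gamma> i j \<ge> 0) \<and> (\<forall>j<p. (\<Sum>i<n. \<gamma> i j) = v j) \<and> (\<forall>i<n. (\<Sum>j<p. \<gamma> i j) = 1 / real n) \<and>
     (\<Sum>i<n. \<Sum>j<p. \<gamma> i j * (norm (a i - \<theta> j))\<^sup>2) \<le> (\<Sum>i<n. (1 / real n) * (\<Sum>g\<in>G. K (a i) g * (8 * R\<^sup>2 * ch (a i) g)))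
        + (\<Sum>j<p. v j * (\<Sum>g\<in>G. K (\<theta> j) g * (8 * R\<^sup>2 * ch (\<theta> j) g)))
        + (4 * R\<^sup>2) * (\<Sum>g\<in>G. \<bar>(\<Sum>i<n. (1 / real n) * K (a i) g) - (\<Sum>j<p. v j * K (\<theta> j) g)\<bar>)"
    by (rule coupling_via_smoothing[OF G]) (use n v K0 K1 a \<theta> cost ch0 D in auto)
  then obtain \<gamma> where \<gamma>: "is_coupling n p v \<gamma>"
    "(\<Sum>i<n. \<Sum>j<p. \<gamma> i j * (norm (a i - \<theta> j))\<^sup>2) \<le> (\<Sum>i<n. (1 / real n) * (\<Sum>g\<in>G. K (a i) g * (8 * R\<^sup>2 * ch (a i) g)))
        + (\<Sum>j<p. v j * (\<Sum>g\<in>G. K (\<theta> j) g * (8 * R\<^sup>2 * ch (\<theta> j) g)))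
        + (4 * R\<^sup>2) * (\<Sum>g\<in>G. \<bar>(\<Sum>i<n. (1 / real n) * K (a i) g) - (\<Sum>j<p. v j * K (\<theta> j) g)\<bar>)"
    unfolding is_coupling_def by blast
  \<comment> \<open>The 8 is a 4 from comparing arc with chord times a 2 from squaring the triangle
    inequality; both marginals are smoothed, whence the 16 in the statement.\<close>
  let ?B = "8 * R\<^sup>2 * (real DIM('a) * (pi / real (N + 2))\<^sup>2)"
  have B: "(\<Sum>g\<in>G. K x g * (8 * R\<^sup>2 * ch x g)) \<le> ?B" for x
  proof -
    have "(\<Sum>g\<in>G. K x g * (8 * R\<^sup>2 * ch x g)) = 8 * R\<^sup>2 * (\<Sum>g\<in>G. K x g * ch x g)"
      by (simp add: sum_distrib_left mult_ac)
    thus ?thesis using Kch[of x] by (simp add: mult_left_mono)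
  qed
  have "(\<Sum>i<n. (1 / real n) * (\<Sum>g\<in>G. K (a i) g * (8 * R\<^sup>2 * ch (a i) g))) \<le> (\<Sum>i<n. (1 / real n) * ?B)"
    by (intro sum_mono mult_left_mono B) auto
  also have "\<dots> = ?B" using n by simp
  finally have 1: "(\<Sum>i<n. (1 / real n) * (\<Sum>g\<in>G. K (a i) g * (8 * R\<^sup>2 * ch (a i) g))) \<le> ?B" .
  have "(\<Sum>j<p. v j * (\<Sum>g\<in>G. K (\<theta> j) g * (8 * R\<^sup>2 * ch (\<theta> j) g))) \<le> (\<Sum>j<p. v j * ?B)"
    by (intro sum_mono mult_left_mono B) (auto simp: v)
  also have "\<dots> = ?B" using v(2) by (simp flip: sum_distrib_right)
  finally have 2: "(\<Sum>j<p. v j * (\<Sum>g\<in>G. K (\<theta> j) g * (8 * R\<^sup>2 * ch (\<theta> j) g))) \<le> ?B" .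
  have 3: "(4 * R\<^sup>2) * (\<Sum>g\<in>G. \<bar>(\<Sum>i<n. (1 / real n) * K (a i) g) - (\<Sum>j<p. v j * K (\<theta> j) g)\<bar>)
      \<le> (4 * R\<^sup>2) * (real (N + 1) ^ DIM('a) * \<eta>)"
    by (intro mult_left_mono TV) auto
  have "?B + ?B + (4 * R\<^sup>2) * (real (N + 1) ^ DIM('a) * \<eta>)
      = 16 * real DIM('a) * (R * (pi / real (N + 2)))\<^sup>2 + 4 * R\<^sup>2 * real (N + 1) ^ DIM('a) * \<eta>"
    by (simp only: power_mult_distrib) (simp add: algebra_simps)
  thus ?thesis using \<gamma> 1 2 3 by (intro exI[of _ \<gamma>]) linarith
qed

subsection \<open>Finite Gaussian mixtures and the likelihood\<close>

definition mixd :: "real \<Rightarrow> nat \<Rightarrow> (nat \<Rightarrow> real) \<Rightarrow> (nat \<Rightarrow> 'a::euclidean_space) \<Rightarrow> 'a \<Rightarrow> real" where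
  "mixd \<sigma> m \<beta> u y = (\<Sum>j<m. \<beta> j * gdens \<sigma> (y - u j))"

lemma borel_measurable_mixd [measurable]: "mixd \<sigma> m \<beta> u \<in> borel_measurable borel"
  unfolding mixd_def by measurable

lemma mixd_pos:
  assumes "\<sigma> > 0" "\<And>j. j < m \<Longrightarrow> \<beta> j \<ge> 0" "(\<Sum>j<m. \<beta> j) = 1"
  shows "mixd \<sigma> m \<beta> u y > 0"
proof -
  obtain j where j: "j < m" "\<beta> j \<noteq> 0" using assms(3) by (metis lessThan_iff sum.neutral zero_neq_one)
  hence "\<beta> j > 0" using assms(2)[of j] by linarith
  thus ?thesis unfolding mixd_def using j assms(1,2) gdens_pos[OF assms(1)]
    by (intro sum_pos2[of _ j]) (auto intro!: mult_pos_pos mult_nonneg_nonneg)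
qed

lemma integral_mixd:
  fixes h :: "'a::euclidean_space \<Rightarrow> real"
  assumes "\<sigma> > 0" "h \<in> borel_measurable borel" "\<And>y. \<bar>h y\<bar> \<le> b"
  shows "integrable lborel (\<lambda>y. h y * mixd \<sigma> m \<beta> u y)"
    and "(\<integral>y. h y * mixd \<sigma> m \<beta> u y \<partial>lborel) = (\<Sum>j<m. \<beta> j * (\<integral>y. h y * gdens \<sigma> (y - u j) \<partial>lborel))"
proof -
  have eq: "h y * mixd \<sigma> m \<beta> u y = (\<Sum>j<m. \<beta> j * (h y * gdens \<sigma> (y - u j)))" for y
    by (simp add: mixd_def sum_distrib_left mult_ac)
  show "integrable lborel (\<lambda>y. h y * mixd \<sigma> m \<beta> u y)"
    unfolding eq by (intro Bochner_Integration.integrable_sum integrable_mult_right integrable_gdens_shift_bounded[OF assms])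
  show "(\<integral>y. h y * mixd \<sigma> m \<beta> u y \<partial>lborel) = (\<Sum>j<m. \<beta> j * (\<integral>y. h y * gdens \<sigma> (y - u j) \<partial>lborel))"
    unfolding eq by (subst Bochner_Integration.integral_sum)
      (auto intro!: integrable_mult_right integrable_gdens_shift_bounded[OF assms])
qed

lemma integral_mixd_one:
  fixes u :: "nat \<Rightarrow> 'a::euclidean_space"
  assumes "\<sigma> > 0" "(\<Sum>j<m. \<beta> j) = 1"
  shows "(\<integral>y. mixd \<sigma> m \<beta> u y \<partial>lborel) = 1"
proof -
  have "(\<integral>y. gdens \<sigma> (y - c) \<partial>lborel) = 1" for c :: 'a
    using has_integral_gdens_shift[OF assms(1), of c] by (simp add: has_bochner_integral_iff)
  thus ?thesis
    using integral_mixd(2)[of \<sigma> "\<lambda>_. 1" 1 m \<beta> u] assms by simp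
qed

text \<open>The NPMLE competes against probability measures, so a finite mixture first has to be
  realised by one: the image under \<open>u\<close> of the point measure with weights
  \<beta>.\<close>

lemma exists_discrete_mixing_measure:
  fixes u :: "nat \<Rightarrow> 'a::euclidean_space"
  assumes "\<And>j. j < m \<Longrightarrow> \<beta> j \<ge> 0" "(\<Sum>j<m. \<beta> j) = 1"
  shows "\<exists>\<nu>. prob_space \<nu> \<and> sets \<nu> = sets borel \<and> (\<forall>y. mixture_dens \<sigma> \<nu> y = mixd \<sigma> m \<beta> u y)"
proof -
  define \<mu> where "\<mu> = point_measure {..<m} \<beta>"
  have [measurable]: "u \<in> measurable \<mu> borel"
    by (simp add: \<mu>_def)
  have "prob_space \<mu>"
  proof
    have "emeasure \<mu> (space \<mu>) = ennreal (\<Sum>j<m. \<beta> j)"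
      using assms(1) by (subst sum_ennreal[symmetric])
        (auto simp: \<mu>_def space_point_measure emeasure_point_measure_finite)
    thus "emeasure \<mu> (space \<mu>) = 1" using assms(2) by simp
  qed
  hence "prob_space (distr \<mu> borel u)" by (intro prob_space.prob_space_distr) auto
  moreover have "mixture_dens \<sigma> (distr \<mu> borel u) y = mixd \<sigma> m \<beta> u y" for y
  proof -
    have "mixture_dens \<sigma> (distr \<mu> borel u) y = (\<integral>j. gdens \<sigma> (y - u j) \<partial>\<mu>)"
      unfolding mixture_dens_def by (subst integral_distr) auto
    also have "\<dots> = (\<Sum>j<m. \<beta> j *\<^sub>R gdens \<sigma> (y - u j))"
      unfolding \<mu>_def using assms(1) by (intro lebesgue_integral_point_measure_finite) auto
    finally show ?thesis by (simp add: mixd_def)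
  qed
  ultimately show ?thesis by (intro exI[of _ "distr \<mu> borel u"]) auto
qed

lemma npmle_likelihood_ge:
  assumes "is_npmle \<sigma> n Y p \<alpha> \<theta>" "\<And>j. j < m \<Longrightarrow> \<beta> j \<ge> 0" "(\<Sum>j<m. \<beta> j) = 1"
  shows "(\<Sum>i<n. ln (mixd \<sigma> m \<beta> u (Y i))) \<le> (\<Sum>i<n. ln (mixd \<sigma> p \<alpha> \<theta> (Y i)))"
proof -
  obtain \<nu> where "prob_space \<nu>" "sets \<nu> = sets borel" and eq: "\<And>y. mixture_dens \<sigma> \<nu> y = mixd \<sigma> m \<beta> u y"
    using exists_discrete_mixing_measure[OF assms(2,3)] by metis
  hence "- (\<Sum>i<n. ln (mixd \<sigma> p \<alpha> \<theta> (Y i))) \<le> - (\<Sum>i<n. ln (mixture_dens \<sigma> \<nu> (Y i)))"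
    using assms(1) unfolding is_npmle_def mixd_def by blast
  thus ?thesis by (simp add: eq)
qed

text \<open>At the projection c the angle between x and y is not acute, so |y - c|^2 + |x - c|^2 <=
  |y - x|^2; strictness comes from x being different from c.\<close>

lemma closest_point_closer:
  fixes x y :: "'a::euclidean_space"
  assumes "convex S" "closed S" "y \<in> S"
  shows "norm (y - closest_point S x) \<le> norm (y - x)"
    and "x \<notin> S \<Longrightarrow> norm (y - closest_point S x) < norm (y - x)"
proof -
  define c where "c = closest_point S x"
  have "(x - c) \<bullet> (y - c) \<le> 0"
    unfolding c_def by (rule closest_point_dot[OF assms])
  moreover have "(norm (y - x))\<^sup>2 = (norm (y - c))\<^sup>2 + (norm (x - c))\<^sup>2 - 2 * ((x - c) \<bullet> (y - c))"
    by (simp add: power2_norm_eq_inner inner_diff_left inner_diff_right inner_commute)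
  ultimately have *: "(norm (y - c))\<^sup>2 + (norm (x - c))\<^sup>2 \<le> (norm (y - x))\<^sup>2" by linarith
  show "norm (y - closest_point S x) \<le> norm (y - x)"
    unfolding c_def[symmetric]
  proof (rule power2_le_imp_le)
    show "(norm (y - c))\<^sup>2 \<le> (norm (y - x))\<^sup>2" using * zero_le_power2[of "norm (x - c)"] by linarith
  qed simp
  assume "x \<notin> S"
  moreover have "c \<in> S" unfolding c_def using assms by (intro closest_point_in_set) auto
  ultimately have "(norm (x - c))\<^sup>2 > 0" by auto
  hence "(norm (y - c))\<^sup>2 < (norm (y - x))\<^sup>2" using * by linarith
  thus "norm (y - closest_point S x) < norm (y - x)"
    unfolding c_def[symmetric] by (rule power2_less_imp_less) auto
qed

text \<open>Projecting an atom onto a ball containing the data brings it closer to every observation,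
  hence would increase the likelihood.\<close>
lemma npmle_atoms_bounded:
  fixes Y :: "nat \<Rightarrow> 'a::euclidean_space"
  assumes "\<sigma> > 0" "n > 0" "is_npmle \<sigma> n Y p \<alpha> \<theta>" "\<And>i. i < n \<Longrightarrow> norm (Y i) \<le> R" "j < p"
  shows "norm (\<theta> j) \<le> R"
proof (rule ccontr)
  assume out: "\<not> norm (\<theta> j) \<le> R"
  define S where "S = cball (0::'a) R"
  define \<theta>' where "\<theta>' = (\<lambda>j. closest_point S (\<theta> j))"
  have S: "convex S" "closed S" by (auto simp: S_def)
  have Y: "Y i \<in> S" if "i < n" for i using assms(4)[OF that] by (simp add: S_def)
  have \<alpha>: "\<And>j. j < p \<Longrightarrow> \<alpha> j > 0" "(\<Sum>j<p. \<alpha> j) = 1"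
    using assms(3) by (auto simp: is_npmle_def)
  have lt: "mixd \<sigma> p \<alpha> \<theta> (Y i) < mixd \<sigma> p \<alpha> \<theta>' (Y i)" if i: "i < n" for i
    unfolding mixd_def
  proof (rule sum_strict_mono_ex1)
    show "\<forall>k\<in>{..<p}. \<alpha> k * gdens \<sigma> (Y i - \<theta> k) \<le> \<alpha> k * gdens \<sigma> (Y i - \<theta>' k)"
    proof
      fix k assume k: "k \<in> {..<p}"
      have "norm (Y i - \<theta>' k) \<le> norm (Y i - \<theta> k)"
        unfolding \<theta>'_def by (rule closest_point_closer(1)[OF S Y[OF i]])
      hence "gdens \<sigma> (Y i - \<theta> k) \<le> gdens \<sigma> (Y i - \<theta>' k)"
        using gdens_strict_antimono[OF assms(1)] by (cases "norm (Y i - \<theta>' k) = norm (Y i - \<theta> k)") (auto simp: gdens_def less_le)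
      thus "\<alpha> k * gdens \<sigma> (Y i - \<theta> k) \<le> \<alpha> k * gdens \<sigma> (Y i - \<theta>' k)"
        using \<alpha>(1)[of k] k by (intro mult_left_mono) auto
    qed
    have "norm (Y i - \<theta>' j) < norm (Y i - \<theta> j)"
      unfolding \<theta>'_def by (rule closest_point_closer(2)[OF S Y[OF i]]) (use out in \<open>simp add: S_def\<close>)
    hence "\<alpha> j * gdens \<sigma> (Y i - \<theta> j) < \<alpha> j * gdens \<sigma> (Y i - \<theta>' j)"
      using \<alpha>(1)[OF assms(5)] gdens_strict_antimono[OF assms(1)] by (intro mult_strict_left_mono) auto
    thus "\<exists>k\<in>{..<p}. \<alpha> k * gdens \<sigma> (Y i - \<theta> k) < \<alpha> k * gdens \<sigma> (Y i - \<theta>' k)"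
      using assms(5) by auto
  qed auto
  have pos: "mixd \<sigma> p \<alpha> u y > 0" for u and y :: 'a
    using \<alpha> by (intro mixd_pos assms(1)) (auto simp: less_imp_le)
  have "(\<Sum>i<n. ln (mixd \<sigma> p \<alpha> \<theta> (Y i))) < (\<Sum>i<n. ln (mixd \<sigma> p \<alpha> \<theta>' (Y i)))"
    using assms(2) lt pos by (intro sum_strict_mono) auto
  moreover have "(\<Sum>i<n. ln (mixd \<sigma> p \<alpha> \<theta>' (Y i))) \<le> (\<Sum>i<n. ln (mixd \<sigma> p \<alpha> \<theta> (Y i)))"
    using \<alpha> by (intro npmle_likelihood_ge[OF assms(3)]) (auto simp: less_imp_le)
  ultimately show False by simp
qed

text \<open>Apply ln s <= s - 1 to s = sqrt x. The square kept in addition to x - 1 averages to a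
  squared Hellinger distance when x is a ratio of densities.\<close>

lemma ln_le_minus_hellinger:
  fixes x :: real
  assumes "x > 0"
  shows "ln x \<le> x - 1 - (sqrt x - 1)\<^sup>2"
proof -
  have "ln x = 2 * ln (sqrt x)" using assms by (simp add: ln_sqrt)
  also have "\<dots> \<le> 2 * (sqrt x - 1)" using ln_le_minus_one[of "sqrt x"] assms by simp
  also have "\<dots> = x - 1 - (sqrt x - 1)\<^sup>2" using assms by (simp add: power2_diff)
  finally show ?thesis .
qed

text \<open>The empirical assumptions are linear in the mixing measure \<open>\<alpha>\<close>. The likelihood inequality
  bounds the empirical Hellinger distance on \<open>W\<close>, hence the empirical \<open>L\<^sup>1\<close> distance of
  \<open>fh / fs\<close> from 1, and linearity transfers the latter back to the population integrals.\<close>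
lemma likelihood_test_function_bound:
  fixes Y a \<theta> :: "nat \<Rightarrow> 'a::euclidean_space"
  assumes \<sigma>: "\<sigma> > 0" and n: "n > 0"
    and u: "\<And>j. j < m \<Longrightarrow> u j \<ge> 0" "(\<Sum>j<m. u j) = 1"
    and \<alpha>: "\<And>j. j < p \<Longrightarrow> \<alpha> j \<ge> 0" "(\<Sum>j<p. \<alpha> j) = 1"
  defines "fs \<equiv> mixd \<sigma> m u a" and "fh \<equiv> mixd \<sigma> p \<alpha> \<theta>"
  assumes like: "(\<Sum>i<n. ln (fs (Y i))) \<le> (\<Sum>i<n. ln (fh (Y i)))"
    and V: "V \<ge> 0" "\<And>i. i < n \<Longrightarrow> fh (Y i) \<le> exp V * fs (Y i)"
    and W[measurable]: "W \<in> sets borel"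
    and T: "\<And>h. h \<in> T \<Longrightarrow> h \<in> borel_measurable borel" "\<And>h y. h \<in> T \<Longrightarrow> \<bar>h y\<bar> \<le> 1" "(\<lambda>_. 1) \<in> T"
    and dev1: "\<And>h j. h \<in> T \<Longrightarrow> j < p \<Longrightarrow>
       \<bar>(1 / real n) * (\<Sum>i<n. indicator W (Y i) * h (Y i) * (gdens \<sigma> (Y i - \<theta> j) / fs (Y i)))
         - (\<integral>y. indicator W y * h y * gdens \<sigma> (y - \<theta> j) \<partial>lborel)\<bar> \<le> \<tau>"
    and dev2: "\<And>h. h \<in> T \<Longrightarrow>
       \<bar>(1 / real n) * (\<Sum>i<n. indicator W (Y i) * h (Y i)) - (\<integral>y. indicator W y * h y * fs y \<partial>lborel)\<bar> \<le> \<tau>"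
    and tail: "(\<integral>y. indicator (- W) y * fs y \<partial>lborel) \<le> \<eta>" and \<tau>: "0 \<le> \<tau>" "\<tau> \<le> 1" and \<eta>: "0 \<le> \<eta>"
    and h: "h \<in> T"
  shows "\<bar>(\<integral>y. h y * fh y \<partial>lborel) - (\<integral>y. h y * fs y \<partial>lborel)\<bar>
           \<le> 2 * sqrt (6 * ((V + 2) * (\<eta> + \<tau>))) + 4 * \<tau> + 2 * \<eta>"
proof -
  define A where "A = (\<lambda>g. (1 / real n) * (\<Sum>i<n. g (Y i)) :: real)"
  define w where "w = (indicator W :: 'a \<Rightarrow> real)"
  define x where "x = (\<lambda>y. fh y / fs y)"
  have w01: "w y = 0 \<or> w y = 1" for y by (auto simp: w_def indicator_def)
  have [measurable]: "w \<in> borel_measurable borel" unfolding w_def by measurable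
  note [measurable] = T(1)
  have A_add: "A (\<lambda>y. f y + g y) = A f + A g" for f g by (simp add: A_def sum.distrib add_divide_distrib)
  have A_diff: "A (\<lambda>y. f y - g y) = A f - A g" for f g by (simp add: A_def sum_subtractf diff_divide_distrib)
  have A_mult: "A (\<lambda>y. c * g y) = c * A g" for c g by (simp add: A_def sum_distrib_left mult_ac)
  have A_mono: "A f \<le> A g" if "\<And>i. i < n \<Longrightarrow> f (Y i) \<le> g (Y i)" for f g
    unfolding A_def using that by (intro mult_left_mono sum_mono) auto
  have A_const: "A (\<lambda>_. c) = c" for c using n by (simp add: A_def)
  have fs: "fs y > 0" and fh: "fh y > 0" for y
    unfolding fs_def fh_def using u \<alpha> by (intro mixd_pos \<sigma>; simp)+
  have x: "x y > 0" for y using fs fh by (simp add: x_def)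
  have ints: "integrable lborel (\<lambda>y. g y * fs y)" and inth: "integrable lborel (\<lambda>y. g y * fh y)"
    if "g \<in> borel_measurable borel" "\<And>y. \<bar>g y\<bar> \<le> 1" for g
    unfolding fs_def fh_def by (intro integral_mixd(1)[OF \<sigma> that])+
  have one_s: "(\<integral>y. fs y \<partial>lborel) = 1" and one_h: "(\<integral>y. fh y \<partial>lborel) = 1"
    unfolding fs_def fh_def by (intro integral_mixd_one \<sigma> u(2) \<alpha>(2))+
  have split: "(\<integral>y. w y * g y * f y \<partial>lborel) + (\<integral>y. (1 - w y) * g y * f y \<partial>lborel) = (\<integral>y. g y * f y \<partial>lborel)"
    if "integrable lborel (\<lambda>y. w y * g y * f y)" "integrable lborel (\<lambda>y. (1 - w y) * g y * f y)" for g f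
    by (subst Bochner_Integration.integral_add[OF that, symmetric]) (simp add: algebra_simps)
  have bnd: "\<bar>w y * g y\<bar> \<le> 1" "\<bar>(1 - w y) * g y\<bar> \<le> 1" if "g \<in> T" for g y
    using T(2)[OF that, of y] w01[of y] by auto
  have splits: "(\<integral>y. w y * g y * fs y \<partial>lborel) + (\<integral>y. (1 - w y) * g y * fs y \<partial>lborel) = (\<integral>y. g y * fs y \<partial>lborel)"
    and splith: "(\<integral>y. w y * g y * fh y \<partial>lborel) + (\<integral>y. (1 - w y) * g y * fh y \<partial>lborel) = (\<integral>y. g y * fh y \<partial>lborel)"
    if "g \<in> T" for g
    using that bnd[OF that] by (intro split ints inth; auto)+
  have cW: "indicator (- W) y = 1 - w y" for y by (simp add: w_def indicator_def)
  have s1: "(\<integral>y. w y * fs y \<partial>lborel) + (\<integral>y. (1 - w y) * fs y \<partial>lborel) = 1"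
    and h1: "(\<integral>y. w y * fh y \<partial>lborel) + (\<integral>y. (1 - w y) * fh y \<partial>lborel) = 1"
    using splits[OF T(3)] splith[OF T(3)] one_s one_h by simp_all
  have tail': "(\<integral>y. (1 - w y) * fs y \<partial>lborel) \<le> \<eta>" using tail by (simp only: cW)
  have nn: "(\<integral>y. (1 - w y) * fs y \<partial>lborel) \<ge> 0" "(\<integral>y. (1 - w y) * fh y \<partial>lborel) \<ge> 0"
    using fs fh w01 by (auto intro!: integral_nonneg_AE AE_I2 mult_nonneg_nonneg simp: less_imp_le w_def)
  \<comment> \<open>A convex combination of the bounds for single atoms; it is indifferent to how
    the weights depend on the data.\<close>
  have dev1': "\<bar>A (\<lambda>y. w y * g y * x y) - (\<integral>y. w y * g y * fh y \<partial>lborel)\<bar> \<le> \<tau>" if g: "g \<in> T" for g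
  proof -
    let ?d = "\<lambda>j. A (\<lambda>y. w y * g y * (gdens \<sigma> (y - \<theta> j) / fs y)) - (\<integral>y. w y * g y * gdens \<sigma> (y - \<theta> j) \<partial>lborel)"
    have "A (\<lambda>y. w y * g y * x y) = (\<Sum>j<p. \<alpha> j * A (\<lambda>y. w y * g y * (gdens \<sigma> (y - \<theta> j) / fs y)))"
      unfolding A_def x_def fh_def mixd_def sum_distrib_left sum_divide_distrib
      by (subst sum.swap) (simp add: mult_ac)
    moreover have "(\<integral>y. w y * g y * fh y \<partial>lborel) = (\<Sum>j<p. \<alpha> j * (\<integral>y. w y * g y * gdens \<sigma> (y - \<theta> j) \<partial>lborel))"
      unfolding fh_def using g bnd(1)[OF g] by (intro integral_mixd(2)[OF \<sigma>]) auto
    ultimately have "\<bar>A (\<lambda>y. w y * g y * x y) - (\<integral>y. w y * g y * fh y \<partial>lborel)\<bar> = \<bar>\<Sum>j<p. \<alpha> j * ?d j\<bar>"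
      by (simp add: right_diff_distrib sum_subtractf)
    also have "\<dots> \<le> (\<Sum>j<p. \<bar>\<alpha> j * ?d j\<bar>)" by (rule sum_abs)
    also have "\<dots> \<le> (\<Sum>j<p. \<alpha> j * \<tau>)"
      using dev1[OF g] \<alpha>(1) by (intro sum_mono) (auto simp: abs_mult A_def w_def intro!: mult_left_mono)
    also have "\<dots> = \<tau>" using \<alpha>(2) by (simp flip: sum_distrib_right)
    finally show ?thesis .
  qed
  have dev2': "\<bar>A (\<lambda>y. w y * g y) - (\<integral>y. w y * g y * fs y \<partial>lborel)\<bar> \<le> \<tau>" if g: "g \<in> T" for g
    using dev2[OF g] by (simp add: A_def w_def)
  have Aw: "A w \<ge> 1 - \<eta> - \<tau>" using dev2'[OF T(3)] s1 tail' by simp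
  have Aw1: "A w \<le> 1" using A_mono[of w "\<lambda>_. 1"] A_const[of 1] by (simp add: w_def)
  have Awx: "A (\<lambda>y. w y * x y) \<le> 1 + \<tau>" using dev1'[OF T(3)] h1 nn by simp
  have hell: "A (\<lambda>y. w y * (sqrt (x y) - 1)\<^sup>2) \<le> (V + 2) * (\<eta> + \<tau>)"
  proof -
    have "0 \<le> A (\<lambda>y. ln (x y))"
    proof -
      have "ln (x y) = ln (fh y) - ln (fs y)" for y
        using fs[of y] fh[of y] by (simp add: x_def ln_div)
      thus ?thesis using like unfolding A_def by (simp add: sum_subtractf)
    qed
    \<comment> \<open>On \<open>W\<close> the Hellinger inequality is used. Off \<open>W\<close>
      only the crude bound ln x <= V is available, but it is weighted by the small empirical mass of
      the complement.\<close>
    also have "\<dots> \<le> A (\<lambda>y. (w y * x y - w y - w y * (sqrt (x y) - 1)\<^sup>2) + V * (1 - w y))"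
    proof (rule A_mono)
      fix i assume i: "i < n"
      have "x (Y i) \<le> exp V" using V(2)[OF i] fs[of "Y i"] by (simp add: x_def field_simps)
      hence "ln (x (Y i)) \<le> V" using x[of "Y i"] by (metis ln_exp ln_le_cancel_iff exp_gt_zero)
      thus "ln (x (Y i)) \<le> (w (Y i) * x (Y i) - w (Y i) - w (Y i) * (sqrt (x (Y i)) - 1)\<^sup>2) + V * (1 - w (Y i))"
        using w01[of "Y i"] ln_le_minus_hellinger[OF x, of "Y i"] by auto
    qed
    also have "\<dots> = A (\<lambda>y. w y * x y) - A w - A (\<lambda>y. w y * (sqrt (x y) - 1)\<^sup>2) + V * (1 - A w)"
      by (simp only: A_add A_diff A_mult A_const)
    finally have "A (\<lambda>y. w y * (sqrt (x y) - 1)\<^sup>2) \<le> (1 + \<tau>) - (1 - \<eta> - \<tau>) + V * (1 - A w)"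
      using Aw Awx by linarith
    also have "\<dots> \<le> (1 + \<tau>) - (1 - \<eta> - \<tau>) + V * (\<eta> + \<tau>)"
      using Aw V(1) by (intro add_left_mono mult_left_mono) auto
    also have "\<dots> \<le> (V + 2) * (\<eta> + \<tau>)" using \<eta> by (simp add: algebra_simps)
    finally show ?thesis .
  qed
  have l1: "A (\<lambda>y. w y * \<bar>x y - 1\<bar>) \<le> sqrt (6 * ((V + 2) * (\<eta> + \<tau>)))"
  proof (rule real_le_rsqrt)
    \<comment> \<open>Factoring x - 1 through sqrt x - 1 lets Cauchy-Schwarz pass from the Hellinger
      distance to the L1 distance. The other factor has empirical mean square at most 2 (1 + \<tau>)
      + 2 <= 6.\<close>
    have prod: "w y * \<bar>x y - 1\<bar> = (w y * \<bar>sqrt (x y) - 1\<bar>) * (w y * (sqrt (x y) + 1))" for y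
    proof -
      have "x y - 1 = (sqrt (x y) - 1) * (sqrt (x y) + 1)"
        using x[of y] by (simp add: algebra_simps)
      hence "\<bar>x y - 1\<bar> = \<bar>sqrt (x y) - 1\<bar> * (sqrt (x y) + 1)"
        using x[of y] by (simp add: abs_mult)
      thus ?thesis using w01[of y] by auto
    qed
    have "A (\<lambda>y. w y * \<bar>x y - 1\<bar>) = (1 / real n) * (\<Sum>i<n. (w (Y i) * \<bar>sqrt (x (Y i)) - 1\<bar>) * (w (Y i) * (sqrt (x (Y i)) + 1)))"
      unfolding A_def prod ..
    hence "(A (\<lambda>y. w y * \<bar>x y - 1\<bar>))\<^sup>2 = (1 / real n)\<^sup>2 * (\<Sum>i<n. (w (Y i) * \<bar>sqrt (x (Y i)) - 1\<bar>) * (w (Y i) * (sqrt (x (Y i)) + 1)))\<^sup>2"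
      by (simp only: power_mult_distrib)
    also have "\<dots> \<le> (1 / real n)\<^sup>2 * ((\<Sum>i<n. (w (Y i) * \<bar>sqrt (x (Y i)) - 1\<bar>)\<^sup>2) * (\<Sum>i<n. (w (Y i) * (sqrt (x (Y i)) + 1))\<^sup>2))"
      by (intro mult_left_mono Cauchy_Schwarz_ineq_sum) auto
    also have "\<dots> = A (\<lambda>y. (w y * \<bar>sqrt (x y) - 1\<bar>)\<^sup>2) * A (\<lambda>y. (w y * (sqrt (x y) + 1))\<^sup>2)"
      by (simp add: A_def power2_eq_square)
    also have "\<dots> \<le> ((V + 2) * (\<eta> + \<tau>)) * 6"
    proof (rule mult_mono)
      have "(\<lambda>y. (w y * \<bar>sqrt (x y) - 1\<bar>)\<^sup>2) = (\<lambda>y. w y * (sqrt (x y) - 1)\<^sup>2)"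
      proof
        fix y show "(w y * \<bar>sqrt (x y) - 1\<bar>)\<^sup>2 = w y * (sqrt (x y) - 1)\<^sup>2" using w01[of y] by auto
      qed
      thus "A (\<lambda>y. (w y * \<bar>sqrt (x y) - 1\<bar>)\<^sup>2) \<le> (V + 2) * (\<eta> + \<tau>)" using hell by simp
      have "A (\<lambda>y. (w y * (sqrt (x y) + 1))\<^sup>2) \<le> A (\<lambda>y. 2 * (w y * x y) + 2 * w y)"
      proof (rule A_mono)
        fix i
        have "(sqrt (x (Y i)) + 1)\<^sup>2 \<le> 2 * x (Y i) + 2"
          using zero_le_power2[of "sqrt (x (Y i)) - 1"] x[of "Y i"] by (simp add: power2_sum power2_diff)
        thus "(w (Y i) * (sqrt (x (Y i)) + 1))\<^sup>2 \<le> 2 * (w (Y i) * x (Y i)) + 2 * w (Y i)"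
          using w01[of "Y i"] by auto
      qed
      also have "\<dots> = 2 * A (\<lambda>y. w y * x y) + 2 * A w" by (simp only: A_add A_mult)
      also have "\<dots> \<le> 6" using Awx Aw1 \<tau> by linarith
      finally show "A (\<lambda>y. (w y * (sqrt (x y) + 1))\<^sup>2) \<le> 6" .
      show "0 \<le> A (\<lambda>y. (w y * (sqrt (x y) + 1))\<^sup>2)" using A_mono[of "\<lambda>_. 0"] A_const[of 0] by simp
      show "0 \<le> (V + 2) * (\<eta> + \<tau>)" using V \<eta> \<tau> by simp
    qed
    finally show "(A (\<lambda>y. w y * \<bar>x y - 1\<bar>))\<^sup>2 \<le> 6 * ((V + 2) * (\<eta> + \<tau>))" by (simp add: mult.commute)
  qed
  define e where "e = sqrt (6 * ((V + 2) * (\<eta> + \<tau>))) + 2 * \<tau>"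
  have inner: "\<bar>(\<integral>y. w y * g y * fh y \<partial>lborel) - (\<integral>y. w y * g y * fs y \<partial>lborel)\<bar> \<le> e" if g: "g \<in> T" for g
  proof -
    have "\<bar>A (\<lambda>y. w y * g y * x y) - A (\<lambda>y. w y * g y)\<bar> \<le> A (\<lambda>y. w y * \<bar>x y - 1\<bar>)"
    proof -
      have "g y * (x y - 1) \<le> \<bar>x y - 1\<bar>" "- (g y * (x y - 1)) \<le> \<bar>x y - 1\<bar>" for y
        using mult_right_mono[OF T(2)[OF g, of y], of "\<bar>x y - 1\<bar>"] by (auto simp: abs_mult[symmetric])
      hence "w y * g y * x y - w y * g y \<le> w y * \<bar>x y - 1\<bar>" "w y * g y - w y * g y * x y \<le> w y * \<bar>x y - 1\<bar>" for y
        using w01[of y] by (auto simp: algebra_simps)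
      hence "A (\<lambda>y. w y * g y * x y - w y * g y) \<le> A (\<lambda>y. w y * \<bar>x y - 1\<bar>)"
        and "A (\<lambda>y. w y * g y - w y * g y * x y) \<le> A (\<lambda>y. w y * \<bar>x y - 1\<bar>)"
        by (blast intro: A_mono)+
      thus ?thesis unfolding A_diff by linarith
    qed
    thus ?thesis using dev1'[OF g] dev2'[OF g] l1 unfolding e_def by linarith
  qed
  \<comment> \<open>No deviation bound covers \<open>fh\<close> outside \<open>W\<close>. Since both
    densities have total mass one, closeness of their masses inside \<open>W\<close> bounds the
    outer mass of \<open>fh\<close> by that of \<open>fs\<close> plus \<open>e\<close>.\<close>
  have out: "(\<integral>y. (1 - w y) * fh y \<partial>lborel) \<le> \<eta> + e"
    using inner[OF T(3)] s1 h1 tail' by simp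
  have outer: "\<bar>\<integral>y. (1 - w y) * h y * f y \<partial>lborel\<bar> \<le> (\<integral>y. (1 - w y) * f y \<partial>lborel)"
    if "\<And>y. f y > 0" "integrable lborel (\<lambda>y. (1 - w y) * f y)" for f
  proof -
    have "\<bar>\<integral>y. (1 - w y) * h y * f y \<partial>lborel\<bar> \<le> (\<integral>y. \<bar>(1 - w y) * h y * f y\<bar> \<partial>lborel)"
      by (rule integral_abs_bound)
    also have "\<dots> \<le> (\<integral>y. (1 - w y) * f y \<partial>lborel)"
    proof (rule integral_mono_AE'[OF that(2)])
      have "\<bar>(1 - w y) * h y * f y\<bar> \<le> (1 - w y) * f y" for y
        using T(2)[OF h, of y] w01[of y] that(1)[of y] by (auto simp: abs_mult)
      thus "AE y in lborel. \<bar>(1 - w y) * h y * f y\<bar> \<le> (1 - w y) * f y" by simp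
      show "AE y in lborel. 0 \<le> (1 - w y) * f y"
      proof (rule AE_I2)
        fix y show "0 \<le> (1 - w y) * f y" using w01[of y] that(1)[of y] by auto
      qed
    qed
    finally show ?thesis .
  qed
  have i1: "integrable lborel (\<lambda>y. (1 - w y) * fs y)" "integrable lborel (\<lambda>y. (1 - w y) * fh y)"
    by (intro ints inth; simp add: w_def indicator_def)+
  have "\<bar>(\<integral>y. h y * fh y \<partial>lborel) - (\<integral>y. h y * fs y \<partial>lborel)\<bar> \<le> e + (\<eta> + e) + \<eta>"
    using inner[OF h] outer[OF fs i1(1)] outer[OF fh i1(2)] out tail' splits[OF h] splith[OF h] by linarith
  thus ?thesis by (simp add: e_def)
qed

subsection \<open>Concentration and lattices\<close>

lemma indep_vars_PiM_components:
  assumes "I \<noteq> {}" "\<And>i. i \<in> I \<Longrightarrow> prob_space (M i)"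
  shows "prob_space.indep_vars (PiM I M) M (\<lambda>i x. x i) I"
proof -
  interpret prob_space "PiM I M" using assms(2) by (rule prob_space_PiM)
  have "distr (PiM I M) (PiM I M) (\<lambda>x. \<lambda>i\<in>I. x i) = distr (PiM I M) (PiM I M) (\<lambda>x. x)"
    by (intro distr_cong) (auto simp: space_PiM)
  also have "\<dots> = PiM I M" by (simp add: distr_id2)
  also have "\<dots> = PiM I (\<lambda>i. distr (PiM I M) (M i) (\<lambda>x. x i))"
    using assms(2) by (intro PiM_cong) (simp_all add: distr_PiM_component)
  finally show ?thesis
    by (subst indep_vars_iff_distr_eq_PiM') (use assms in auto)
qed

text \<open>The summands are independent but not identically distributed. The average of their laws
  is the equal-weight mixture at the centres, so the mean is an integral against
  \<open>mixd\<close>, and the range [-b, b] of each summand gives the exponent.\<close>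

lemma gauss_sample_hoeffding:
  fixes c :: "nat \<Rightarrow> 'a::euclidean_space" and g :: "'a \<Rightarrow> real"
  assumes \<sigma>: "\<sigma> > 0" and n: "n > 0" and [measurable]: "g \<in> borel_measurable borel"
    and b: "b > 0" "\<And>y. \<bar>g y\<bar> \<le> b" and \<tau>: "\<tau> \<ge> 0"
  defines "M \<equiv> PiM {..<n} (\<lambda>_. gauss_vec \<sigma> :: 'a measure)"
  shows "measure M {\<epsilon>\<in>space M. \<bar>(1 / real n) * (\<Sum>i<n. g (c i + \<epsilon> i)) - (\<integral>y. g y * mixd \<sigma> n (\<lambda>_. 1 / real n) c y \<partial>lborel)\<bar> \<ge> \<tau>}
       \<le> 2 * exp (- real n * \<tau>\<^sup>2 / (2 * b\<^sup>2))"
proof -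
  have ps: "prob_space (gauss_vec \<sigma> :: 'a measure)" by (rule prob_space_gauss_vec[OF \<sigma>])
  interpret prob_space M unfolding M_def by (intro prob_space_PiM ps)
  let ?X = "\<lambda>i \<epsilon>. g (c i + \<epsilon> i)"
  have indep: "indep_vars (\<lambda>_. borel) ?X {..<n}"
  proof (rule indep_vars_compose2[where X = "\<lambda>i x. x i" and M' = "\<lambda>_. gauss_vec \<sigma>"])
    show "indep_vars (\<lambda>_. gauss_vec \<sigma>) (\<lambda>i x. x i) {..<n}"
      unfolding M_def by (rule indep_vars_PiM_components) (use n ps in auto)
  qed simp
  interpret H: Hoeffding_ineq M "{..<n}" ?X "\<lambda>_. - b" "\<lambda>_. b" "\<Sum>i<n. expectation (?X i)"
    using indep b(2) by unfold_locales (auto simp: abs_le_iff intro!: AE_I2, metis minus_le_iff)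
  have ex: "expectation (?X i) = (\<integral>y. g y * gdens \<sigma> (y - c i) \<partial>lborel)" if i: "i < n" for i
  proof -
    have "(\<integral>e. g (c i + e) \<partial>distr M (gauss_vec \<sigma>) (\<lambda>\<epsilon>. \<epsilon> i)) = expectation (?X i)"
      unfolding M_def using i by (intro integral_distr) auto
    moreover have "distr M (gauss_vec \<sigma>) (\<lambda>\<epsilon>. \<epsilon> i) = gauss_vec \<sigma>"
      unfolding M_def using i ps by (intro distr_PiM_component) auto
    ultimately have "expectation (?X i) = (\<integral>e. g (c i + e) \<partial>gauss_vec \<sigma>)" by simp
    thus ?thesis by (simp add: integral_gauss_vec_shift)
  qed
  have mean: "(\<integral>y. g y * mixd \<sigma> n (\<lambda>_. 1 / real n) c y \<partial>lborel) = (1 / real n) * (\<Sum>i<n. expectation (?X i))"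
    by (subst integral_mixd(2)[OF \<sigma> _ b(2)]) (auto simp: ex sum_distrib_left)
  have "{\<epsilon>\<in>space M. \<bar>(1 / real n) * (\<Sum>i<n. g (c i + \<epsilon> i)) - (\<integral>y. g y * mixd \<sigma> n (\<lambda>_. 1 / real n) c y \<partial>lborel)\<bar> \<ge> \<tau>}
      = {\<epsilon>\<in>space M. \<bar>(\<Sum>i<n. ?X i \<epsilon>) - (\<Sum>i<n. expectation (?X i))\<bar> \<ge> real n * \<tau>}"
  proof -
    have "\<bar>(1 / real n) * s - (1 / real n) * e\<bar> \<ge> \<tau> \<longleftrightarrow> \<bar>s - e\<bar> \<ge> real n * \<tau>" for s e :: real
    proof -
      have "\<bar>(1 / real n) * s - (1 / real n) * e\<bar> = \<bar>s - e\<bar> / real n"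
        using n by (simp add: abs_divide flip: diff_divide_distrib)
      thus ?thesis using n by (simp add: field_simps)
    qed
    thus ?thesis unfolding mean by (simp only:)
  qed
  moreover have "measure M {\<epsilon>\<in>space M. \<bar>(\<Sum>i<n. ?X i \<epsilon>) - (\<Sum>i<n. expectation (?X i))\<bar> \<ge> real n * \<tau>}
      \<le> 2 * exp (-2 * (real n * \<tau>)\<^sup>2 / (\<Sum>i<n. (b - - b)\<^sup>2))"
    by (rule H.Hoeffding_ineq_abs_ge) (use n b \<tau> in auto)
  moreover have "-2 * (real n * \<tau>)\<^sup>2 / (\<Sum>i<n. (b - - b)\<^sup>2) = - real n * \<tau>\<^sup>2 / (2 * b\<^sup>2)"
    using n b(1) by (simp add: field_simps power2_eq_square)
  ultimately show ?thesis by simp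
qed

text \<open>A union bound: the first error term is for some noise vector leaving the ball of radius
  r, the second for some function in \<open>G\<close> deviating from its mean.\<close>

lemma gauss_sample_good_event:
  fixes c :: "nat \<Rightarrow> 'a::euclidean_space" and G :: "('a \<Rightarrow> real) set"
  assumes \<sigma>: "\<sigma> > 0" and n: "n > 0" and G: "finite G" "\<And>g. g \<in> G \<Longrightarrow> g \<in> borel_measurable borel"
    and b: "b > 0" "\<And>g y. g \<in> G \<Longrightarrow> \<bar>g y\<bar> \<le> b" and \<tau>: "\<tau> \<ge> 0" and r: "r \<ge> 0"
  defines "M \<equiv> PiM {..<n} (\<lambda>_. gauss_vec \<sigma> :: 'a measure)"
  obtains A where "A \<in> sets M"
    "measure M A \<ge> 1 - (real n * (2 powr (real DIM('a) / 2) * exp (- r\<^sup>2 / (4 * \<sigma>\<^sup>2))) + real (card G) * (2 * exp (- real n * \<tau>\<^sup>2 / (2 * b\<^sup>2))))"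
    "\<And>\<epsilon> i. \<epsilon> \<in> A \<Longrightarrow> i < n \<Longrightarrow> norm (\<epsilon> i) \<le> r"
    "\<And>\<epsilon> g. \<epsilon> \<in> A \<Longrightarrow> g \<in> G \<Longrightarrow>
       \<bar>(1 / real n) * (\<Sum>i<n. g (c i + \<epsilon> i)) - (\<integral>y. g y * mixd \<sigma> n (\<lambda>_. 1 / real n) c y \<partial>lborel)\<bar> \<le> \<tau>"
proof -
  have ps: "prob_space (gauss_vec \<sigma> :: 'a measure)" by (rule prob_space_gauss_vec[OF \<sigma>])
  interpret prob_space M unfolding M_def by (intro prob_space_PiM ps)
  define F where "F = (\<lambda>i. {\<epsilon>\<in>space M. norm (\<epsilon> i) > r})"
  define H where "H = (\<lambda>g. {\<epsilon>\<in>space M. \<bar>(1 / real n) * (\<Sum>i<n. g (c i + \<epsilon> i)) - (\<integral>y. g y * mixd \<sigma> n (\<lambda>_. 1 / real n) c y \<partial>lborel)\<bar> \<ge> \<tau>})"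
  have comp: "(\<lambda>\<epsilon>. \<epsilon> i) \<in> measurable M borel" if "i < n" for i
  proof -
    have "(\<lambda>\<epsilon>. \<epsilon> i) \<in> measurable M (gauss_vec \<sigma>)"
      unfolding M_def by (rule measurable_component_singleton) (use that in auto)
    thus ?thesis by (simp add: measurable_cong_sets[OF refl sets_gauss_vec])
  qed
  have Fm: "F i \<in> events" if "i < n" for i
  proof -
    note [measurable] = comp[OF that]
    show ?thesis unfolding F_def by measurable
  qed
  have Hm: "H g \<in> events" if "g \<in> G" for g
  proof -
    note [measurable] = comp G(2)[OF that]
    have "(\<lambda>\<epsilon>. \<Sum>i<n. g (c i + \<epsilon> i)) \<in> borel_measurable M"
      by (intro borel_measurable_sum) (auto intro!: measurable_compose[OF _ G(2)[OF that]] borel_measurable_add comp)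
    thus ?thesis unfolding H_def by measurable
  qed
  have Fp: "prob (F i) \<le> 2 powr (real DIM('a) / 2) * exp (- r\<^sup>2 / (4 * \<sigma>\<^sup>2))" if "i < n" for i
  proof -
    have meas: "(\<lambda>\<epsilon>. \<epsilon> i) \<in> measurable M (gauss_vec \<sigma>)"
      using comp[OF that] by (simp add: measurable_cong_sets[OF refl sets_gauss_vec])
    have "measure (distr M (gauss_vec \<sigma>) (\<lambda>\<epsilon>. \<epsilon> i)) {e. norm e > r} = prob (F i)"
      by (subst measure_distr[OF meas]) (auto simp: F_def intro!: arg_cong[where f = prob])
    moreover have "distr M (gauss_vec \<sigma>) (\<lambda>\<epsilon>. \<epsilon> i) = gauss_vec \<sigma>"
      unfolding M_def using that ps by (intro distr_PiM_component) auto
    ultimately show ?thesis using gauss_vec_norm_tail[OF \<sigma> r, where 'a='a] by simp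
  qed
  have Hp: "prob (H g) \<le> 2 * exp (- real n * \<tau>\<^sup>2 / (2 * b\<^sup>2))" if "g \<in> G" for g
    unfolding H_def M_def using G(2)[OF that] b(2)[OF that] by (intro gauss_sample_hoeffding \<sigma> n b(1) \<tau>) auto
  define Bad where "Bad = (\<Union>i\<in>{..<n}. F i) \<union> (\<Union>g\<in>G. H g)"
  have Bm: "Bad \<in> events" unfolding Bad_def using Fm Hm G(1) by auto
  have "prob Bad \<le> prob (\<Union>i\<in>{..<n}. F i) + prob (\<Union>g\<in>G. H g)"
    unfolding Bad_def using Fm Hm G(1) by (intro measure_Un_le) auto
  also have "\<dots> \<le> (\<Sum>i<n. prob (F i)) + (\<Sum>g\<in>G. prob (H g))"
    using Fm Hm G(1) by (intro add_mono measure_UNION_le) auto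
  also have "\<dots> \<le> (\<Sum>i<n. 2 powr (real DIM('a) / 2) * exp (- r\<^sup>2 / (4 * \<sigma>\<^sup>2))) + (\<Sum>g\<in>G. 2 * exp (- real n * \<tau>\<^sup>2 / (2 * b\<^sup>2)))"
    using Fp Hp by (intro add_mono sum_mono) auto
  finally have "prob Bad \<le> real n * (2 powr (real DIM('a) / 2) * exp (- r\<^sup>2 / (4 * \<sigma>\<^sup>2))) + real (card G) * (2 * exp (- real n * \<tau>\<^sup>2 / (2 * b\<^sup>2)))"
    by simp
  hence P: "prob (space M - Bad) \<ge> 1 - (real n * (2 powr (real DIM('a) / 2) * exp (- r\<^sup>2 / (4 * \<sigma>\<^sup>2))) + real (card G) * (2 * exp (- real n * \<tau>\<^sup>2 / (2 * b\<^sup>2))))"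
    using prob_compl[OF Bm] by linarith
  have "space M - Bad \<in> sets M" using Bm by auto
  from this P show ?thesis
    by (rule that) (auto simp: Bad_def F_def H_def not_less not_le less_imp_le)
qed

section \<open>Finite grids in Euclidean space\<close>

lemma lattice_finite:
  "finite (lattice \<delta> N :: 'a::euclidean_space set)"
  and card_lattice_le: "card (lattice \<delta> N :: 'a::euclidean_space set) \<le> (2 * N + 1) ^ DIM('a)"
proof -
  define S where "S = PiE (Basis::'a set) (\<lambda>_. {- int N..int N})"
  define \<Phi> where "\<Phi> = (\<lambda>z::'a \<Rightarrow> int. \<Sum>b\<in>Basis. (\<delta> * of_int (z b)) *\<^sub>R b)"
  have fin: "finite S" unfolding S_def by (intro finite_PiE) auto
  have sub: "lattice \<delta> N \<subseteq> \<Phi> ` S"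
  proof
    fix t :: 'a assume "t \<in> lattice \<delta> N"
    then obtain z :: "'a \<Rightarrow> int" where z: "\<And>b. b \<in> Basis \<Longrightarrow> \<bar>z b\<bar> \<le> int N \<and> t \<bullet> b = \<delta> * of_int (z b)"
      unfolding lattice_def by (simp only: mem_Collect_eq) metis
    have "restrict z Basis \<in> S" using z by (fastforce simp: S_def PiE_iff abs_le_iff)
    moreover have "t = \<Phi> (restrict z Basis)"
      by (rule euclidean_eqI) (simp add: \<Phi>_def z)
    ultimately show "t \<in> \<Phi> ` S" by blast
  qed
  show "finite (lattice \<delta> N :: 'a set)" by (rule finite_subset[OF sub]) (use fin in auto)
  have "card (lattice \<delta> N :: 'a set) \<le> card (\<Phi> ` S)" by (rule card_mono[OF _ sub]) (use fin in auto)
  also have "\<dots> \<le> card S" by (rule card_image_le[OF fin])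
  also have "card S = (2 * N + 1) ^ DIM('a)"
  proof -
    have "nat (2 * int N + 1) = 2 * N + 1" by simp
    thus ?thesis by (simp add: S_def card_PiE)
  qed
  finally show "card (lattice \<delta> N :: 'a set) \<le> (2 * N + 1) ^ DIM('a)" .
qed

text \<open>Every coordinate is rounded down to a multiple of \<delta>. The quotients lie in
  [-N, N], hence so do their floors, and the error is estimated in the l1 norm.\<close>

lemma lattice_approx:
  fixes x :: "'a::euclidean_space"
  assumes "\<delta> > 0" "norm x \<le> R" "R \<le> \<delta> * real N"
  obtains x' where "x' \<in> lattice \<delta> N" "norm (x - x') \<le> \<delta> * real DIM('a)"
proof -
  define x' where "x' = (\<Sum>b\<in>Basis. (\<delta> * of_int \<lfloor>(x \<bullet> b) / \<delta>\<rfloor>) *\<^sub>R b)"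
  have x': "x' \<bullet> b = \<delta> * of_int \<lfloor>(x \<bullet> b) / \<delta>\<rfloor>" if "b \<in> Basis" for b
    unfolding x'_def using that by (simp only: inner_sum_left_Basis)
  show ?thesis
  proof
    show "x' \<in> lattice \<delta> N"
      unfolding lattice_def
    proof clarify
      fix b :: 'a assume b: "b \<in> Basis"
      have "\<bar>x \<bullet> b\<bar> \<le> \<delta> * real N" using Basis_le_norm[OF b, of x] assms by linarith
      hence "x \<bullet> b / \<delta> \<le> real N" "- real N \<le> x \<bullet> b / \<delta>" using assms(1) by (auto simp: field_simps abs_le_iff)
      hence "\<bar>\<lfloor>(x \<bullet> b) / \<delta>\<rfloor>\<bar> \<le> int N" by linarith
      thus "\<exists>z. \<bar>z\<bar> \<le> int N \<and> x' \<bullet> b = \<delta> * real_of_int z" using x'[OF b] by blast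
    qed
    have "\<bar>(x - x') \<bullet> b\<bar> \<le> \<delta>" if b: "b \<in> Basis" for b
    proof -
      have "(x - x') \<bullet> b = \<delta> * (x \<bullet> b / \<delta> - of_int \<lfloor>(x \<bullet> b) / \<delta>\<rfloor>)"
        using assms(1) x'[OF b] by (simp add: inner_diff_left right_diff_distrib)
      moreover have "\<bar>x \<bullet> b / \<delta> - of_int \<lfloor>(x \<bullet> b) / \<delta>\<rfloor>\<bar> \<le> 1" by linarith
      ultimately show ?thesis using assms(1) by (simp add: abs_mult mult_left_le)
    qed
    hence "(\<Sum>b\<in>Basis. \<bar>(x - x') \<bullet> b\<bar>) \<le> (\<Sum>b\<in>(Basis::'a set). \<delta>)" by (rule sum_mono)
    thus "norm (x - x') \<le> \<delta> * real DIM('a)"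
      using norm_le_l1[of "x - x'"] by (simp add: mult.commute)
  qed
qed

lemma norm_lattice_le:
  assumes "t \<in> lattice \<delta> N" "\<delta> \<ge> 0"
  shows "(norm (t::'a::euclidean_space))\<^sup>2 \<le> real DIM('a) * (\<delta> * real N)\<^sup>2"
proof -
  have "(norm t)\<^sup>2 = (\<Sum>b\<in>Basis. (t \<bullet> b)\<^sup>2)"
    unfolding power2_norm_eq_inner euclidean_inner[of t t] by (simp add: power2_eq_square)
  also have "\<dots> \<le> (\<Sum>b\<in>(Basis::'a set). (\<delta> * real N)\<^sup>2)"
  proof (rule sum_mono)
    fix b :: 'a assume "b \<in> Basis"
    then obtain z :: int where z: "\<bar>z\<bar> \<le> int N" "t \<bullet> b = \<delta> * of_int z" using assms(1) by (auto simp: lattice_def)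
    have "\<bar>real_of_int z\<bar> \<le> real N" using z(1) by linarith
    hence "\<bar>t \<bullet> b\<bar> \<le> \<bar>\<delta> * real N\<bar>" using z(2) assms(2) by (simp add: abs_mult mult_left_mono)
    thus "(t \<bullet> b)\<^sup>2 \<le> (\<delta> * real N)\<^sup>2" by (simp only: abs_le_square_iff)
  qed
  finally show ?thesis by simp
qed

subsection \<open>Characteristic function of the estimated mixing measure\<close>

lemma mixd_le:
  fixes u :: "nat \<Rightarrow> 'a::euclidean_space"
  assumes "\<And>j. j < m \<Longrightarrow> \<beta> j \<ge> 0" "(\<Sum>j<m. \<beta> j) = 1"
  shows "mixd \<sigma> m \<beta> u y \<le> (2 * pi * \<sigma>\<^sup>2) powr (- real DIM('a) / 2)"
proof -
  have "mixd \<sigma> m \<beta> u y \<le> (\<Sum>j<m. \<beta> j * (2 * pi * \<sigma>\<^sup>2) powr (- real DIM('a) / 2))"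
    unfolding mixd_def using assms(1) by (intro sum_mono mult_left_mono gdens_le) auto
  thus ?thesis using assms(2) by (simp flip: sum_distrib_right)
qed

text \<open>All atoms lie within R + B of y, which gives a common lower bound for the Gaussian
  terms. It is used twice for the true density: on the truncation ball, where it is a denominator,
  and at the observations.\<close>

lemma mixd_ge:
  fixes u :: "nat \<Rightarrow> 'a::euclidean_space"
  assumes "\<And>j. j < m \<Longrightarrow> \<beta> j \<ge> 0" "(\<Sum>j<m. \<beta> j) = 1" "\<And>j. j < m \<Longrightarrow> norm (u j) \<le> B" "norm y \<le> R"
  shows "(2 * pi * \<sigma>\<^sup>2) powr (- real DIM('a) / 2) * exp (- (R + B)\<^sup>2 / (2 * \<sigma>\<^sup>2)) \<le> mixd \<sigma> m \<beta> u y"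
proof -
  have "norm (y - u j) \<le> R + B" if "j < m" for j
    using norm_triangle_ineq4[of y "u j"] assms(3)[OF that] assms(4) by linarith
  hence "(\<Sum>j<m. \<beta> j * ((2 * pi * \<sigma>\<^sup>2) powr (- real DIM('a) / 2) * exp (- (R + B)\<^sup>2 / (2 * \<sigma>\<^sup>2)))) \<le> mixd \<sigma> m \<beta> u y"
    unfolding mixd_def using assms(1) by (intro sum_mono mult_left_mono gdens_ge) auto
  thus ?thesis using assms(2) by (simp flip: sum_distrib_right)
qed

lemma mixd_tail:
  fixes u :: "nat \<Rightarrow> 'a::euclidean_space"
  assumes \<sigma>: "\<sigma> > 0" and "\<And>j. j < m \<Longrightarrow> \<beta> j \<ge> 0" "(\<Sum>j<m. \<beta> j) = 1" "\<And>j. j < m \<Longrightarrow> norm (u j) \<le> B" "B \<le> R"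
  shows "(\<integral>y. indicator (- cball 0 R) y * mixd \<sigma> m \<beta> u y \<partial>lborel)
     \<le> 2 powr (real DIM('a) / 2) * exp (- (R - B)\<^sup>2 / (4 * \<sigma>\<^sup>2))"
proof -
  let ?I = "indicator (- cball 0 R) :: 'a \<Rightarrow> real"
  interpret prob_space "gauss_vec \<sigma> :: 'a measure" by (rule prob_space_gauss_vec[OF \<sigma>])
  have "(\<integral>y. ?I y * gdens \<sigma> (y - u j) \<partial>lborel) \<le> 2 powr (real DIM('a) / 2) * exp (- (R - B)\<^sup>2 / (4 * \<sigma>\<^sup>2))"
    if j: "j < m" for j
  proof -
    have "(\<integral>y. ?I y * gdens \<sigma> (y - u j) \<partial>lborel) = (\<integral>e. ?I (u j + e) \<partial>gauss_vec \<sigma>)"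
      by (rule integral_gauss_vec_shift[symmetric]) simp
    also have "\<dots> \<le> (\<integral>e. indicator {e::'a. norm e > R - B} e \<partial>gauss_vec \<sigma>)"
    proof (rule integral_mono)
      show "integrable (gauss_vec \<sigma>) (\<lambda>e. ?I (u j + e))"
        by (rule integrable_const_bound[of _ 1]) (auto simp: indicator_def)
      show "integrable (gauss_vec \<sigma>) (indicator {e::'a. norm e > R - B} :: _ \<Rightarrow> real)"
        by (rule integrable_const_bound[of _ 1]) (auto simp: indicator_def)
      fix e :: 'a
      have "norm (u j + e) \<le> B + norm e" using norm_triangle_ineq[of "u j" e] assms(4)[OF j] by linarith
      thus "?I (u j + e) \<le> indicator {e. norm e > R - B} e" by (auto simp: indicator_def)
    qed
    also have "\<dots> = measure (gauss_vec \<sigma>) {e::'a. norm e > R - B}" by simp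
    also have "\<dots> \<le> 2 powr (real DIM('a) / 2) * exp (- (R - B)\<^sup>2 / (4 * \<sigma>\<^sup>2))"
      using assms(5) by (intro gauss_vec_norm_tail \<sigma>) auto
    finally show ?thesis .
  qed
  hence "(\<Sum>j<m. \<beta> j * (\<integral>y. ?I y * gdens \<sigma> (y - u j) \<partial>lborel))
      \<le> (\<Sum>j<m. \<beta> j * (2 powr (real DIM('a) / 2) * exp (- (R - B)\<^sup>2 / (4 * \<sigma>\<^sup>2))))"
    using assms(2) by (intro sum_mono mult_left_mono) auto
  also have "\<dots> = 2 powr (real DIM('a) / 2) * exp (- (R - B)\<^sup>2 / (4 * \<sigma>\<^sup>2))"
    using assms(3) by (simp flip: sum_distrib_right)
  finally show ?thesis
    by (subst integral_mixd(2)[OF \<sigma>, of _ 1]) (auto simp: indicator_def)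
qed

text \<open>The characteristic function of the mixture is that of the mixing measure times the
  Gaussian one. Real and imaginary parts are separated because the test functions of the likelihood
  bound are real-valued.\<close>

lemma mixd_char:
  fixes u :: "nat \<Rightarrow> 'a::euclidean_space"
  assumes \<sigma>: "\<sigma> > 0"
  shows "(\<integral>y. cos (t \<bullet> y) * mixd \<sigma> m \<beta> u y \<partial>lborel) = exp (- \<sigma>\<^sup>2 * (norm t)\<^sup>2 / 2) * Re (\<Sum>j<m. \<beta> j *\<^sub>R cis (t \<bullet> u j))"
    and "(\<integral>y. sin (t \<bullet> y) * mixd \<sigma> m \<beta> u y \<partial>lborel) = exp (- \<sigma>\<^sup>2 * (norm t)\<^sup>2 / 2) * Im (\<Sum>j<m. \<beta> j *\<^sub>R cis (t \<bullet> u j))"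
proof -
  have "has_bochner_integral lborel (\<lambda>y. Re (gdens \<sigma> (y - v) *\<^sub>R cis (t \<bullet> y))) (Re (exp (- \<sigma>\<^sup>2 * (norm t)\<^sup>2 / 2) *\<^sub>R cis (t \<bullet> v)))" for v
    by (rule has_bochner_integral_bounded_linear[OF bounded_linear_Re has_integral_gdens_shift_cis[OF \<sigma>]])
  hence c: "(\<integral>y. cos (t \<bullet> y) * gdens \<sigma> (y - v) \<partial>lborel) = exp (- \<sigma>\<^sup>2 * (norm t)\<^sup>2 / 2) * cos (t \<bullet> v)" for v
    by (simp add: has_bochner_integral_iff mult_ac)
  have "has_bochner_integral lborel (\<lambda>y. Im (gdens \<sigma> (y - v) *\<^sub>R cis (t \<bullet> y))) (Im (exp (- \<sigma>\<^sup>2 * (norm t)\<^sup>2 / 2) *\<^sub>R cis (t \<bullet> v)))" for v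
    by (rule has_bochner_integral_bounded_linear[OF bounded_linear_Im has_integral_gdens_shift_cis[OF \<sigma>]])
  hence s: "(\<integral>y. sin (t \<bullet> y) * gdens \<sigma> (y - v) \<partial>lborel) = exp (- \<sigma>\<^sup>2 * (norm t)\<^sup>2 / 2) * sin (t \<bullet> v)" for v
    by (simp add: has_bochner_integral_iff mult_ac)
  show "(\<integral>y. cos (t \<bullet> y) * mixd \<sigma> m \<beta> u y \<partial>lborel) = exp (- \<sigma>\<^sup>2 * (norm t)\<^sup>2 / 2) * Re (\<Sum>j<m. \<beta> j *\<^sub>R cis (t \<bullet> u j))"
    by (subst integral_mixd(2)[OF \<sigma>, of _ 1]) (auto simp: c sum_distrib_left sum_distrib_right mult_ac)
  show "(\<integral>y. sin (t \<bullet> y) * mixd \<sigma> m \<beta> u y \<partial>lborel) = exp (- \<sigma>\<^sup>2 * (norm t)\<^sup>2 / 2) * Im (\<Sum>j<m. \<beta> j *\<^sub>R cis (t \<bullet> u j))"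
    by (subst integral_mixd(2)[OF \<sigma>, of _ 1]) (auto simp: s sum_distrib_left sum_distrib_right mult_ac)
qed

text \<open>Here the unknown permutation disappears: with equal weights, the mixture depends only on
  the multiset of centres.\<close>

lemma mixd_permute:
  assumes "\<pi> permutes {..<n}"
  shows "mixd \<sigma> n (\<lambda>_. c) (\<lambda>i. a (\<pi> i)) y = mixd \<sigma> n (\<lambda>_. c) a y"
  unfolding mixd_def using sum.permute[OF assms, of "\<lambda>i. c * gdens \<sigma> (y - a i)"] by (simp add: o_def)

text \<open>\<open>K\<close> bounds the ratio of a single Gaussian to the true density on the ball
  of radius \<open>R1\<close>, and \<open>exp V\<close> the ratio of estimate to truth at the
  observations. \<open>\<eta>\<close> bounds the true mass outside the ball, and
  \<open>\<tau>'\<close> is the Hoeffding deviation enlarged by the error of rounding atoms to mesh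
  \<open>\<delta>\<close>. The exponential factor in the conclusion undoes the Gaussian damping at
  the highest lattice frequency.\<close>

lemma npmle_characteristic_function_close:
  fixes a :: "nat \<Rightarrow> 'a::euclidean_space"
  assumes \<sigma>: "\<sigma> > 0" and n: "n > 0" and B: "0 < B" "B \<le> R1" and r: "r \<ge> 0" and perm: "\<pi> permutes {..<n}"
    and a: "\<And>i. i < n \<Longrightarrow> norm (a i) \<le> B" and \<delta>: "\<delta> > 0" "B + r \<le> \<delta> * real Z" and \<tau>: "\<tau> \<ge> 0"
  defines "K \<equiv> exp ((R1 + B)\<^sup>2 / (2 * \<sigma>\<^sup>2))" and "V \<equiv> (B + r + B)\<^sup>2 / (2 * \<sigma>\<^sup>2)"
    and "\<eta> \<equiv> 2 powr (real DIM('a) / 2) * exp (- (R1 - B)\<^sup>2 / (4 * \<sigma>\<^sup>2))"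
  defines "\<tau>' \<equiv> \<tau> + 2 * (K / \<sigma> * (\<delta> * real DIM('a)))"
  assumes \<tau>'1: "\<tau>' \<le> 1"
  defines "M \<equiv> PiM {..<n} (\<lambda>_. gauss_vec \<sigma> :: 'a measure)"
  obtains A where "A \<in> sets M"
    "measure M A \<ge> 1 - (real n * (2 powr (real DIM('a) / 2) * exp (- r\<^sup>2 / (4 * \<sigma>\<^sup>2)))
        + (2 * (2 * real N + 1) ^ DIM('a) * (1 + (2 * real Z + 1) ^ DIM('a))) * (2 * exp (- real n * \<tau>\<^sup>2 / (2 * K\<^sup>2))))"
    "\<And>\<epsilon> p \<alpha> \<theta> j. \<epsilon> \<in> A \<Longrightarrow> is_npmle \<sigma> n (\<lambda>i. a (\<pi> i) + \<epsilon> i) p \<alpha> \<theta> \<Longrightarrow> j < p \<Longrightarrow> norm (\<theta> j) \<le> B + r"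
    "\<And>\<epsilon> p \<alpha> \<theta> t. \<epsilon> \<in> A \<Longrightarrow> is_npmle \<sigma> n (\<lambda>i. a (\<pi> i) + \<epsilon> i) p \<alpha> \<theta> \<Longrightarrow> t \<in> lattice (1 / (B + r)) N \<Longrightarrow>
       cmod ((\<Sum>i<n. (1 / real n) *\<^sub>R cis (t \<bullet> a i)) - (\<Sum>j<p. \<alpha> j *\<^sub>R cis (t \<bullet> \<theta> j)))
         \<le> 2 * (exp (\<sigma>\<^sup>2 * (real DIM('a) * (1 / (B + r) * real N)\<^sup>2) / 2) * (2 * sqrt (6 * ((V + 2) * (\<eta> + \<tau>'))) + 4 * \<tau>' + 2 * \<eta>))"
proof -
  define u where "u = (\<lambda>_::nat. 1 / real n)"
  have u: "\<And>j. j < n \<Longrightarrow> u j \<ge> 0" "(\<Sum>j<n. u j) = 1" using n by (auto simp: u_def)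
  define fs where "fs = mixd \<sigma> n u a"
  have fs_pos: "fs y > 0" for y unfolding fs_def by (intro mixd_pos \<sigma> u)
  have [measurable]: "fs \<in> borel_measurable borel" unfolding fs_def by measurable
  define W where "W = cball (0::'a) R1"
  have W[measurable]: "W \<in> sets borel" by (simp add: W_def)
  define F where "F = (lattice (1 / (B + r)) N :: 'a set)"
  \<comment> \<open>Frequency 0 is in \<open>F\<close>, so the constant 1 is among the cosines, as
    the likelihood argument demands.\<close>
  define T where "T = (\<lambda>t y. cos (t \<bullet> y)) ` F \<union> (\<lambda>t y. sin (t \<bullet> y)) ` F"
  define \<Theta> where "\<Theta> = (lattice \<delta> Z :: 'a set)"
  define G1 where "G1 = (\<lambda>(h::'a \<Rightarrow> real) y. indicator W y * h y)"
  define G2 where "G2 = (\<lambda>(h::'a \<Rightarrow> real) \<theta> y. indicator W y * h y * (gdens \<sigma> (y - \<theta>) / fs y))"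
  \<comment> \<open>The estimated atoms depend on the data. The ratio functions are therefore
    controlled only for atoms on the grid \<open>\<Theta>\<close>, and the Lipschitz bound
    \<open>G2_lip\<close> covers all others.\<close>
  define G where "G = G1 ` T \<union> (\<lambda>(h, \<theta>). G2 h \<theta>) ` (T \<times> \<Theta>)"
  define cp where "cp = (2 * pi * \<sigma>\<^sup>2) powr (- real DIM('a) / 2)"
  have cp: "cp > 0" using \<sigma> by (simp add: cp_def)
  have K1: "K \<ge> 1" by (simp add: K_def)
  have finT: "finite T" unfolding T_def F_def by (simp add: lattice_finite)
  have fin\<Theta>: "finite \<Theta>" by (simp add: \<Theta>_def lattice_finite)
  have finG: "finite G" unfolding G_def using finT fin\<Theta> by auto
  have T_meas: "h \<in> borel_measurable borel" and T_bd: "\<bar>h y\<bar> \<le> 1" if "h \<in> T" for h y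
    using that by (auto simp: T_def)
  have "0 \<in> F" by (auto simp: F_def lattice_def intro!: exI[of _ 0])
  hence T1: "(\<lambda>_. 1) \<in> T" unfolding T_def by (intro UnI1 image_eqI[of _ _ 0]) auto
  have cardG: "real (card G) \<le> 2 * (2 * real N + 1) ^ DIM('a) * (1 + (2 * real Z + 1) ^ DIM('a))"
  proof -
    have "card T \<le> card F + card F"
      unfolding T_def by (intro order_trans[OF card_Un_le] add_mono card_image_le) (auto simp: F_def lattice_finite)
    also have "\<dots> \<le> 2 * (2 * N + 1) ^ DIM('a)" using card_lattice_le[where 'a='a, of "1 / (B + r)" N] by (simp add: F_def)
    finally have cT: "card T \<le> 2 * (2 * N + 1) ^ DIM('a)" .
    have "card G \<le> card T + card (T \<times> \<Theta>)"
      unfolding G_def using finT fin\<Theta> by (intro order_trans[OF card_Un_le] add_mono card_image_le) auto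
    also have "\<dots> = card T * (1 + card \<Theta>)" by (simp add: card_cartesian_product)
    also have "\<dots> \<le> (2 * (2 * N + 1) ^ DIM('a)) * (1 + (2 * Z + 1) ^ DIM('a))"
      using card_lattice_le[where 'a='a, of \<delta> Z] by (intro mult_mono cT) (auto simp: \<Theta>_def)
    finally have "real (card G) \<le> real ((2 * (2 * N + 1) ^ DIM('a)) * (1 + (2 * Z + 1) ^ DIM('a)))"
      by (simp only: of_nat_le_iff)
    thus ?thesis by (simp add: algebra_simps)
  qed
  have fs_ge: "cp / K \<le> fs y" if "y \<in> W" for y
  proof -
    have "cp * exp (- (R1 + B)\<^sup>2 / (2 * \<sigma>\<^sup>2)) \<le> fs y"
      unfolding cp_def fs_def by (rule mixd_ge[OF u a]) (use that in \<open>auto simp: W_def\<close>)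
    thus ?thesis by (simp add: K_def exp_minus field_simps)
  qed
  have ratio: "indicator W y * (g / fs y) \<le> K * (g / cp)" if "g \<ge> 0" for y g
  proof (cases "y \<in> W")
    case True
    have "g / fs y \<le> g / (cp / K)"
      using fs_ge[OF True] cp K1 that by (intro divide_left_mono) (auto intro!: mult_pos_pos divide_pos_pos fs_pos)
    thus ?thesis using True by (simp add: mult.commute)
  qed (use that cp K1 in auto)
  have G1_bd: "\<bar>G1 h y\<bar> \<le> 1" if "h \<in> T" for h y
    using T_bd[OF that, of y] by (auto simp: G1_def indicator_def)
  have G2_bd: "\<bar>G2 h \<theta> y\<bar> \<le> K" if h: "h \<in> T" for h \<theta> y
  proof -
    have "\<bar>G2 h \<theta> y\<bar> = \<bar>h y\<bar> * (indicator W y * (gdens \<sigma> (y - \<theta>) / fs y))"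
      using fs_pos[of y] by (simp add: G2_def abs_mult)
    also have "\<dots> \<le> 1 * (K * (gdens \<sigma> (y - \<theta>) / cp))"
      using T_bd[OF h, of y] fs_pos[of y] cp K1 by (intro mult_mono ratio) auto
    also have "\<dots> \<le> K"
    proof -
      have "gdens \<sigma> (y - \<theta>) / cp \<le> 1" using gdens_le[of \<sigma> "y - \<theta>"] cp unfolding cp_def[symmetric] by simp
      thus ?thesis using K1 mult_left_le[of "gdens \<sigma> (y - \<theta>) / cp" K] by (simp only: mult_1_left)
    qed
    finally show ?thesis .
  qed
  have G2_lip: "\<bar>G2 h \<theta> y - G2 h \<theta>' y\<bar> \<le> K / \<sigma> * norm (\<theta> - \<theta>')" if h: "h \<in> T" for h \<theta> \<theta>' y
  proof -
    have "\<bar>G2 h \<theta> y - G2 h \<theta>' y\<bar> = \<bar>h y\<bar> * (indicator W y * (\<bar>gdens \<sigma> (y - \<theta>) - gdens \<sigma> (y - \<theta>')\<bar> / fs y))"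
      using fs_pos[of y] by (simp add: G2_def abs_mult abs_divide flip: right_diff_distrib diff_divide_distrib)
    also have "\<dots> \<le> 1 * (K * (\<bar>gdens \<sigma> (y - \<theta>) - gdens \<sigma> (y - \<theta>')\<bar> / cp))"
      using T_bd[OF h, of y] fs_pos[of y] cp K1 by (intro mult_mono ratio) auto
    also have "\<dots> \<le> 1 * (K * ((cp * (norm ((y - \<theta>) - (y - \<theta>')) / \<sigma>)) / cp))"
      using gdens_lipschitz[OF \<sigma>, of "y - \<theta>" "y - \<theta>'"] cp K1
      by (intro mult_left_mono divide_right_mono) (auto simp: cp_def)
    also have "\<dots> = K / \<sigma> * norm (\<theta> - \<theta>')" using cp by (simp add: norm_minus_commute)
    finally show ?thesis .
  qed
  have G1_meas: "G1 h \<in> borel_measurable borel" and G2_meas: "G2 h \<theta> \<in> borel_measurable borel" if "h \<in> T" for h \<theta>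
    using T_meas[OF that] unfolding G1_def G2_def by measurable
  have G_meas: "g \<in> borel_measurable borel" if "g \<in> G" for g
    using that G1_meas G2_meas by (auto simp: G_def)
  have G_bd: "\<bar>g y\<bar> \<le> K" if "g \<in> G" for g y
    using that G1_bd[of _ y] G2_bd K1 by (fastforce simp: G_def intro: order_trans)
  have K0: "K > 0" using K1 by linarith
  obtain A where A: "A \<in> sets M"
    "measure M A \<ge> 1 - (real n * (2 powr (real DIM('a) / 2) * exp (- r\<^sup>2 / (4 * \<sigma>\<^sup>2))) + real (card G) * (2 * exp (- real n * \<tau>\<^sup>2 / (2 * K\<^sup>2))))"
    "\<And>\<epsilon> i. \<epsilon> \<in> A \<Longrightarrow> i < n \<Longrightarrow> norm (\<epsilon> i) \<le> r"
    "\<And>\<epsilon> g. \<epsilon> \<in> A \<Longrightarrow> g \<in> G \<Longrightarrow>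
       \<bar>(1 / real n) * (\<Sum>i<n. g (a (\<pi> i) + \<epsilon> i)) - (\<integral>y. g y * mixd \<sigma> n (\<lambda>_. 1 / real n) (\<lambda>i. a (\<pi> i)) y \<partial>lborel)\<bar> \<le> \<tau>"
    unfolding M_def
    by (rule gauss_sample_good_event[where G = G and b = K and c = "\<lambda>i. a (\<pi> i)", OF \<sigma> n finG _ K0 _ \<tau> r])
      (use G_meas G_bd in blast)+
  have mix: "mixd \<sigma> n (\<lambda>_. 1 / real n) (\<lambda>i. a (\<pi> i)) = fs"
    unfolding fs_def u_def by (rule ext) (rule mixd_permute[OF perm])
  have Yb: "norm (a (\<pi> i) + \<epsilon> i) \<le> B + r" if "\<epsilon> \<in> A" "i < n" for \<epsilon> i
  proof -
    have "\<pi> i < n" using permutes_in_image[OF perm, of i] that(2) by simp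
    thus ?thesis using norm_triangle_ineq[of "a (\<pi> i)" "\<epsilon> i"] a[of "\<pi> i"] A(3)[OF that] by linarith
  qed
  have atoms: "norm (\<theta> j) \<le> B + r" if "\<epsilon> \<in> A" "is_npmle \<sigma> n (\<lambda>i. a (\<pi> i) + \<epsilon> i) p \<alpha> \<theta>" "j < p" for \<epsilon> p \<alpha> \<theta> j
    by (rule npmle_atoms_bounded[OF \<sigma> n that(2) _ that(3)]) (use Yb[OF that(1)] in auto)
  define e where "e = 2 * sqrt (6 * ((V + 2) * (\<eta> + \<tau>'))) + 4 * \<tau>' + 2 * \<eta>"
  have \<tau>': "\<tau> \<le> \<tau>'" unfolding \<tau>'_def using K0 \<sigma> \<delta> by simp
  have test: "\<bar>(\<integral>y. h y * mixd \<sigma> p \<alpha> \<theta> y \<partial>lborel) - (\<integral>y. h y * fs y \<partial>lborel)\<bar> \<le> e"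
    if \<epsilon>: "\<epsilon> \<in> A" and npmle: "is_npmle \<sigma> n (\<lambda>i. a (\<pi> i) + \<epsilon> i) p \<alpha> \<theta>" and h: "h \<in> T" for \<epsilon> p \<alpha> \<theta> h
  proof -
    let ?Y = "\<lambda>i. a (\<pi> i) + \<epsilon> i"
    have \<alpha>: "\<And>j. j < p \<Longrightarrow> \<alpha> j \<ge> 0" "(\<Sum>j<p. \<alpha> j) = 1"
      using npmle by (auto simp: is_npmle_def less_imp_le)
    show ?thesis
      unfolding e_def fs_def
    proof (rule likelihood_test_function_bound[OF \<sigma> n u \<alpha>, where T = T and W = W and Y = ?Y])
      show "(\<Sum>i<n. ln (mixd \<sigma> n u a (?Y i))) \<le> (\<Sum>i<n. ln (mixd \<sigma> p \<alpha> \<theta> (?Y i)))"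
        by (rule npmle_likelihood_ge[OF npmle u])
      show "V \<ge> 0" by (simp add: V_def)
      show "mixd \<sigma> p \<alpha> \<theta> (?Y i) \<le> exp V * mixd \<sigma> n u a (?Y i)" if i: "i < n" for i
      proof -
        have "cp * exp (- (B + r + B)\<^sup>2 / (2 * \<sigma>\<^sup>2)) \<le> mixd \<sigma> n u a (?Y i)"
          unfolding cp_def by (rule mixd_ge[OF u a Yb[OF \<epsilon> i]])
        hence "cp \<le> exp V * mixd \<sigma> n u a (?Y i)" by (simp add: V_def exp_minus field_simps)
        moreover have "mixd \<sigma> p \<alpha> \<theta> (?Y i) \<le> cp" unfolding cp_def by (rule mixd_le[OF \<alpha>])
        ultimately show ?thesis by linarith
      qed
      show "W \<in> sets borel" by (rule W)
      show "\<And>h. h \<in> T \<Longrightarrow> h \<in> borel_measurable borel" "\<And>h y. h \<in> T \<Longrightarrow> \<bar>h y\<bar> \<le> 1" "(\<lambda>_. 1) \<in> T"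
        using T_meas T_bd T1 by auto
      show "\<bar>1 / real n * (\<Sum>i<n. indicator W (?Y i) * h (?Y i)) - (\<integral>y. indicator W y * h y * mixd \<sigma> n u a y \<partial>lborel)\<bar> \<le> \<tau>'"
        if "h \<in> T" for h
      proof -
        have "G1 h \<in> G" using that by (auto simp: G_def)
        from A(4)[OF \<epsilon> this] show ?thesis using \<tau>' unfolding mix by (simp add: G1_def fs_def)
      qed
      show "\<bar>1 / real n * (\<Sum>i<n. indicator W (?Y i) * h (?Y i) * (gdens \<sigma> (?Y i - \<theta> j) / mixd \<sigma> n u a (?Y i)))
          - (\<integral>y. indicator W y * h y * gdens \<sigma> (y - \<theta> j) \<partial>lborel)\<bar> \<le> \<tau>'" if h: "h \<in> T" and j: "j < p" for h j
      proof -
        obtain \<theta>' where \<theta>': "\<theta>' \<in> \<Theta>" "norm (\<theta> j - \<theta>') \<le> \<delta> * real DIM('a)"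
          unfolding \<Theta>_def using lattice_approx[OF \<delta>(1) atoms[OF \<epsilon> npmle j] \<delta>(2)] by metis
        have "G2 h \<theta>' \<in> G" unfolding G_def using h \<theta>'(1) by auto
        note dev = A(4)[OF \<epsilon> this, unfolded mix]
        \<comment> \<open>The rounding error enters once through the empirical average and once
          through the integral, hence the factor 2 in \<open>\<tau>'\<close>.\<close>
        define \<rho> where "\<rho> = K / \<sigma> * (\<delta> * real DIM('a))"
        have lip: "\<bar>G2 h (\<theta> j) y - G2 h \<theta>' y\<bar> \<le> \<rho>" for y
          using G2_lip[OF h, of "\<theta> j" y \<theta>'] mult_left_mono[OF \<theta>'(2), of "K / \<sigma>"] K0 \<sigma> by (simp add: \<rho>_def)
        have i1: "\<bar>(1 / real n) * (\<Sum>i<n. G2 h (\<theta> j) (?Y i)) - (1 / real n) * (\<Sum>i<n. G2 h \<theta>' (?Y i))\<bar> \<le> \<rho>"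
        proof -
          have "\<bar>\<Sum>i<n. G2 h (\<theta> j) (?Y i) - G2 h \<theta>' (?Y i)\<bar> \<le> (\<Sum>i<n. \<rho>)"
            by (intro order_trans[OF sum_abs] sum_mono lip)
          hence "(1 / real n) * \<bar>\<Sum>i<n. G2 h (\<theta> j) (?Y i) - G2 h \<theta>' (?Y i)\<bar> \<le> (1 / real n) * (\<Sum>i<n. \<rho>)"
            by (intro mult_left_mono) auto
          thus ?thesis using n by (simp add: sum_subtractf abs_divide flip: diff_divide_distrib)
        qed
        have i2: "\<bar>(\<integral>y. G2 h (\<theta> j) y * fs y \<partial>lborel) - (\<integral>y. G2 h \<theta>' y * fs y \<partial>lborel)\<bar> \<le> \<rho>"
        proof -
          have i: "integrable lborel (\<lambda>y. G2 h t y * fs y)" for t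
            unfolding fs_def by (rule integral_mixd(1)[OF \<sigma> G2_meas[OF h] G2_bd[OF h]])
          have ifs: "integrable lborel fs"
            using integral_mixd(1)[OF \<sigma>, of "\<lambda>_. 1" 1 n u a] by (simp add: fs_def)
          have "\<bar>(\<integral>y. G2 h (\<theta> j) y * fs y \<partial>lborel) - (\<integral>y. G2 h \<theta>' y * fs y \<partial>lborel)\<bar>
              = \<bar>\<integral>y. G2 h (\<theta> j) y * fs y - G2 h \<theta>' y * fs y \<partial>lborel\<bar>"
            by (simp add: Bochner_Integration.integral_diff[OF i i])
          also have "\<dots> \<le> (\<integral>y. \<bar>G2 h (\<theta> j) y * fs y - G2 h \<theta>' y * fs y\<bar> \<partial>lborel)"
            by (rule integral_abs_bound)
          also have "\<dots> \<le> (\<integral>y. \<rho> * fs y \<partial>lborel)"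
          proof (rule integral_mono)
            show "integrable lborel (\<lambda>y. \<bar>G2 h (\<theta> j) y * fs y - G2 h \<theta>' y * fs y\<bar>)" using i by auto
            show "integrable lborel (\<lambda>y. \<rho> * fs y)" using ifs by auto
            show "\<bar>G2 h (\<theta> j) y * fs y - G2 h \<theta>' y * fs y\<bar> \<le> \<rho> * fs y" for y
              using lip[of y] fs_pos[of y] by (simp add: abs_mult mult_right_mono flip: left_diff_distrib)
          qed
          also have "\<dots> = \<rho>" using integral_mixd_one[OF \<sigma> u(2), of a] by (simp add: fs_def)
          finally show ?thesis .
        qed
        \<comment> \<open>The true density cancels: integrating the ratio against \<open>fs\<close>
          returns the plain Gaussian integral.\<close>
        have e1: "(\<integral>y. indicator W y * h y * gdens \<sigma> (y - \<theta> j) \<partial>lborel) = (\<integral>y. G2 h (\<theta> j) y * fs y \<partial>lborel)"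
          using fs_pos by (intro Bochner_Integration.integral_cong refl) (simp add: G2_def less_imp_neq[symmetric])
        have e2: "(\<Sum>i<n. indicator W (?Y i) * h (?Y i) * (gdens \<sigma> (?Y i - \<theta> j) / mixd \<sigma> n u a (?Y i)))
            = (\<Sum>i<n. G2 h (\<theta> j) (?Y i))"
          by (simp add: G2_def fs_def)
        have "\<tau>' = \<tau> + 2 * \<rho>" by (simp add: \<tau>'_def \<rho>_def)
        thus ?thesis unfolding e1 e2 using i1 i2 dev by linarith
      qed
      show "(\<integral>y. indicator (- W) y * mixd \<sigma> n u a y \<partial>lborel) \<le> \<eta>"
        unfolding W_def \<eta>_def by (rule mixd_tail[OF \<sigma> u a B(2)])
      show "0 \<le> \<tau>'" using \<tau> \<tau>' by linarith
      show "0 \<le> \<eta>" by (simp add: \<eta>_def)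
    qed (use \<tau>'1 h in auto)
  qed
  show ?thesis
  proof (rule that[OF A(1)])
    have "real (card G) * (2 * exp (- real n * \<tau>\<^sup>2 / (2 * K\<^sup>2)))
        \<le> (2 * (2 * real N + 1) ^ DIM('a) * (1 + (2 * real Z + 1) ^ DIM('a))) * (2 * exp (- real n * \<tau>\<^sup>2 / (2 * K\<^sup>2)))"
      by (intro mult_right_mono cardG) auto
    thus "measure M A \<ge> 1 - (real n * (2 powr (real DIM('a) / 2) * exp (- r\<^sup>2 / (4 * \<sigma>\<^sup>2)))
        + (2 * (2 * real N + 1) ^ DIM('a) * (1 + (2 * real Z + 1) ^ DIM('a))) * (2 * exp (- real n * \<tau>\<^sup>2 / (2 * K\<^sup>2))))"
      using A(2) by linarith
  next
    fix \<epsilon> p \<alpha> and \<theta> :: "nat \<Rightarrow> 'a" and j assume "\<epsilon> \<in> A" "is_npmle \<sigma> n (\<lambda>i. a (\<pi> i) + \<epsilon> i) p \<alpha> \<theta>" "j < p"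
    thus "norm (\<theta> j) \<le> B + r" by (rule atoms)
  next
    fix \<epsilon> p \<alpha> and \<theta> :: "nat \<Rightarrow> 'a" and t :: 'a
    assume \<epsilon>: "\<epsilon> \<in> A" and npmle: "is_npmle \<sigma> n (\<lambda>i. a (\<pi> i) + \<epsilon> i) p \<alpha> \<theta>" and t: "t \<in> lattice (1 / (B + r)) N"
    define D where "D = (\<Sum>i<n. u i *\<^sub>R cis (t \<bullet> a i)) - (\<Sum>j<p. \<alpha> j *\<^sub>R cis (t \<bullet> \<theta> j))"
    define E where "E = exp (- \<sigma>\<^sup>2 * (norm t)\<^sup>2 / 2)"
    have E: "E > 0" by (simp add: E_def)
    have "(\<lambda>y. cos (t \<bullet> y)) \<in> T" "(\<lambda>y. sin (t \<bullet> y)) \<in> T" using t by (auto simp: T_def F_def)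
    note this[THEN test[OF \<epsilon> npmle]]
    hence "\<bar>E * Re D\<bar> \<le> e" "\<bar>E * Im D\<bar> \<le> e"
      unfolding fs_def mixd_char[OF \<sigma>] E_def[symmetric] D_def right_diff_distrib[symmetric] minus_complex.sel
      by (simp_all add: abs_minus_commute right_diff_distrib)
    \<comment> \<open>Bounding the modulus by |Re| + |Im| costs the factor 2; dividing by
      \<open>E\<close> afterwards is the deconvolution.\<close>
    hence "E * cmod D \<le> 2 * e"
      using mult_left_mono[OF cmod_le[of D], of E] E by (simp add: abs_mult distrib_left)
    hence 1: "cmod D \<le> (1 / E) * (2 * e)" using E by (simp add: field_simps)
    have "0 \<le> 2 * e" using \<open>E * cmod D \<le> 2 * e\<close> E by (meson mult_nonneg_nonneg norm_ge_zero less_imp_le order_trans)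
    moreover have "1 / E \<le> exp (\<sigma>\<^sup>2 * (real DIM('a) * (1 / (B + r) * real N)\<^sup>2) / 2)"
    proof -
      have "(norm t)\<^sup>2 \<le> real DIM('a) * (1 / (B + r) * real N)\<^sup>2"
        using B r by (intro norm_lattice_le[OF t]) auto
      hence "\<sigma>\<^sup>2 * (norm t)\<^sup>2 / 2 \<le> \<sigma>\<^sup>2 * (real DIM('a) * (1 / (B + r) * real N)\<^sup>2) / 2"
        by (intro divide_right_mono mult_left_mono) auto
      moreover have "1 / E = exp (\<sigma>\<^sup>2 * (norm t)\<^sup>2 / 2)" by (simp add: E_def exp_minus field_simps)
      ultimately show ?thesis by simp
    qed
    ultimately have "(1 / E) * (2 * e) \<le> exp (\<sigma>\<^sup>2 * (real DIM('a) * (1 / (B + r) * real N)\<^sup>2) / 2) * (2 * e)"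
      by (rule mult_right_mono[rotated])
    with 1 have "cmod D \<le> 2 * (exp (\<sigma>\<^sup>2 * (real DIM('a) * (1 / (B + r) * real N)\<^sup>2) / 2) * e)" by (simp add: mult_ac)
    thus "cmod ((\<Sum>i<n. (1 / real n) *\<^sub>R cis (t \<bullet> a i)) - (\<Sum>j<p. \<alpha> j *\<^sub>R cis (t \<bullet> \<theta> j)))
         \<le> 2 * (exp (\<sigma>\<^sup>2 * (real DIM('a) * (1 / (B + r) * real N)\<^sup>2) / 2) * (2 * sqrt (6 * ((V + 2) * (\<eta> + \<tau>'))) + 4 * \<tau>' + 2 * \<eta>))"
      by (simp only: D_def u_def e_def)
  qed
qed

subsection \<open>Rate of convergence\<close>

lemma square_add_le: "(x + y)\<^sup>2 \<le> 2 * x\<^sup>2 + 2 * y\<^sup>2" for x y :: real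
  using zero_le_power2[of "x - y"] by (simp add: power2_sum power2_diff)

text \<open>The exponents, up to constants and powers of ln n: truncation at \<sigma> sqrt(ln n / 8)
  makes K at most n^(1/8) and \<eta> at most n^(-1/64). With \<tau> = n^(-1/4) the Hoeffding
  exponent is at least of order n^(1/4), which beats a polynomial number of test functions. The
  square root in the likelihood bound turns n^(-1/64) into n^(-1/128), and deconvolution costs
  n^(1/512), leaving n^(-3/512).\<close>

lemma npmle_wasserstein_rate:
  fixes B \<sigma> :: real
  assumes B: "B > 0" and \<sigma>: "\<sigma> > 0"
  shows "\<exists>n0 C. C > 0 \<and> (\<forall>n (a :: nat \<Rightarrow> 'a::euclidean_space) \<pi>. n \<ge> n0 \<longrightarrow> \<pi> permutes {..<n} \<longrightarrow> (\<forall>i<n. norm (a i) \<le> B) \<longrightarrow>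
    (\<exists>A \<in> sets (PiM {..<n} (\<lambda>_. gauss_vec \<sigma> :: 'a measure)).
       measure (PiM {..<n} (\<lambda>_. gauss_vec \<sigma> :: 'a measure)) A \<ge> 1 - 5 / real n \<and>
       (\<forall>\<epsilon>\<in>A. \<forall>p \<alpha> \<theta>. is_npmle \<sigma> n (\<lambda>i. a (\<pi> i) + \<epsilon> i) p \<alpha> \<theta> \<longrightarrow>
          (\<exists>\<gamma>. is_coupling n p \<alpha> \<gamma> \<and> (\<Sum>i<n. \<Sum>j<p. \<gamma> i j * (norm (a i - \<theta> j))\<^sup>2) \<le> C / ln (real n)))))"
proof -
  define d where "d = real DIM('a)"
  have d: "d \<ge> 1" unfolding d_def by (simp add: Suc_leI)
  \<comment> \<open>Chosen so that \<open>\<sigma>\<^sup>2 * d * k\<^sup>2 / 2 = 1 / 512\<close>,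
    the exponent of n lost in the deconvolution.\<close>
  define k where "k = 1 / (16 * \<sigma> * sqrt d)"
  have k: "k > 0" using \<sigma> d by (simp add: k_def)
  have k2: "k\<^sup>2 = 1 / (256 * \<sigma>\<^sup>2 * d)" using d by (simp add: k_def power_divide power_mult_distrib)
  define c1 where "c1 = 2 powr (d / 2) * exp (B\<^sup>2 / (4 * \<sigma>\<^sup>2))"
  define c2 where "c2 = exp (B\<^sup>2 / \<sigma>\<^sup>2)"
  define c3 where "c3 = 1 + 2 * (c2 / \<sigma> * d)"
  define c4 where "c4 = 2 * B\<^sup>2 + 8 * \<sigma>\<^sup>2 * (2 + d)"
  define c5 where "c5 = (8 * B\<^sup>2 + 8 * \<sigma>\<^sup>2 * (2 + d)) / (2 * \<sigma>\<^sup>2)"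
  define c6 where "c6 = 2 * sqrt (6 * ((c5 + 2) * (c1 + c3))) + 4 * c3 + 2 * c1"
  define c7 where "c7 = k * sqrt c4 + 1"
  define c8 where "c8 = 4 * c4 * c7 ^ DIM('a) * (2 * c6)"
  have c1: "c1 > 0" and c2: "c2 > 0" by (simp_all add: c1_def c2_def)
  have c3: "c3 > 0" unfolding c3_def using c2 \<sigma> d by (intro add_pos_nonneg) auto
  have c4: "c4 > 0" unfolding c4_def using B \<sigma> d by (intro add_pos_nonneg) auto
  have c5: "c5 \<ge> 0" unfolding c5_def using \<sigma> d by (intro divide_nonneg_nonneg) auto
  have c6: "c6 \<ge> 0" unfolding c6_def using c1 c3 c5 by simp
  have c7: "c7 \<ge> 1" unfolding c7_def using k c4 by simp
  \<comment> \<open>The first summand is \<open>16 * d * pi\<^sup>2 / k\<^sup>2\<close>, the cost of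
    smoothing; the 1 pays for the mass that cannot be transported through the smoothed
    measures.\<close>
  define C where "C = 4096 * d\<^sup>2 * pi\<^sup>2 * \<sigma>\<^sup>2 + 1"
  have C: "C > 0" unfolding C_def by (intro add_nonneg_pos) auto

  define c where "c = 1 / (2 * c2\<^sup>2)"
  have c: "c > 0" using c2 by (simp add: c_def)
  \<comment> \<open>In the exponent \<open>3 * DIM('a) + 1\<close>, the frequencies account for
    \<open>DIM('a)\<close>, the grid of atoms for \<open>2 * DIM('a)\<close>, and the target
    probability 1/n for one. In \<open>DIM('a) + 3\<close>, the squared radius, the error
    \<open>e\<close> and the target 1 / ln n account for one logarithm each, and the kernel for
    \<open>DIM('a)\<close>.\<close>
  have "eventually (\<lambda>x::real. x \<ge> 6 \<and> ln x \<ge> 1 \<and> B \<le> \<sigma> * sqrt (ln x / 8) \<and> c3 * x powr (-1/4) \<le> 1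
      \<and> 2 * c7 * ln x \<le> x \<and> 2 * x * (sqrt c4 * ln x) + 3 \<le> x\<^sup>2
      \<and> 8 * x ^ (3 * DIM('a) + 1) \<le> exp (c * x powr (1/4))
      \<and> c8 * ln x ^ (DIM('a) + 3) \<le> x powr (3/512)) at_top"
  proof (intro eventually_conj)
    show "eventually (\<lambda>x::real. x \<ge> 6) at_top" by (rule eventually_ge_at_top)
    show "eventually (\<lambda>x::real. ln x \<ge> 1) at_top" by real_asymp
    show "eventually (\<lambda>x::real. B \<le> \<sigma> * sqrt (ln x / 8)) at_top" using \<sigma> by real_asymp
    show "eventually (\<lambda>x::real. c3 * x powr (-1/4) \<le> 1) at_top" by real_asymp
    show "eventually (\<lambda>x::real. 2 * c7 * ln x \<le> x) at_top" by real_asymp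
    show "eventually (\<lambda>x::real. 2 * x * (sqrt c4 * ln x) + 3 \<le> x\<^sup>2) at_top" by real_asymp
    show "eventually (\<lambda>x::real. 8 * x ^ (3 * DIM('a) + 1) \<le> exp (c * x powr (1/4))) at_top" using c by real_asymp
    show "eventually (\<lambda>x::real. c8 * ln x ^ (DIM('a) + 3) \<le> x powr (3/512)) at_top" by real_asymp
  qed
  from eventually_compose_filterlim[OF this filterlim_real_sequentially]
  obtain n0 where n0: "\<And>n. n \<ge> n0 \<Longrightarrow> real n \<ge> 6 \<and> ln (real n) \<ge> 1 \<and> B \<le> \<sigma> * sqrt (ln (real n) / 8) \<and> c3 * real n powr (-1/4) \<le> 1
      \<and> 2 * c7 * ln (real n) \<le> real n \<and> 2 * real n * (sqrt c4 * ln (real n)) + 3 \<le> (real n)\<^sup>2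
      \<and> 8 * real n ^ (3 * DIM('a) + 1) \<le> exp (c * real n powr (1/4))
      \<and> c8 * ln (real n) ^ (DIM('a) + 3) \<le> real n powr (3/512)"
    unfolding eventually_sequentially by blast
  show ?thesis
  proof (intro exI[of _ n0] exI[of _ C] conjI C allI impI)
    fix n :: nat and a :: "nat \<Rightarrow> 'a" and \<pi>
    assume n: "n \<ge> n0" and perm: "\<pi> permutes {..<n}" and a: "\<forall>i<n. norm (a i) \<le> B"
    define x where "x = real n"
    define l where "l = ln x"
    have x6: "x \<ge> 6" and l1: "l \<ge> 1" and aB: "B \<le> \<sigma> * sqrt (l / 8)" and a3: "c3 * x powr (-1/4) \<le> 1"
      and a7: "2 * c7 * l \<le> x" and a4: "2 * x * (sqrt c4 * l) + 3 \<le> x\<^sup>2"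
      and aexp: "8 * x ^ (3 * DIM('a) + 1) \<le> exp (c * x powr (1/4))"
      and a8: "c8 * l ^ (DIM('a) + 3) \<le> x powr (3/512)"
      using n0[OF n] by (auto simp: x_def l_def)
    have x0: "x > 0" using x6 by simp
    have n_pos: "n > 0" using x0 by (simp add: x_def)
    have expl: "exp (q * l) = x powr q" for q using x0 by (simp add: powr_def l_def)
    define R1 where "R1 = \<sigma> * sqrt (l / 8)"
    \<comment> \<open>This gives \<open>r\<^sup>2 / (4 * \<sigma>\<^sup>2) = 2 * l + d\<close>. The
      first term pays for the union over n noise vectors and leaves 1/n; the second absorbs the
      factor \<open>2 powr (d / 2)\<close>.\<close>
    define r where "r = 2 * \<sigma> * sqrt (2 * l + d)"
    define R2 where "R2 = B + r"
    define \<delta> where "\<delta> = 1 / x"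
    define Z where "Z = nat \<lceil>x * R2\<rceil>"
    \<comment> \<open>The lattice frequencies have coordinates at most N / R2, and this choice keeps
      them below \<open>k * sqrt l\<close>. Since \<open>R2\<close> is of order
      \<open>sqrt l\<close>, the degree is of order \<open>l\<close>.\<close>
    define N where "N = nat \<lfloor>R2 * (k * sqrt l)\<rfloor>"
    define \<tau> where "\<tau> = x powr (-1/4)"
    define K where "K = exp ((R1 + B)\<^sup>2 / (2 * \<sigma>\<^sup>2))"
    define V where "V = (B + r + B)\<^sup>2 / (2 * \<sigma>\<^sup>2)"
    define \<eta> where "\<eta> = 2 powr (d / 2) * exp (- (R1 - B)\<^sup>2 / (4 * \<sigma>\<^sup>2))"
    define \<tau>' where "\<tau>' = \<tau> + 2 * (K / \<sigma> * (\<delta> * d))"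
    define e where "e = 2 * sqrt (6 * ((V + 2) * (\<eta> + \<tau>'))) + 4 * \<tau>' + 2 * \<eta>"
    have r0: "r \<ge> 0" using \<sigma> l1 d by (simp add: r_def)
    have R2: "R2 > 0" using B r0 by (simp add: R2_def)
    have r2: "r\<^sup>2 = 4 * \<sigma>\<^sup>2 * (2 * l + d)" using l1 d by (simp add: r_def power_mult_distrib)
    have r2': "r\<^sup>2 \<le> 4 * \<sigma>\<^sup>2 * ((2 + d) * l)"
      unfolding r2 using l1 d mult_right_mono[of 1 l d] by (intro mult_left_mono) (auto simp: algebra_simps)
    have R1sq: "R1\<^sup>2 = \<sigma>\<^sup>2 * l / 8" using l1 by (simp add: R1_def power_mult_distrib)
    have K: "K \<le> c2 * x powr (1/8)"
    proof -
      have "(R1 + B)\<^sup>2 / (2 * \<sigma>\<^sup>2) \<le> (2 * R1\<^sup>2 + 2 * B\<^sup>2) / (2 * \<sigma>\<^sup>2)"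
        by (intro divide_right_mono square_add_le) auto
      also have "\<dots> = B\<^sup>2 / \<sigma>\<^sup>2 + (1/8) * l" unfolding R1sq using \<sigma> by (simp add: field_simps)
      finally have "K \<le> exp (B\<^sup>2 / \<sigma>\<^sup>2 + (1/8) * l)" by (simp add: K_def)
      thus ?thesis by (simp only: exp_add expl c2_def)
    qed
    have K0: "K > 0" by (simp add: K_def)
    have \<eta>: "\<eta> \<le> c1 * x powr (-1/64)"
    proof -
      have "R1\<^sup>2 \<le> 2 * (R1 - B)\<^sup>2 + 2 * B\<^sup>2" using square_add_le[of "R1 - B" B] by simp
      hence "- (R1 - B)\<^sup>2 / (4 * \<sigma>\<^sup>2) \<le> (B\<^sup>2 - R1\<^sup>2 / 2) / (4 * \<sigma>\<^sup>2)"
        by (intro divide_right_mono) auto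
      also have "\<dots> = B\<^sup>2 / (4 * \<sigma>\<^sup>2) + (-1/64) * l" unfolding R1sq using \<sigma> by (simp add: field_simps)
      finally have "exp (- (R1 - B)\<^sup>2 / (4 * \<sigma>\<^sup>2)) \<le> exp (B\<^sup>2 / (4 * \<sigma>\<^sup>2)) * x powr (-1/64)"
        unfolding expl[symmetric] exp_add[symmetric] by simp
      hence "2 powr (d / 2) * exp (- (R1 - B)\<^sup>2 / (4 * \<sigma>\<^sup>2)) \<le> 2 powr (d / 2) * (exp (B\<^sup>2 / (4 * \<sigma>\<^sup>2)) * x powr (-1/64))"
        by (rule mult_left_mono) simp
      thus ?thesis by (simp only: \<eta>_def c1_def mult.assoc)
    qed
    have \<eta>0: "\<eta> \<ge> 0" by (simp add: \<eta>_def)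
    have \<tau>': "\<tau>' \<le> c3 * x powr (-1/4)"
    proof -
      have "K / \<sigma> * (\<delta> * d) \<le> (c2 * x powr (1/8)) / \<sigma> * (\<delta> * d)"
        using K \<sigma> x0 d by (intro mult_right_mono divide_right_mono) (auto simp: \<delta>_def)
      also have "\<dots> = (c2 / \<sigma> * d) * (x powr (1/8) * x powr (-1))"
        using x0 by (simp add: \<delta>_def powr_minus_divide)
      also have "\<dots> \<le> (c2 / \<sigma> * d) * x powr (-1/4)"
        unfolding powr_add[symmetric] using c2 \<sigma> d x6 by (intro mult_left_mono powr_mono) auto
      finally have "K / \<sigma> * (\<delta> * d) \<le> (c2 / \<sigma> * d) * x powr (-1/4)" .
      moreover have "c3 * x powr (-1/4) = x powr (-1/4) + 2 * ((c2 / \<sigma> * d) * x powr (-1/4))"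
        unfolding c3_def by (simp only: distrib_right mult_1_left mult.assoc)
      ultimately show ?thesis unfolding \<tau>'_def \<tau>_def by linarith
    qed
    have \<tau>0: "\<tau> \<ge> 0" by (simp add: \<tau>_def)
    have \<tau>'0: "\<tau>' \<ge> 0" using \<tau>0 K0 \<sigma> d x0 by (simp add: \<tau>'_def \<delta>_def)
    have \<tau>'64: "\<tau>' \<le> c3 * x powr (-1/64)"
      using \<tau>' c3 x6 by (elim order_trans) (intro mult_left_mono powr_mono, auto)
    have V: "V \<le> c5 * l"
    proof -
      have "(B + r + B)\<^sup>2 \<le> 2 * (2 * B)\<^sup>2 + 2 * r\<^sup>2" using square_add_le[of "2 * B" r] by (simp add: algebra_simps)
      also have "\<dots> \<le> 8 * B\<^sup>2 * l + 8 * \<sigma>\<^sup>2 * ((2 + d) * l)"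
        using r2' mult_left_mono[OF l1, of "8 * B\<^sup>2"] by (simp add: power_mult_distrib)
      also have "\<dots> = (8 * B\<^sup>2 + 8 * \<sigma>\<^sup>2 * (2 + d)) * l" by (simp add: algebra_simps)
      finally have "V \<le> ((8 * B\<^sup>2 + 8 * \<sigma>\<^sup>2 * (2 + d)) * l) / (2 * \<sigma>\<^sup>2)"
        unfolding V_def by (rule divide_right_mono) simp
      thus ?thesis by (simp add: c5_def)
    qed
    have V0: "V \<ge> 0" by (simp add: V_def)
    have R2sq: "R2\<^sup>2 \<le> c4 * l"
    proof -
      have "R2\<^sup>2 \<le> 2 * B\<^sup>2 + 2 * r\<^sup>2" unfolding R2_def by (rule square_add_le)
      also have "\<dots> \<le> 2 * B\<^sup>2 * l + 8 * \<sigma>\<^sup>2 * ((2 + d) * l)"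
        using r2' mult_left_mono[OF l1, of "2 * B\<^sup>2"] by simp
      also have "\<dots> = c4 * l" by (simp add: c4_def algebra_simps)
      finally show ?thesis .
    qed
    have R2': "R2 \<le> sqrt c4 * sqrt l"
      using real_sqrt_le_mono[OF R2sq] R2 by (simp add: real_sqrt_mult)
    have sqrtl: "sqrt l \<le> l" using l1 self_le_power[of l 2] by (intro real_le_lsqrt) auto
    have sll: "sqrt l * sqrt l = l" using l1 by simp
    have N1: "real N + 1 \<le> c7 * l"
    proof -
      have "real N \<le> R2 * (k * sqrt l)" unfolding N_def using R2 k l1 by (simp add: of_nat_floor)
      also have "\<dots> \<le> sqrt c4 * sqrt l * (k * sqrt l)"
        using R2' k l1 by (intro mult_right_mono) auto
      also have "\<dots> = k * sqrt c4 * l" using sll by (metis mult.assoc mult.commute)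
      finally show ?thesis using l1 by (simp add: c7_def distrib_right)
    qed
    have N2: "R2 * (k * sqrt l) \<le> real (N + 2)" unfolding N_def by linarith
    have NR: "1 / R2 * real N \<le> k * sqrt l"
    proof -
      have "real N \<le> R2 * (k * sqrt l)" unfolding N_def using R2 k l1 by (simp add: of_nat_floor)
      thus ?thesis using R2 by (simp add: field_simps)
    qed
    have Z1: "R2 \<le> \<delta> * real Z"
    proof -
      have "x * R2 \<le> real Z" unfolding Z_def by linarith
      thus ?thesis using x0 by (simp add: \<delta>_def field_simps)
    qed
    have Z2: "2 * real Z + 1 \<le> x\<^sup>2"
    proof -
      have "x * R2 \<ge> 0" using x0 R2 by simp
      hence "real Z \<le> x * R2 + 1" unfolding Z_def by linarith
      also have "x * R2 \<le> x * (sqrt c4 * l)"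
        using R2' sqrtl x0 c4 by (intro mult_left_mono) (auto elim!: order_trans intro!: mult_left_mono)
      finally show ?thesis using a4 by linarith
    qed
    have \<tau>'1: "\<tau> + 2 * (exp ((R1 + B)\<^sup>2 / (2 * \<sigma>\<^sup>2)) / \<sigma> * (\<delta> * real DIM('a))) \<le> 1"
      using \<tau>' a3 by (simp add: \<tau>'_def K_def d_def)
    obtain A where A: "A \<in> sets (PiM {..<n} (\<lambda>_. gauss_vec \<sigma> :: 'a measure))"
      "measure (PiM {..<n} (\<lambda>_. gauss_vec \<sigma> :: 'a measure)) A \<ge> 1 - (x * (2 powr (d / 2) * exp (- r\<^sup>2 / (4 * \<sigma>\<^sup>2)))
        + (2 * (2 * real N + 1) ^ DIM('a) * (1 + (2 * real Z + 1) ^ DIM('a))) * (2 * exp (- x * \<tau>\<^sup>2 / (2 * K\<^sup>2))))"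
      "\<And>\<epsilon> p \<alpha> \<theta> j. \<epsilon> \<in> A \<Longrightarrow> is_npmle \<sigma> n (\<lambda>i. a (\<pi> i) + \<epsilon> i) p \<alpha> \<theta> \<Longrightarrow> j < p \<Longrightarrow> norm (\<theta> j) \<le> R2"
      "\<And>\<epsilon> p \<alpha> \<theta> t. \<epsilon> \<in> A \<Longrightarrow> is_npmle \<sigma> n (\<lambda>i. a (\<pi> i) + \<epsilon> i) p \<alpha> \<theta> \<Longrightarrow> t \<in> lattice (1 / R2) N \<Longrightarrow>
         cmod ((\<Sum>i<n. (1 / real n) *\<^sub>R cis (t \<bullet> a i)) - (\<Sum>j<p. \<alpha> j *\<^sub>R cis (t \<bullet> \<theta> j)))
           \<le> 2 * (exp (\<sigma>\<^sup>2 * (d * (1 / R2 * real N)\<^sup>2) / 2) * e)"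
      unfolding x_def d_def K_def e_def R2_def V_def \<eta>_def \<tau>'_def
      by (rule npmle_characteristic_function_close[where a = a and N = N and Z = Z and \<pi> = \<pi> and ?R1.0 = R1 and r = r and \<delta> = \<delta> and \<tau> = \<tau> and B = B and n = n, OF \<sigma> n_pos B _ r0 perm _ _ _ \<tau>0 \<tau>'1])
         (use a aB Z1 x0 in \<open>simp_all add: R1_def \<delta>_def R2_def\<close>)
    have p1: "x * (2 powr (d / 2) * exp (- r\<^sup>2 / (4 * \<sigma>\<^sup>2))) \<le> 1 / x"
    proof -
      have "- r\<^sup>2 / (4 * \<sigma>\<^sup>2) = - d + (-2) * l" unfolding r2 using \<sigma> by (simp add: field_simps)
      hence "exp (- r\<^sup>2 / (4 * \<sigma>\<^sup>2)) = exp (- d) * x powr (-2)" by (simp only: exp_add expl)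
      moreover have "x powr (-2) = 1 / x\<^sup>2" using x0 by (simp add: powr_minus_divide)
      moreover have "2 powr (d / 2) * exp (- d) \<le> 1"
      proof -
        have "2 powr (d / 2) \<le> exp 1 powr (d / 2)" using d exp_ge_add_one_self[of 1] by (intro powr_mono2) auto
        also have "\<dots> \<le> exp d" using d by (simp add: powr_def)
        finally show ?thesis by (simp add: exp_minus field_simps)
      qed
      ultimately have "x * (2 powr (d / 2) * exp (- r\<^sup>2 / (4 * \<sigma>\<^sup>2))) \<le> x * (1 * (1 / x\<^sup>2))"
        using x0 by (simp only: mult.assoc[symmetric]) (intro divide_right_mono mult_left_mono mult_right_mono, auto)
      thus ?thesis using x0 by (simp add: power2_eq_square)
    qed
    have p2: "(2 * (2 * real N + 1) ^ DIM('a) * (1 + (2 * real Z + 1) ^ DIM('a))) * (2 * exp (- x * \<tau>\<^sup>2 / (2 * K\<^sup>2))) \<le> 1 / x"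
    proof -
      have n1: "2 * real N + 1 \<le> x" using N1 a7 by linarith
      have "x * \<tau>\<^sup>2 = x powr (1/2)"
      proof -
        have "x * \<tau>\<^sup>2 = x powr 1 * (x powr (-1/4) * x powr (-1/4))" using x0 by (simp add: \<tau>_def power2_eq_square)
        thus ?thesis by (simp only: powr_add[symmetric]) simp
      qed
      moreover have "K\<^sup>2 \<le> c2\<^sup>2 * x powr (1/4)"
      proof -
        have "K\<^sup>2 \<le> (c2 * x powr (1/8))\<^sup>2" using K K0 by (intro power_mono) auto
        also have "\<dots> = c2\<^sup>2 * (x powr (1/8) * x powr (1/8))" by (simp add: power_mult_distrib power2_eq_square)
        finally show ?thesis by (simp flip: powr_add)
      qed
      hence "x powr (1/2) / (2 * (c2\<^sup>2 * x powr (1/4))) \<le> x powr (1/2) / (2 * K\<^sup>2)"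
        using K0 c2 x0 by (intro divide_left_mono) auto
      moreover have "x powr (1/2) / (2 * (c2\<^sup>2 * x powr (1/4))) = c * x powr (1/4)"
      proof -
        have "x powr (1/2) = x powr (1/4) * x powr (1/4)" by (simp flip: powr_add)
        thus ?thesis using x0 by (simp add: c_def)
      qed
      ultimately have "exp (- x * \<tau>\<^sup>2 / (2 * K\<^sup>2)) \<le> exp (- (c * x powr (1/4)))" by simp
      also have "\<dots> = 1 / exp (c * x powr (1/4))" by (simp add: exp_minus field_simps)
      also have "\<dots> \<le> 1 / (8 * x ^ (3 * DIM('a) + 1))"
        using aexp x0 by (intro divide_left_mono) auto
      finally have ex: "exp (- x * \<tau>\<^sup>2 / (2 * K\<^sup>2)) \<le> 1 / (8 * x ^ (3 * DIM('a) + 1))" .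
      have "(2 * real N + 1) ^ DIM('a) \<le> x ^ DIM('a)" using n1 by (intro power_mono) auto
      moreover have "1 + (2 * real Z + 1) ^ DIM('a) \<le> 2 * x ^ (2 * DIM('a))"
      proof -
        have "(2 * real Z + 1) ^ DIM('a) \<le> (x\<^sup>2) ^ DIM('a)" using Z2 by (intro power_mono) auto
        moreover have "1 \<le> x ^ (2 * DIM('a))" using x6 by (intro one_le_power) auto
        ultimately show ?thesis unfolding power_mult by linarith
      qed
      ultimately have "2 * (2 * real N + 1) ^ DIM('a) * (1 + (2 * real Z + 1) ^ DIM('a)) \<le> 2 * x ^ DIM('a) * (2 * x ^ (2 * DIM('a)))"
        using x0 by (intro mult_mono) auto
      also have "\<dots> = 4 * x ^ (3 * DIM('a))" by (simp flip: power_add)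
      finally have cnt: "2 * (2 * real N + 1) ^ DIM('a) * (1 + (2 * real Z + 1) ^ DIM('a)) \<le> 4 * x ^ (3 * DIM('a))" .
      have "(2 * (2 * real N + 1) ^ DIM('a) * (1 + (2 * real Z + 1) ^ DIM('a))) * (2 * exp (- x * \<tau>\<^sup>2 / (2 * K\<^sup>2)))
          \<le> (4 * x ^ (3 * DIM('a))) * (2 * (1 / (8 * x ^ (3 * DIM('a) + 1))))"
        by (rule mult_mono[OF cnt mult_left_mono[OF ex]]) (use x0 in auto)
      also have "\<dots> = 1 / x" using x0 by simp
      finally show ?thesis .
    qed
    \<comment> \<open>The noise bound and the Hoeffding bounds fail with probability at most 1/n
      each, within the allowed 5/n.\<close>
    have prob: "measure (PiM {..<n} (\<lambda>_. gauss_vec \<sigma> :: 'a measure)) A \<ge> 1 - 5 / real n"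
    proof -
      have "1 / x + 1 / x \<le> 5 / x" using x0 by (simp add: field_simps)
      thus ?thesis using A(2) p1 p2 unfolding x_def[symmetric] by linarith
    qed
    have e0: "e \<le> c6 * l * x powr (-1/128)"
    proof -
      have "(V + 2) * (\<eta> + \<tau>') \<le> ((c5 + 2) * l) * ((c1 + c3) * x powr (-1/64))"
      proof (rule mult_mono)
        show "V + 2 \<le> (c5 + 2) * l" using V l1 by (simp add: algebra_simps)
        show "\<eta> + \<tau>' \<le> (c1 + c3) * x powr (-1/64)" using \<eta> \<tau>'64 by (simp add: algebra_simps)
      qed (use \<eta>0 \<tau>'0 c5 l1 in auto)
      hence "6 * ((V + 2) * (\<eta> + \<tau>')) \<le> 6 * (((c5 + 2) * l) * ((c1 + c3) * x powr (-1/64)))"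
        by (rule mult_left_mono) simp
      also have "\<dots> = 6 * ((c5 + 2) * (c1 + c3)) * (l * x powr (-1/64))" by (simp only: mult_ac)
      finally have "sqrt (6 * ((V + 2) * (\<eta> + \<tau>'))) \<le> sqrt (6 * ((c5 + 2) * (c1 + c3)) * (l * x powr (-1/64)))"
        by (rule real_sqrt_le_mono)
      also have "\<dots> = sqrt (6 * ((c5 + 2) * (c1 + c3))) * (sqrt l * sqrt (x powr (-1/64)))"
        by (simp only: real_sqrt_mult)
      also have "sqrt (x powr (-1/64)) = x powr (-1/128)" by (simp add: powr_half_sqrt[symmetric] powr_powr)
      also have "sqrt (6 * ((c5 + 2) * (c1 + c3))) * (sqrt l * x powr (-1/128))
          \<le> sqrt (6 * ((c5 + 2) * (c1 + c3))) * (l * x powr (-1/128))"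
        using sqrtl c1 c3 c5 by (intro mult_left_mono mult_right_mono) auto
      finally have s: "sqrt (6 * ((V + 2) * (\<eta> + \<tau>'))) \<le> sqrt (6 * ((c5 + 2) * (c1 + c3))) * (l * x powr (-1/128))" .
      have "x powr (-1/64) \<le> x powr (-1/128)" using x6 by (intro powr_mono) auto
      also have "\<dots> \<le> l * x powr (-1/128)" using l1 mult_right_mono[of 1 l "x powr (-1/128)"] by simp
      finally have q: "x powr (-1/64) \<le> l * x powr (-1/128)" .
      have "\<eta> \<le> c1 * (l * x powr (-1/128))" "\<tau>' \<le> c3 * (l * x powr (-1/128))"
        using \<eta> \<tau>'64 mult_left_mono[OF q, of c1] mult_left_mono[OF q, of c3] c1 c3 by linarith+
      hence "e \<le> 2 * (sqrt (6 * ((c5 + 2) * (c1 + c3))) * (l * x powr (-1/128))) + 4 * (c3 * (l * x powr (-1/128))) + 2 * (c1 * (l * x powr (-1/128)))"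
        unfolding e_def using s by linarith
      also have "\<dots> = c6 * l * x powr (-1/128)" by (simp add: c6_def algebra_simps)
      finally show ?thesis .
    qed
    have e_nn: "e \<ge> 0" unfolding e_def using V0 \<eta>0 \<tau>'0 by simp
    define H where "H = 2 * (exp (\<sigma>\<^sup>2 * (d * (1 / R2 * real N)\<^sup>2) / 2) * e)"
    have H: "4 * R2\<^sup>2 * real (N + 1) ^ DIM('a) * H \<le> 1 / l"
    proof -
      have "\<sigma>\<^sup>2 * (d * (1 / R2 * real N)\<^sup>2) / 2 \<le> \<sigma>\<^sup>2 * (d * (k * sqrt l)\<^sup>2) / 2"
        using NR R2 d by (intro divide_right_mono mult_left_mono power_mono) auto
      also have "\<dots> = (1/512) * l" using l1 \<sigma> d by (simp add: power_mult_distrib k2 field_simps)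
      finally have "exp (\<sigma>\<^sup>2 * (d * (1 / R2 * real N)\<^sup>2) / 2) \<le> x powr (1/512)" unfolding expl[symmetric] by simp
      hence "H \<le> 2 * (x powr (1/512) * (c6 * l * x powr (-1/128)))"
        unfolding H_def using e0 e_nn by (intro mult_left_mono mult_mono) auto
      also have "\<dots> = 2 * c6 * l * (x powr (1/512) * x powr (-1/128))" by simp
      also have "x powr (1/512) * x powr (-1/128) = x powr (-3/512)" by (simp flip: powr_add)
      finally have H1: "H \<le> 2 * c6 * l * x powr (-3/512)" .
      have "4 * R2\<^sup>2 * real (N + 1) ^ DIM('a) * H \<le> 4 * (c4 * l) * (c7 * l) ^ DIM('a) * (2 * c6 * l * x powr (-3/512))"
        using R2sq N1 H1 c4 c7 l1 e_nn by (intro mult_mono power_mono) (auto simp: H_def)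
      also have "\<dots> = (c8 * l ^ (DIM('a) + 3)) * (x powr (-3/512) / l)"
        using l1 by (simp add: c8_def power_mult_distrib power_add power2_eq_square eval_nat_numeral mult_ac)
      also have "\<dots> \<le> x powr (3/512) * (x powr (-3/512) / l)"
        using a8 l1 by (intro mult_right_mono) auto
      also have "\<dots> = 1 / l" using x0 by (simp flip: powr_add)
      finally show ?thesis .
    qed
    have main: "16 * d * (R2 * (pi / real (N + 2)))\<^sup>2 \<le> 4096 * d\<^sup>2 * pi\<^sup>2 * \<sigma>\<^sup>2 / l"
    proof -
      have ks: "k * sqrt l > 0" using k l1 by simp
      have "R2 / real (N + 2) \<le> 1 / (k * sqrt l)" using N2 ks by (simp add: field_simps)
      hence "pi * (R2 / real (N + 2)) \<le> pi * (1 / (k * sqrt l))" by (intro mult_left_mono) auto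
      hence "(R2 * (pi / real (N + 2)))\<^sup>2 \<le> (pi * (1 / (k * sqrt l)))\<^sup>2"
        using R2 by (intro power_mono) (auto simp: mult_ac)
      also have "\<dots> = pi\<^sup>2 * (256 * \<sigma>\<^sup>2 * d) / l" using l1 k2 \<sigma> d by (simp add: power_mult_distrib power_divide)
      finally have "16 * d * (R2 * (pi / real (N + 2)))\<^sup>2 \<le> 16 * d * (pi\<^sup>2 * (256 * \<sigma>\<^sup>2 * d) / l)"
        using d by (intro mult_left_mono) auto
      also have "\<dots> = 4096 * d\<^sup>2 * pi\<^sup>2 * \<sigma>\<^sup>2 / l" by (simp add: power2_eq_square)
      finally show ?thesis .
    qed
    show "\<exists>A \<in> sets (PiM {..<n} (\<lambda>_. gauss_vec \<sigma> :: 'a measure)).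
       measure (PiM {..<n} (\<lambda>_. gauss_vec \<sigma> :: 'a measure)) A \<ge> 1 - 5 / real n \<and>
       (\<forall>\<epsilon>\<in>A. \<forall>p \<alpha> \<theta>. is_npmle \<sigma> n (\<lambda>i. a (\<pi> i) + \<epsilon> i) p \<alpha> \<theta> \<longrightarrow>
          (\<exists>\<gamma>. is_coupling n p \<alpha> \<gamma> \<and> (\<Sum>i<n. \<Sum>j<p. \<gamma> i j * (norm (a i - \<theta> j))\<^sup>2) \<le> C / ln (real n)))"
    proof (intro bexI[OF _ A(1)] conjI prob ballI allI impI)
      fix \<epsilon> p \<alpha> and \<theta> :: "nat \<Rightarrow> 'a" assume \<epsilon>: "\<epsilon> \<in> A" and npmle: "is_npmle \<sigma> n (\<lambda>i. a (\<pi> i) + \<epsilon> i) p \<alpha> \<theta>"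
      have \<alpha>: "\<And>j. j < p \<Longrightarrow> \<alpha> j \<ge> 0" "(\<Sum>j<p. \<alpha> j) = 1"
        using npmle by (auto simp: is_npmle_def less_imp_le)
      have aR: "norm (a i) \<le> R2" if "i < n" for i using a that r0 by (fastforce simp: R2_def)
      obtain \<gamma> where \<gamma>: "is_coupling n p \<alpha> \<gamma>" "(\<Sum>i<n. \<Sum>j<p. \<gamma> i j * (norm (a i - \<theta> j))\<^sup>2)
          \<le> 16 * real DIM('a) * (R2 * (pi / real (N + 2)))\<^sup>2 + 4 * R2\<^sup>2 * real (N + 1) ^ DIM('a) * H"
        using coupling_of_close_characteristic_functions[OF R2 n_pos aR A(3)[OF \<epsilon> npmle] \<alpha> A(4)[OF \<epsilon> npmle]]
        unfolding H_def by blast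
      note \<gamma>(2)
      also have "16 * real DIM('a) * (R2 * (pi / real (N + 2)))\<^sup>2 + 4 * R2\<^sup>2 * real (N + 1) ^ DIM('a) * H
          \<le> 4096 * d\<^sup>2 * pi\<^sup>2 * \<sigma>\<^sup>2 / l + 1 / l"
        using main H unfolding d_def by linarith
      also have "\<dots> = C / ln (real n)" by (simp add: C_def l_def x_def add_divide_distrib)
      finally show "\<exists>\<gamma>. is_coupling n p \<alpha> \<gamma> \<and> (\<Sum>i<n. \<Sum>j<p. \<gamma> i j * (norm (a i - \<theta> j))\<^sup>2) \<le> C / ln (real n)"
        using \<gamma>(1) by blast
    qed
  qed
qed

theorem theorem2:
  fixes B \<sigma> :: real
  assumes "B > 0" and "\<sigma> > 0"
  shows "\<exists>C0 C. C0 > 0 \<and> C > 0 \<and>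
    (\<forall>(n::nat) (X :: nat \<Rightarrow> real^'d) (\<pi> :: nat \<Rightarrow> nat) (f :: real^'d \<Rightarrow> real^'d)
       (\<psi> :: real^'d \<Rightarrow> real) (lam::real) (L::real).
      \<pi> permutes {..<n} \<longrightarrow>
      (\<forall>x. GDERIV \<psi> x :> f x) \<longrightarrow>
      lam > 0 \<longrightarrow> L > 0 \<longrightarrow>
      (\<forall>x z. \<psi> z \<ge> \<psi> x + f x \<bullet> (z - x) + lam / 2 * (norm (x - z))\<^sup>2) \<longrightarrow>
      (\<forall>x z. \<psi> z \<le> \<psi> x + f x \<bullet> (z - x) + L / 2 * (norm (x - z))\<^sup>2) \<longrightarrow>
      (\<forall>i<n. norm (f (X i)) \<le> B) \<longrightarrow>
      real n \<ge> C0 * (ln (real n)) ^ (CARD('d) + 1) \<longrightarrow>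
      (\<exists>A \<in> sets (PiM {..<n} (\<lambda>_. gauss_vec \<sigma> :: (real^'d) measure)).
         measure (PiM {..<n} (\<lambda>_. gauss_vec \<sigma> :: (real^'d) measure)) A \<ge> 1 - 5 / real n \<and>
         (\<forall>\<epsilon>\<in>A. \<forall>p \<alpha> \<theta> \<Gamma>.
            is_npmle \<sigma> n (\<lambda>i. f (X (\<pi> i)) + \<epsilon> i) p \<alpha> \<theta> \<longrightarrow>
            is_opt_coupling n p X \<theta> \<alpha> \<Gamma> \<longrightarrow>
            (1 / real n) * (\<Sum>i<n. (norm (bary_proj n p \<Gamma> \<theta> i - f (X i)))\<^sup>2)
              \<le> C * (L / lam) * (1 / ln (real n)))))"
proof -
  from npmle_wasserstein_rate[OF assms, where 'a = "real^'d"]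
  obtain n0 C where C: "C > 0" and rate: "\<forall>n (a :: nat \<Rightarrow> real^'d) \<pi>. n \<ge> n0 \<longrightarrow> \<pi> permutes {..<n} \<longrightarrow> (\<forall>i<n. norm (a i) \<le> B) \<longrightarrow>
    (\<exists>A \<in> sets (PiM {..<n} (\<lambda>_. gauss_vec \<sigma> :: (real^'d) measure)).
       measure (PiM {..<n} (\<lambda>_. gauss_vec \<sigma> :: (real^'d) measure)) A \<ge> 1 - 5 / real n \<and>
       (\<forall>\<epsilon>\<in>A. \<forall>p \<alpha> \<theta>. is_npmle \<sigma> n (\<lambda>i. a (\<pi> i) + \<epsilon> i) p \<alpha> \<theta> \<longrightarrow>
          (\<exists>\<gamma>. is_coupling n p \<alpha> \<gamma> \<and> (\<Sum>i<n. \<Sum>j<p. \<gamma> i j * (norm (a i - \<theta> j))\<^sup>2) \<le> C / ln (real n))))"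
    by (elim exE conjE) (rule that)
  show ?thesis
  \<comment> \<open>With C0 = n0 + 1 the size condition yields n >= n0 as soon as ln n >= 1.\<close>
  proof (rule exI[of _ "real (Suc n0)"], rule exI[of _ C], intro conjI allI impI)
    fix n :: nat and X :: "nat \<Rightarrow> real^'d" and \<pi> f \<psi> and lam L :: real
    let ?M = "PiM {..<n} (\<lambda>_. gauss_vec \<sigma> :: (real^'d) measure)"
    assume perm: "\<pi> permutes {..<n}" and grad: "\<forall>x. GDERIV \<psi> x :> f x" and lam: "lam > 0" and L: "L > 0"
      and conv: "\<forall>x z. \<psi> z \<ge> \<psi> x + f x \<bullet> (z - x) + lam / 2 * (norm (x - z))\<^sup>2"
      and smooth: "\<forall>x z. \<psi> z \<le> \<psi> x + f x \<bullet> (z - x) + L / 2 * (norm (x - z))\<^sup>2"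
      and bd: "\<forall>i<n. norm (f (X i)) \<le> B"
      and large: "real n \<ge> real (Suc n0) * (ln (real n)) ^ (CARD('d) + 1)"
    show "\<exists>A \<in> sets ?M. measure ?M A \<ge> 1 - 5 / real n \<and>
         (\<forall>\<epsilon>\<in>A. \<forall>p \<alpha> \<theta> \<Gamma>. is_npmle \<sigma> n (\<lambda>i. f (X (\<pi> i)) + \<epsilon> i) p \<alpha> \<theta> \<longrightarrow> is_opt_coupling n p X \<theta> \<alpha> \<Gamma> \<longrightarrow>
            (1 / real n) * (\<Sum>i<n. (norm (bary_proj n p \<Gamma> \<theta> i - f (X i)))\<^sup>2) \<le> C * (L / lam) * (1 / ln (real n)))"
    \<comment> \<open>For 1 <= n <= 5 the required probability is at most 0, so the empty event
      suffices. For n >= 6 the estimate exp 1 <= 3 gives ln n >= 1.\<close>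
    proof (cases "n \<le> 5")
      case True
      show ?thesis
      \<comment> \<open>At n = 0 the quotient \<open>5 / real n\<close> is 0, so an event of full
        probability is required. The error bound then holds on the whole space because the
        conventions for \<open>/\<close> and \<open>ln\<close> at 0 make it read 0 <= 0.\<close>
      proof (cases "n = 0")
        case True
        interpret prob_space ?M by (intro prob_space_PiM prob_space_gauss_vec assms)
        show ?thesis using True prob_space by (intro bexI[of _ "space ?M"]) auto
      next
        case False
        hence "1 - 5 / real n \<le> 0" using True by (simp add: field_simps)
        thus ?thesis by (intro bexI[of _ "{}"]) auto
      qed
    next
      case False
      have "exp 1 \<le> real n" using False exp_le by linarith
      hence "ln (real n) \<ge> 1" using False by (simp add: ln_ge_iff)
      hence "real (Suc n0) * 1 \<le> real (Suc n0) * (ln (real n)) ^ (CARD('d) + 1)"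
        by (intro mult_left_mono one_le_power) auto
      from order_trans[OF this large] have "n \<ge> n0" by simp
      from rate[rule_format, OF this perm, of "\<lambda>i. f (X i)"] bd obtain A where A: "A \<in> sets ?M" "measure ?M A \<ge> 1 - 5 / real n"
        "\<And>\<epsilon> p \<alpha> \<theta>. \<epsilon> \<in> A \<Longrightarrow> is_npmle \<sigma> n (\<lambda>i. f (X (\<pi> i)) + \<epsilon> i) p \<alpha> \<theta> \<Longrightarrow>
          \<exists>\<gamma>. is_coupling n p \<alpha> \<gamma> \<and> (\<Sum>i<n. \<Sum>j<p. \<gamma> i j * (norm (f (X i) - \<theta> j))\<^sup>2) \<le> C / ln (real n)"
        by blast
      show ?thesis
      proof (intro bexI[OF _ A(1)] conjI A(2) ballI allI impI)
        fix \<epsilon> p \<alpha> \<theta> \<Gamma>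
        assume "\<epsilon> \<in> A" "is_npmle \<sigma> n (\<lambda>i. f (X (\<pi> i)) + \<epsilon> i) p \<alpha> \<theta>" and opt: "is_opt_coupling n p X \<theta> \<alpha> \<Gamma>"
        then obtain \<gamma> where \<gamma>: "is_coupling n p \<alpha> \<gamma>" "(\<Sum>i<n. \<Sum>j<p. \<gamma> i j * (norm (f (X i) - \<theta> j))\<^sup>2) \<le> C / ln (real n)"
          using A(3) by blast
        have "(1 / real n) * (\<Sum>i<n. (norm (bary_proj n p \<Gamma> \<theta> i - f (X i)))\<^sup>2)
            \<le> (L / lam) * (\<Sum>i<n. \<Sum>j<p. \<gamma> i j * (norm (f (X i) - \<theta> j))\<^sup>2)"
          using grad conv smooth by (intro opt_coupling_stability[OF lam L _ _ _ opt \<gamma>(1)]) auto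
        also have "\<dots> \<le> (L / lam) * (C / ln (real n))"
          using \<gamma>(2) lam L by (intro mult_left_mono) auto
        finally show "(1 / real n) * (\<Sum>i<n. (norm (bary_proj n p \<Gamma> \<theta> i - f (X i)))\<^sup>2) \<le> C * (L / lam) * (1 / ln (real n))"
          by (simp add: mult_ac)
      qed
    qed
  qed (use C in auto)
qed

end
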